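(* Let $\mu\in\mathcal{P}_p(\mathbb{R}^N)$ be successively $\mathcal{W}_p$-continuous, let $K\subset\mathbb{R}$ be a (nonempty) compact set and let $\delta>0$. Assume that $f:\mathbb{R}^N\times\mathbb{R}^N\to\mathbb{R}$ is lower semicontinuous and satisfies one of the following: (a) $f$ is bounded from below; (b) there are $\varepsilon>0$ and a constant $C$ with $|f(x,\alpha)|\le C(1+\|x\|^{p-\varepsilon})$ for all $(x,\alpha)$. Define $V_N^\delta(x,y,\alpha):=f(y,\alpha)$ and, for $t=N-1,\dots,0$, $$V_t^\delta(x_{1:t},y_{1:t},\alpha_{1:t}):=\inf_{\alpha_{t+1}\in K}\ \sup_{\gamma^{t+1}\in\Pi_\delta(\mu_{x_{1:t}},\cdot)}\int V_{t+1}^\delta(x_{1:t+1},y_{1:t+1},\alpha_{1:t+1})\,\gamma^{t+1}(dx_{t+1},dy_{t+1}),$$ and $$V(\delta):=\inf_{\alpha\in\mathcal{A}}\ \sup_{\gamma\in\Pi_{\mathrm{bc},\delta}(\mu,\cdot)}\int f(y,\alpha(x,y))\,\gamma(dx,dy).$$ Then $V(\delta)=V_0^\delta$. Consequently, $V_t^\delta$ can be written as the cost-to-go function $$V_t^\delta(x_{1:t},y_{1:t},\alpha_{1:t})=\inf_{\alpha\in\mathcal{A}(\alpha_{1:t})}\ \sup_{\gamma\in\Pi_{\mathrm{bc},\delta}(\bar\mu_{x_{1:t}},\cdot)}\int f(y,\alpha)\,\gamma(dx_{t+1:N},dy_{t+1:N}),$$ where $\mathcal{A}(\alpha_{1:t})$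 is the set of predictable controls with the first $t$ values equal to $\alpha_{1:t}\in K^t$ (here $y=(y_{1:t},y_{t+1:N})$, $\alpha=\alpha(x,y)$ and $x_{1:t},y_{1:t}$ are held fixed).
   Context: Fix $N\in\mathbb{N}$ and $p\in[1,\infty)$. For $x\in\mathbb{R}^k$ let $\|x\|=(\sum_{t=1}^k|x_t|^p)^{1/p}$ and $x_{s:t}=(x_s,\dots,x_t)$. $\mathcal{P}(\mathbb{R}^k)$ is the set of Borel probability measures, $\mathcal{P}_p(\mathbb{R}^k)$ those with finite $p$-th moment, and $\mathcal{W}_p$ is the $p$-Wasserstein distance. For $\mu\in\mathcal{P}_p(\mathbb{R}^N)$ write the disintegration $\mu=\mu^1\otimes\mu_{x_1}\otimes\dots\otimes\mu_{x_{1:N-1}}$, where $\mu^1$ is the first marginal, $\mu_{x_{1:t}}\in\mathcal{P}(\mathbb{R})$ is the conditional distribution of the $(t+1)$-st coordinate given that the first $t$ coordinates equal $x_{1:t}$, $\mu_{x_{1:0}}:=\mu^1$, and let $\bar\mu_{x_{1:t}}=\mu_{x_{1:t}}\otimes\dots\otimes\mu_{x_{1:N-1}}$ be the conditional distribution on $\mathbb{R}^{N-t}$ of the coordinates $t+1,\dots,N$. $\mu$ is successively $\mathcal{W}_p$-continuous if $\mathbb{R}^t\ni x_{1:t}\mapsto\mu_{x_{1:t}}$ is continuous with respect to $\mathcal{W}_p$ for each $t=1,\dots,N-1$ (this version of the kernels is used). For $\pi\in\mathcal{P}(\mathbb{R}^2)$ set $\mathcal{C}_p(\pi)=(\int|x-y|^p\,\pi(dx,dy))^{1/p}$.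 For $\eta\in\mathcal{P}(\mathbb{R})$, $\Pi(\eta,\cdot)$ is the set of $\pi\in\mathcal{P}(\mathbb{R}^2)$ with first marginal $\eta$ and $\Pi_\delta(\eta,\cdot):=\{\pi\in\Pi(\eta,\cdot):\mathcal{C}_p(\pi)<\delta\}$. For two measures, $\Pi(\mu,\nu)$ denotes the set of couplings. $\Pi_\delta(\mu,\cdot)$, for $\mu$ on $\mathbb{R}^N$, is the set of measures $\gamma=\gamma^1\otimes\gamma_{x_1,y_1}\otimes\dots\otimes\gamma_{x_{1:N-1},y_{1:N-1}}$ on $\mathbb{R}^N\times\mathbb{R}^N$ with Borel measurable kernels $(x_{1:s},y_{1:s})\mapsto\gamma_{x_{1:s},y_{1:s}}$ (giving the conditional law of $(x_{s+1},y_{s+1})$) such that $\gamma_{x_{1:s-1},y_{1:s-1}}\in\Pi_\delta(\mu_{x_{1:s-1}},\cdot)$ for $s=1,\dots,N$ (with $\gamma_{x_{1:0},y_{1:0}}:=\gamma^1$). Such a $\gamma$ with second marginal $\nu$ is bicausal if $\gamma^1\in\Pi(\mu^1,\nu^1)$ and $\gamma_{x_{1:t},y_{1:t}}\in\Pi(\mu_{x_{1:t}},\nu_{y_{1:t}})$ for $\gamma$-a.e. $(x,y)$, $t=1,\dots,N-1$. Set $\Pi_{\mathrm{bc},\delta}(\mu,\cdot):=\{\gamma\in\Pi_\delta(\mu,\cdot):\gamma\text{ is bicausal}\}$; $\Pi_{\mathrm{bc},\delta}(\bar\mu_{x_{1:t}},\cdot)$ is defined in the same way with the measure $\bar\mu_{x_{1:t}}$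 on $\mathbb{R}^{N-t}$ and its kernels. $\mathcal{A}$ is the set of predictable controls: Borel measurable $\alpha=(\alpha_1,\dots,\alpha_N):\mathbb{R}^N\times\mathbb{R}^N\to K^N$ such that $\alpha_t(x,y)$ depends only on $(x_{1:t-1},y_{1:t-1})$.
   Formalization: If f is not bounded from below, the cost-to-go formula is claimed only at those x_{1:t} whose conditional law \bar\mu_{x_{1:t}} has finite p-th moment (this holds for \mu-a.e. x_{1:t}); elsewhere the integral of f may be undefined (infinity minus infinity). *)

theory Defs
  imports "HOL-Probability.Probability"
begin

section \<open>Euclidean spaces of varying dimension\<close>

text \<open>
  A point of $R^k$ is an extensional function on \<open>{..<k}\<close>, so coordinates are counted from 0:
  the coordinate $x_{t+1}$ is \<open>x t\<close>, and the prefix $x_{1:t}$ is \<open>restrict x {..<t}\<close>.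
\<close>

abbreviation Rn :: "nat \<Rightarrow> (nat \<Rightarrow> real) measure" where
  "Rn k \<equiv> Pi\<^sub>M {..<k} (\<lambda>_. borel)"

abbreviation Rn_top :: "nat \<Rightarrow> (nat \<Rightarrow> real) topology" where
  "Rn_top k \<equiv> product_topology (\<lambda>_. euclideanreal) {..<k}"

definition pnorm :: "real \<Rightarrow> nat \<Rightarrow> (nat \<Rightarrow> real) \<Rightarrow> real" where
  "pnorm p k x = (\<Sum>i<k. \<bar>x i\<bar> powr p) powr (1 / p)"

text \<open>The concatenation of a point of $R^t$ and a point of $R^s$.\<close>

definition glue :: "nat \<Rightarrow> nat \<Rightarrow> (nat \<Rightarrow> real) \<Rightarrow> (nat \<Rightarrow> real) \<Rightarrow> (nat \<Rightarrow> real)" where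
  "glue t s x z = (\<lambda>i\<in>{..<t + s}. if i < t then x i else z (i - t))"

definition lower_semicont :: "nat \<Rightarrow> ((nat \<Rightarrow> real) \<Rightarrow> (nat \<Rightarrow> real) \<Rightarrow> real) \<Rightarrow> bool" where
  "lower_semicont N f \<longleftrightarrow>
     (\<forall>c. openin (prod_topology (Rn_top N) (Rn_top N))
        {(x, a). x \<in> space (Rn N) \<and> a \<in> space (Rn N) \<and> c < f x a})"


section \<open>Integrals, moments and the Wasserstein distance\<close>

text \<open>
  The integral of an extended real function as the integral of the positive part minus that of
  the negative part. It is the usual one whenever at most one of the two is infinite.
\<close>

definition ereal_integral :: "'a measure \<Rightarrow> ('a \<Rightarrow> ereal) \<Rightarrow> ereal" where
  "ereal_integral M h =
     enn2ereal (\<integral>\<^sup>+z. e2ennreal (h z) \<partial>M) - enn2ereal (\<integral>\<^sup>+z. e2ennreal (- h z) \<partial>M)"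

definition ennreal_powr :: "ennreal \<Rightarrow> real \<Rightarrow> ennreal" where
  "ennreal_powr a r = (if a = \<top> then \<top> else ennreal (enn2real a powr r))"

definition Pp :: "real \<Rightarrow> nat \<Rightarrow> (nat \<Rightarrow> real) measure set" where
  "Pp p k = {\<mu> \<in> space (prob_algebra (Rn k)). (\<integral>\<^sup>+x. ennreal (pnorm p k x powr p) \<partial>\<mu>) < \<top>}"

definition Pp_real :: "real \<Rightarrow> real measure set" where
  "Pp_real p = {\<eta> \<in> space (prob_algebra borel). (\<integral>\<^sup>+x. ennreal (\<bar>x\<bar> powr p) \<partial>\<eta>) < \<top>}"

definition couplings :: "'a measure \<Rightarrow> 'b measure \<Rightarrow> ('a \<times> 'b) measure set" where
  "couplings M M' =
     {\<pi> \<in> space (prob_algebra (M \<Otimes>\<^sub>M M')). distr \<pi> M fst = M \<and> distr \<pi> M' snd = M'}"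

definition pcost :: "real \<Rightarrow> (real \<times> real) measure \<Rightarrow> ennreal" where
  "pcost p \<pi> = ennreal_powr (\<integral>\<^sup>+(x, y). ennreal (\<bar>x - y\<bar> powr p) \<partial>\<pi>) (1 / p)"

definition wasserstein :: "real \<Rightarrow> real measure \<Rightarrow> real measure \<Rightarrow> ennreal" where
  "wasserstein p \<eta> \<nu> = (INF \<pi>\<in>couplings \<eta> \<nu>. pcost p \<pi>)"


section \<open>Disintegrations\<close>

text \<open>
  A family \<open>\<kappa>\<close> of kernels stands for $(\mu_{x_{1:t}})_t$ via \<open>\<kappa> t x\<close> with \<open>x\<close> in $R^t$;
  \<open>\<kappa> 0\<close> is evaluated only at the single point of $R^0$.
\<close>

primrec kernel_prod ::
    "(nat \<Rightarrow> (nat \<Rightarrow> real) \<Rightarrow> real measure) \<Rightarrow> nat \<Rightarrow> (nat \<Rightarrow> real) measure" where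
  "kernel_prod \<kappa> 0 = return (Rn 0) (\<lambda>_. undefined)"
| "kernel_prod \<kappa> (Suc n) =
     kernel_prod \<kappa> n \<bind> (\<lambda>x. distr (\<kappa> n x) (Rn (Suc n)) (\<lambda>u. x(n := u)))"

definition disintegration ::
    "nat \<Rightarrow> (nat \<Rightarrow> real) measure \<Rightarrow> (nat \<Rightarrow> (nat \<Rightarrow> real) \<Rightarrow> real measure) \<Rightarrow> bool" where
  "disintegration N \<mu> \<kappa> \<longleftrightarrow>
     (\<forall>t<N. \<kappa> t \<in> Rn t \<rightarrow>\<^sub>M prob_algebra borel) \<and> \<mu> = kernel_prod \<kappa> N"

text \<open>For \<open>t = 0\<close> the continuity clause is void since $R^0$ is a point.\<close>

definition successively_continuous ::
    "real \<Rightarrow> nat \<Rightarrow> (nat \<Rightarrow> (nat \<Rightarrow> real) \<Rightarrow> real measure) \<Rightarrow> bool" where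
  "successively_continuous p N \<kappa> \<longleftrightarrow>
     (\<forall>t<N. \<forall>x\<in>space (Rn t). \<kappa> t x \<in> Pp_real p \<and>
        ((\<lambda>x'. wasserstein p (\<kappa> t x') (\<kappa> t x)) \<longlongrightarrow> 0) (atin (Rn_top t) x))"

text \<open>
  The kernels of the conditional law of the coordinates after the first \<open>t\<close> ones, given that these
  are \<open>x\<close>. That law on $R^{N-t}$ is \<open>kernel_prod (tail_kernels t x \<kappa>) (N - t)\<close>.
\<close>

definition tail_kernels ::
    "nat \<Rightarrow> (nat \<Rightarrow> real) \<Rightarrow> (nat \<Rightarrow> (nat \<Rightarrow> real) \<Rightarrow> real measure) \<Rightarrow>
     nat \<Rightarrow> (nat \<Rightarrow> real) \<Rightarrow> real measure" where
  "tail_kernels t x \<kappa> s z = \<kappa> (t + s) (glue t s x z)"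


section \<open>Sets of couplings\<close>

text \<open>The set $\Pi_\delta(\eta, \cdot)$ for a measure on the real line.\<close>

definition Pi_delta_real :: "real \<Rightarrow> real \<Rightarrow> real measure \<Rightarrow> (real \<times> real) measure set" where
  "Pi_delta_real p \<delta> \<eta> =
     {\<pi> \<in> space (prob_algebra borel). distr \<pi> borel fst = \<eta> \<and> pcost p \<pi> < ennreal \<delta>}"

type_synonym pair_kernels =
  "nat \<Rightarrow> (nat \<Rightarrow> real) \<times> (nat \<Rightarrow> real) \<Rightarrow> (real \<times> real) measure"

primrec pair_kernel_prod ::
    "pair_kernels \<Rightarrow> nat \<Rightarrow> ((nat \<Rightarrow> real) \<times> (nat \<Rightarrow> real)) measure" where
  "pair_kernel_prod g 0 = return (Rn 0 \<Otimes>\<^sub>M Rn 0) (\<lambda>_. undefined, \<lambda>_. undefined)"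
| "pair_kernel_prod g (Suc n) =
     pair_kernel_prod g n \<bind>
       (\<lambda>(x, y). distr (g n (x, y)) (Rn (Suc n) \<Otimes>\<^sub>M Rn (Suc n)) (\<lambda>(u, v). (x(n := u), y(n := v))))"

definition delta_kernels ::
    "real \<Rightarrow> real \<Rightarrow> nat \<Rightarrow> (nat \<Rightarrow> (nat \<Rightarrow> real) \<Rightarrow> real measure) \<Rightarrow> pair_kernels \<Rightarrow> bool" where
  "delta_kernels p \<delta> n \<kappa> g \<longleftrightarrow>
     (\<forall>s<n. g s \<in> Rn s \<Otimes>\<^sub>M Rn s \<rightarrow>\<^sub>M prob_algebra borel \<and>
        (\<forall>x\<in>space (Rn s). \<forall>y\<in>space (Rn s). g s (x, y) \<in> Pi_delta_real p \<delta> (\<kappa> s x)))"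

text \<open>
  The kernels \<open>\<nu>\<^sub>k\<close> disintegrate the second marginal. They and \<open>g\<close> are unique up to null
  sets, so the condition does not depend on the chosen versions.
\<close>

definition bicausal ::
    "nat \<Rightarrow> (nat \<Rightarrow> (nat \<Rightarrow> real) \<Rightarrow> real measure) \<Rightarrow> pair_kernels \<Rightarrow> bool" where
  "bicausal n \<kappa> g \<longleftrightarrow>
     (\<exists>\<nu>\<^sub>k. disintegration n (distr (pair_kernel_prod g n) (Rn n) snd) \<nu>\<^sub>k \<and>
        (\<forall>t<n. AE (x, y) in pair_kernel_prod g n.
           g t (restrict x {..<t}, restrict y {..<t})
             \<in> couplings (\<kappa> t (restrict x {..<t})) (\<nu>\<^sub>k t (restrict y {..<t}))))"

text \<open>The set $\Pi_{bc,\delta}(\mu, \cdot)$ for the measure on $R^n$ with kernels \<open>\<kappa>\<close>.\<close>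

definition Pi_bc_delta ::
    "real \<Rightarrow> real \<Rightarrow> nat \<Rightarrow> (nat \<Rightarrow> (nat \<Rightarrow> real) \<Rightarrow> real measure) \<Rightarrow>
     ((nat \<Rightarrow> real) \<times> (nat \<Rightarrow> real)) measure set" where
  "Pi_bc_delta p \<delta> n \<kappa> =
     {pair_kernel_prod g n | g. delta_kernels p \<delta> n \<kappa> g \<and> bicausal n \<kappa> g}"


section \<open>Controls and value functions\<close>

definition controls ::
    "nat \<Rightarrow> real set \<Rightarrow> ((nat \<Rightarrow> real) \<times> (nat \<Rightarrow> real) \<Rightarrow> (nat \<Rightarrow> real)) set" where
  "controls N K =
     {\<alpha> \<in> Rn N \<Otimes>\<^sub>M Rn N \<rightarrow>\<^sub>M Rn N.
        (\<forall>x\<in>space (Rn N). \<forall>y\<in>space (Rn N). \<forall>t<N. \<alpha> (x, y) t \<in> K) \<and>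
        (\<forall>x\<in>space (Rn N). \<forall>y\<in>space (Rn N). \<forall>x'\<in>space (Rn N). \<forall>y'\<in>space (Rn N). \<forall>t<N.
           (\<forall>i<t. x i = x' i \<and> y i = y' i) \<longrightarrow> \<alpha> (x, y) t = \<alpha> (x', y') t)}"

text \<open>The set $A(\alpha_{1:t})$, with \<open>a\<close> for $\alpha_{1:t}$.\<close>

definition controls_from ::
    "nat \<Rightarrow> real set \<Rightarrow> nat \<Rightarrow> (nat \<Rightarrow> real) \<Rightarrow>
     ((nat \<Rightarrow> real) \<times> (nat \<Rightarrow> real) \<Rightarrow> (nat \<Rightarrow> real)) set" where
  "controls_from N K t a =
     {\<alpha> \<in> controls N K. \<forall>x\<in>space (Rn N). \<forall>y\<in>space (Rn N). \<forall>i<t. \<alpha> (x, y) i = a i}"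

text \<open>\<open>dpp_value p \<delta> K \<kappa> f N t x y a\<close> is $V_t^\delta(x_{1:t}, y_{1:t}, \alpha_{1:t})$ for \<open>t \<le> N\<close>.\<close>

function dpp_value ::
    "real \<Rightarrow> real \<Rightarrow> real set \<Rightarrow> (nat \<Rightarrow> (nat \<Rightarrow> real) \<Rightarrow> real measure) \<Rightarrow>
     ((nat \<Rightarrow> real) \<Rightarrow> (nat \<Rightarrow> real) \<Rightarrow> real) \<Rightarrow> nat \<Rightarrow> nat \<Rightarrow>
     (nat \<Rightarrow> real) \<Rightarrow> (nat \<Rightarrow> real) \<Rightarrow> (nat \<Rightarrow> real) \<Rightarrow> ereal" where
  "dpp_value p \<delta> K \<kappa> f N t x y a =
     (if N \<le> t then ereal (f y a)
      else INF b\<in>K. SUP \<gamma>\<in>Pi_delta_real p \<delta> (\<kappa> t x).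
        ereal_integral \<gamma>
          (\<lambda>(u, v). dpp_value p \<delta> K \<kappa> f N (Suc t) (x(t := u)) (y(t := v)) (a(t := b))))"
  by pat_completeness auto
termination
  by (relation "Wellfounded.measure (\<lambda>(p, \<delta>, K, \<kappa>, f, N, t, x, y, a). N - t)") auto

declare dpp_value.simps [simp del]

text \<open>The value $V(\delta)$.\<close>

definition robust_value ::
    "real \<Rightarrow> real \<Rightarrow> real set \<Rightarrow> (nat \<Rightarrow> (nat \<Rightarrow> real) \<Rightarrow> real measure) \<Rightarrow>
     ((nat \<Rightarrow> real) \<Rightarrow> (nat \<Rightarrow> real) \<Rightarrow> real) \<Rightarrow> nat \<Rightarrow> ereal" where
  "robust_value p \<delta> K \<kappa> f N =
     (INF \<alpha>\<in>controls N K. SUP \<gamma>\<in>Pi_bc_delta p \<delta> N \<kappa>.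
        ereal_integral \<gamma> (\<lambda>(x, y). ereal (f y (\<alpha> (x, y)))))"

text \<open>The cost-to-go from time \<open>t\<close>; \<open>u\<close> and \<open>v\<close> are the coordinates after the first \<open>t\<close> ones.\<close>

definition cost_to_go ::
    "real \<Rightarrow> real \<Rightarrow> real set \<Rightarrow> (nat \<Rightarrow> (nat \<Rightarrow> real) \<Rightarrow> real measure) \<Rightarrow>
     ((nat \<Rightarrow> real) \<Rightarrow> (nat \<Rightarrow> real) \<Rightarrow> real) \<Rightarrow> nat \<Rightarrow> nat \<Rightarrow>
     (nat \<Rightarrow> real) \<Rightarrow> (nat \<Rightarrow> real) \<Rightarrow> (nat \<Rightarrow> real) \<Rightarrow> ereal" where
  "cost_to_go p \<delta> K \<kappa> f N t x y a =
     (INF \<alpha>\<in>controls_from N K t a. SUP \<gamma>\<in>Pi_bc_delta p \<delta> (N - t) (tail_kernels t x \<kappa>).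
        ereal_integral \<gamma>
          (\<lambda>(u, v). ereal (f (glue t (N - t) y v)
             (\<alpha> (glue t (N - t) x u, glue t (N - t) y v)))))"

end

theory Submission
  imports Defs
begin

text \<open>
  The supremum over $\Pi_\delta(\mu_{x_{1:t}}, \cdot)$ is turned into one over a set of laws that does not depend on
  \<open>x\<close>: with a uniform \<open>w\<close> and the quantile function \<open>q\<close> of the first marginal, every coupling is the law of
  \<open>(q w, q w + z)\<close> for a law of \<open>(w, z)\<close> with $p$-th moment of \<open>z\<close> below $\delta^p$. Quantiles converge almost
  everywhere along weakly convergent kernels, so for nonnegative costs Fatou's lemma makes all value functions
  lower semicontinuous, the least minimizer is a measurable optimal control, and by the Lindelof property
  countably many couplings suffice for measurable nearly optimal kernels. Bicausality comes for free after an
  arbitrarily small perturbation of the second coordinate that encodes the first one in it.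

  Under the growth condition the value functions need not be lower semicontinuous in \<open>x\<close>. Adding
  $A + \theta \|x\|^p + \theta \|y - x\|^p$ makes the cost nonnegative; the part in \<open>x\<close> has the same integral
  under all admissible couplings and the other part costs at most $\theta N \delta^p$, where \<open>\<theta>\<close> is arbitrarily small.
\<close>

section \<open>Lower semicontinuous functions\<close>

text \<open>Bicausality asks that the conditional law of the next \<open>y\<close> depend on the
  past of \<open>y\<close> only. This is automatic if the past of \<open>x\<close> is a function of
  the past of \<open>y\<close>, which the encoding enforces. The perturbation is affordable for two
  reasons: the cost constraint is strict, so small changes stay admissible, and the value functions
  are lower semicontinuous, so the integral does not drop in the limit. The upper bound holds for
  all admissible kernels, bicausal or not.

  The quantile representation has to cover first marginals with atoms, where \<open>w\<close> is not
  determined by \<open>x\<close>; an auxiliary uniform variable spreads each atom over the jump of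
  the distribution function.

  Selection from countably many couplings requires strict slack, which each step consumes; it is
  restored by aiming at a target below the next value.

  For signed costs the original value functions are not shown to be measurable. They are enclosed
  between quantities of the penalized problem, using only that integrals are monotone. The
  conditional mean of the penalty in \<open>x\<close> may be infinite at exceptional states, which
  form null sets.\<close>

definition lsc :: "('a::topological_space \<Rightarrow> ennreal) \<Rightarrow> bool" where
  "lsc f \<longleftrightarrow> (\<forall>c. open {z. c < f z})"

lemma lsc_measurable: "lsc f \<Longrightarrow> f \<in> borel_measurable borel"
  unfolding lsc_def by (intro borel_measurableI_greater) auto

lemma lsc_liminf:
  assumes "lsc f" and "X \<longlonglongrightarrow> z"
  shows "f z \<le> liminf (\<lambda>n. f (X n))"
  unfolding le_Liminf_iff
proof safe
  fix c assume "c < f z"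
  then have "\<forall>\<^sub>F n in sequentially. X n \<in> {z. c < f z}"
    using assms by (intro topological_tendstoD[OF assms(2)]) (auto simp: lsc_def)
  then show "\<forall>\<^sub>F n in sequentially. c < f (X n)"
    by simp
qed

lemma lscI_liminf:
  fixes f :: "'a::first_countable_topology \<Rightarrow> ennreal"
  assumes "\<And>X z. X \<longlonglongrightarrow> z \<Longrightarrow> f z \<le> liminf (\<lambda>n. f (X n))"
  shows "lsc f"
  unfolding lsc_def
proof
  fix c
  have "closed {z. f z \<le> c}"
    unfolding closed_sequential_limits
  proof safe
    fix X z assume X: "\<forall>n. X n \<in> {z. f z \<le> c}" "X \<longlonglongrightarrow> z"
    have "f z \<le> liminf (\<lambda>n. f (X n))"
      by (rule assms) fact
    also have "\<dots> \<le> liminf (\<lambda>n::nat. c)"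
      using X(1) by (intro Liminf_mono always_eventually) auto
    finally show "f z \<le> c"
      by (simp add: Liminf_const)
  qed
  then show "open {z. c < f z}"
    by (simp add: closed_def Compl_eq not_le)
qed

lemma lsc_SUP:
  assumes "\<And>i. i \<in> I \<Longrightarrow> lsc (f i)"
  shows "lsc (\<lambda>z. SUP i\<in>I. f i z)"
  unfolding lsc_def
proof
  fix c
  have "{z. c < (SUP i\<in>I. f i z)} = (\<Union>i\<in>I. {z. c < f i z})"
    by (auto simp: less_SUP_iff)
  then show "open {z. c < (SUP i\<in>I. f i z)}"
    using assms by (auto simp: lsc_def)
qed

lemma lsc_compose:
  assumes "lsc f" and "continuous_on UNIV g"
  shows "lsc (\<lambda>z. f (g z))"
  unfolding lsc_def
proof
  fix c
  have "open (g -` {z. c < f z})"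
    using assms by (intro open_vimage) (auto simp: lsc_def)
  then show "open {z. c < f (g z)}"
    by (simp add: vimage_def)
qed

text \<open>At each rational level \<open>q\<close>, Lindelof extracts countably many of the open
  sets \<open>{z. c q < f i z}\<close> with the same union. Collecting these indices over all
  \<open>q\<close> gives one \<open>C\<close> for all points, since a rational level would separate
  two different suprema.\<close>

lemma lsc_SUP_countable:
  fixes f :: "'i \<Rightarrow> 'a::second_countable_topology \<Rightarrow> ennreal"
  assumes "\<And>i. i \<in> I \<Longrightarrow> lsc (f i)"
  obtains C where "C \<subseteq> I" and "countable C" and "\<And>z. (SUP i\<in>I. f i z) = (SUP i\<in>C. f i z)"
proof -
  define c where "c q = ennreal (real_of_rat q)" for q
  have "\<exists>C\<subseteq>I. countable C \<and> (\<Union>i\<in>I. {z. c q < f i z}) = (\<Union>i\<in>C. {z. c q < f i z})" for q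
  proof -
    obtain F where F: "F \<subseteq> (\<lambda>i. {z. c q < f i z}) ` I" "countable F"
        "\<Union>F = \<Union>((\<lambda>i. {z. c q < f i z}) ` I)"
      using Lindelof[of "(\<lambda>i. {z. c q < f i z}) ` I"] assms unfolding lsc_def by blast
    then obtain C where "C \<subseteq> I" "countable C" "F = (\<lambda>i. {z. c q < f i z}) ` C"
      by (metis countable_subset_image)
    with F show ?thesis by metis
  qed
  then obtain C where C: "\<And>q. C q \<subseteq> I" "\<And>q. countable (C q)"
      "\<And>q. (\<Union>i\<in>I. {z. c q < f i z}) = (\<Union>i\<in>C q. {z. c q < f i z})"
    by metis
  show thesis
  proof
    show "(\<Union>q. C q) \<subseteq> I" using C by auto
    show "countable (\<Union>q. C q)" using C by auto
    fix z
    show "(SUP i\<in>I. f i z) = (SUP i\<in>(\<Union>q. C q). f i z)" (is "?L = ?R")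
    proof (rule antisym)
      show "?R \<le> ?L" using C by (intro SUP_subset_mono) auto
      show "?L \<le> ?R"
      proof (rule ccontr)
        assume "\<not> ?L \<le> ?R"
        then obtain r' where r': "?R < r'" "r' < ?L"
          using dense[of ?R ?L] by (auto simp: not_le)
        then obtain r where r: "?R < ennreal r" "ennreal r < ?L" "0 \<le> r"
          by (cases r') auto
        obtain s where s: "ennreal r < s" "s < ?L" using dense r(2) by blast
        then obtain s' where s': "s = ennreal s'" "0 \<le> s'" "r < s'"
          using r(3) by (cases s) (auto simp: ennreal_less_iff)
        then obtain q where q: "r < real_of_rat q" "real_of_rat q < s'"
          using of_rat_dense by blast
        have "c q < ?L"
          using ennreal_leI[of "real_of_rat q" s'] q(2) s(2) s'(1)
          by (auto simp: c_def intro: order.strict_trans1)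
        then have "z \<in> (\<Union>i\<in>C q. {z. c q < f i z})"
          unfolding C(3)[symmetric] by (auto simp: less_SUP_iff)
        then have "c q < ?R"
          by (auto simp: less_SUP_iff)
        moreover have "ennreal r \<le> c q"
          unfolding c_def using q by (intro ennreal_leI) simp
        ultimately show False using r(1) by simp
      qed
    qed
  qed
qed

lemma lsc_attains_inf:
  fixes f :: "'a::metric_space \<Rightarrow> ennreal"
  assumes "lsc f" and "compact K" and "K \<noteq> {}"
  shows "\<exists>b\<in>K. f b = (INF b\<in>K. f b)"
proof -
  obtain s where s: "\<And>n. s n \<in> f ` K" "s \<longlonglongrightarrow> Inf (f ` K)"
    using Inf_as_limit[of "f ` K"] assms(3) by auto
  then have "\<forall>n. \<exists>x. x \<in> K \<and> s n = f x"
    by auto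
  then obtain X where X: "\<And>n. X n \<in> K" "\<And>n. s n = f (X n)"
    by metis
  obtain b r where b: "b \<in> K" "strict_mono (r :: nat \<Rightarrow> nat)" "(X \<circ> r) \<longlonglongrightarrow> b"
    using assms(2) X(1) unfolding compact_def by metis
  have "f b \<le> liminf (\<lambda>n. f ((X \<circ> r) n))"
    by (rule lsc_liminf) fact+
  also have "\<dots> = Inf (f ` K)"
    using LIMSEQ_subseq_LIMSEQ[OF s(2) b(2)] X(2)
    by (intro lim_imp_Liminf) (auto simp: o_def)
  finally have "f b = Inf (f ` K)"
    using b(1) by (intro antisym INF_lower)
  with b(1) show ?thesis by blast
qed

lemma lsc_slice:
  assumes "lsc (\<lambda>(x, b). f x b)"
  shows "lsc (f x)"
  using lsc_compose[OF assms, of "\<lambda>b. (x, b)"] by (simp add: continuous_on_Pair)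

text \<open>Sublevel sets are closed: minimizers along a convergent sequence of parameters have a
  limit point in the compact \<open>K\<close>, and joint semicontinuity applies there.
  Semicontinuity in \<open>x\<close> for each fixed \<open>b\<close> would not suffice.\<close>

lemma lsc_INF:
  fixes f :: "'a::first_countable_topology \<Rightarrow> 'b::metric_space \<Rightarrow> ennreal"
  assumes f: "lsc (\<lambda>(x, b). f x b)" and K: "compact K"
  shows "lsc (\<lambda>x. INF b\<in>K. f x b)"
proof (cases "K = {}")
  case False
  show ?thesis
    unfolding lsc_def
  proof
    fix c
    have "closed {x. (INF b\<in>K. f x b) \<le> c}"
      unfolding closed_sequential_limits
    proof safe
      fix X x assume X: "\<forall>n. X n \<in> {x. (INF b\<in>K. f x b) \<le> c}" "X \<longlonglongrightarrow> x"
      have "\<exists>b\<in>K. f (X n) b \<le> c" for n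
        using lsc_attains_inf[OF lsc_slice[OF f] K False, of "X n"] X(1) by (metis mem_Collect_eq)
      then obtain B where B: "\<And>n. B n \<in> K" "\<And>n. f (X n) (B n) \<le> c" by metis
      obtain b r where b: "b \<in> K" "strict_mono (r :: nat \<Rightarrow> nat)" "(B \<circ> r) \<longlonglongrightarrow> b"
        using K B(1) unfolding compact_def by metis
      have "(\<lambda>n. ((X \<circ> r) n, (B \<circ> r) n)) \<longlonglongrightarrow> (x, b)"
        using LIMSEQ_subseq_LIMSEQ[OF X(2) b(2)] b(3) by (rule tendsto_Pair)
      from lsc_liminf[OF f this] have "f x b \<le> liminf (\<lambda>n. f (X (r n)) (B (r n)))"
        by simp
      also have "\<dots> \<le> liminf (\<lambda>n::nat. c)"
        using B by (intro Liminf_mono always_eventually) auto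
      finally show "(INF b\<in>K. f x b) \<le> c"
        using b(1) by (auto simp: Liminf_const intro: INF_lower2)
    qed
    then show "open {x. c < (INF b\<in>K. f x b)}"
      by (simp add: closed_def Compl_eq not_le)
  qed
qed (simp add: lsc_def)

text \<open>The selector is the least minimizer: it is at most \<open>c\<close> if and only if the infimum over
  \<open>K \<inter> {..c}\<close>, which is again lower semicontinuous in \<open>x\<close>, is the infimum over \<open>K\<close>.\<close>

lemma lsc_measurable_minimizer:
  fixes f :: "'a::second_countable_topology \<Rightarrow> real \<Rightarrow> ennreal"
  assumes f: "lsc (\<lambda>(x, b). f x b)" and K: "compact K" "K \<noteq> {}"
  obtains m where "m \<in> borel_measurable borel" and "\<And>x. m x \<in> K"
    and "\<And>x. f x (m x) = (INF b\<in>K. f x b)"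
proof -
  define A where "A x = {b \<in> K. f x b \<le> (INF b\<in>K. f x b)}" for x
  have A: "Inf (A x) \<in> A x" "c \<in> A x \<Longrightarrow> Inf (A x) \<le> c" for x c
  proof -
    have "closed {b. f x b \<le> (INF b\<in>K. f x b)}"
      using lsc_slice[OF f, of x] unfolding lsc_def by (simp add: closed_def Compl_eq not_le)
    then have "compact (K \<inter> {b. f x b \<le> (INF b\<in>K. f x b)})"
      by (rule compact_Int_closed[OF K(1)])
    then have "compact (A x)"
      by (simp add: A_def Int_def)
    then have cl: "closed (A x)" "bdd_below (A x)"
      by (auto simp: compact_imp_closed bounded_imp_bdd_below compact_imp_bounded)
    have "A x \<noteq> {}"
      using lsc_attains_inf[OF lsc_slice[OF f] K, of x] by (auto simp: A_def)
    then show "Inf (A x) \<in> A x" using cl by (intro closed_contains_Inf) auto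
    show "c \<in> A x \<Longrightarrow> Inf (A x) \<le> c" using cl by (intro cInf_lower)
  qed
  show thesis
  proof
    show "(\<lambda>x. Inf (A x)) \<in> borel_measurable borel"
    proof (rule borel_measurableI_le)
      fix c
      show "{x \<in> space borel. Inf (A x) \<le> c} \<in> sets borel"
      proof (cases "K \<inter> {..c} = {}")
        case True
        then have "{x. Inf (A x) \<le> c} = {}"
          using A by (fastforce simp: A_def)
        then show ?thesis by simp
      next
        case False
        have K': "compact (K \<inter> {..c})" using K by (intro compact_Int_closed) auto
        have "{x. Inf (A x) \<le> c} = {x. (INF b\<in>K \<inter> {..c}. f x b) \<le> (INF b\<in>K. f x b)}"
        proof safe
          fix x assume "Inf (A x) \<le> c"
          with A(1)[of x] show "(INF b\<in>K \<inter> {..c}. f x b) \<le> (INF b\<in>K. f x b)"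
            by (intro INF_lower2[of "Inf (A x)"]) (auto simp: A_def)
        next
          fix x assume *: "(INF b\<in>K \<inter> {..c}. f x b) \<le> (INF b\<in>K. f x b)"
          obtain b where "b \<in> K \<inter> {..c}" "f x b = (INF b\<in>K \<inter> {..c}. f x b)"
            using lsc_attains_inf[OF lsc_slice[OF f] K' False, of x] by auto
          with * A(2)[of b x] show "Inf (A x) \<le> c" by (auto simp: A_def)
        qed
        moreover have "(\<lambda>x. INF b\<in>K \<inter> {..c}. f x b) \<in> borel_measurable borel"
            "(\<lambda>x. INF b\<in>K. f x b) \<in> borel_measurable borel"
          by (intro lsc_measurable lsc_INF f K K')+
        ultimately show ?thesis by simp
      qed
    qed
    show "Inf (A x) \<in> K" for x using A(1)[of x] by (simp add: A_def)
    then show "f x (Inf (A x)) = (INF b\<in>K. f x b)" for x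
      using A(1)[of x] by (intro antisym INF_lower) (auto simp: A_def)
  qed
qed

text \<open>Fatou's lemma for a fixed measure \<open>M\<close>: the parameter enters only through
  the point \<open>T z c\<close>. This is what the representation of couplings by laws independent
  of the state is for.\<close>

lemma lsc_nn_integral:
  fixes T :: "'a::first_countable_topology \<Rightarrow> 'c \<Rightarrow> 'b::topological_space"
  assumes W: "lsc W" and T: "\<And>z. T z \<in> M \<rightarrow>\<^sub>M borel"
    and conv: "\<And>X z. X \<longlonglongrightarrow> z \<Longrightarrow> AE c in M. (\<lambda>n. T (X n) c) \<longlonglongrightarrow> T z c"
  shows "lsc (\<lambda>z. \<integral>\<^sup>+c. W (T z c) \<partial>M)"
proof (rule lscI_liminf)
  fix X and z :: 'a assume X: "X \<longlonglongrightarrow> z"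
  have [measurable]: "W \<in> borel_measurable borel" "\<And>z. T z \<in> M \<rightarrow>\<^sub>M borel"
    using lsc_measurable[OF W] T by auto
  have "(\<integral>\<^sup>+c. W (T z c) \<partial>M) \<le> (\<integral>\<^sup>+c. liminf (\<lambda>n. W (T (X n) c)) \<partial>M)"
    using conv[OF X] by (intro nn_integral_mono_AE) (auto elim!: eventually_mono intro: lsc_liminf[OF W])
  also have "\<dots> \<le> liminf (\<lambda>n. \<integral>\<^sup>+c. W (T (X n) c) \<partial>M)"
    by (intro nn_integral_liminf) measurable
  finally show "(\<integral>\<^sup>+c. W (T z c) \<partial>M) \<le> liminf (\<lambda>n. \<integral>\<^sup>+c. W (T (X n) c) \<partial>M)" .
qed

section \<open>Quantiles and the distributional transform\<close>

text \<open>The left-continuous generalized inverse of the distribution function. The value 0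
  outside (0,1) is arbitrary, as the uniform law does not charge that set.\<close>

definition quantile :: "real measure \<Rightarrow> real \<Rightarrow> real" where
  "quantile M w = (if 0 < w \<and> w < 1 then Inf {x. w \<le> cdf M x} else 0)"

lemma quantile_le_iff:
  assumes "real_distribution M" and "0 < w" and "w < 1"
  shows "quantile M w \<le> c \<longleftrightarrow> w \<le> cdf M c"
proof -
  interpret cdf_distribution M
    using assms(1) by (simp add: cdf_distribution_def)
  show ?thesis
    using pseudoinverse[of w c] assms by (simp add: quantile_def)
qed

text \<open>\<open>quantile_le_iff\<close> turns a sublevel set in \<open>(x, w)\<close> into an
  inequality between \<open>w\<close> and the mass of \<open>{..c}\<close> under \<open>k x\<close>,
  which is jointly measurable.\<close>

lemma measurable_quantile:
  assumes [measurable]: "k \<in> S \<rightarrow>\<^sub>M prob_algebra borel"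
  shows "(\<lambda>(x, w). quantile (k x) w) \<in> S \<Otimes>\<^sub>M borel \<rightarrow>\<^sub>M borel"
proof (rule borel_measurableI_le)
  fix c
  have "real_distribution (k x)" if "x \<in> space S" for x
    using measurable_space[OF assms that]
    by (auto simp: space_prob_algebra real_distribution_def real_distribution_axioms_def)
  then have "{z \<in> space (S \<Otimes>\<^sub>M borel). (case z of (x, w) \<Rightarrow> quantile (k x) w) \<le> c} =
      {z \<in> space (S \<Otimes>\<^sub>M borel). if 0 < snd z \<and> snd z < 1 then snd z \<le> measure (k (fst z)) {..c} else 0 \<le> c}"
    using quantile_le_iff by (force simp: space_pair_measure cdf_def quantile_def)
  also have "\<dots> \<in> sets (S \<Otimes>\<^sub>M borel)"
    by measurable
  finally show "{z \<in> space (S \<Otimes>\<^sub>M borel). (case z of (x, w) \<Rightarrow> quantile (k x) w) \<le> c} \<in> sets (S \<Otimes>\<^sub>M borel)" .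
qed

lemma quantile_measurable [measurable]:
  assumes "real_distribution M"
  shows "quantile M \<in> borel_measurable borel"
proof -
  \<comment> \<open>A single measure is a kernel on a one-point space.\<close>
  have "(\<lambda>x. M) \<in> count_space {()} \<rightarrow>\<^sub>M prob_algebra borel"
    using assms by (auto simp: space_prob_algebra real_distribution_def real_distribution_axioms_def)
  from measurable_quantile[OF this]
  have "(\<lambda>(x, w). quantile M w) \<in> count_space {()} \<Otimes>\<^sub>M borel \<rightarrow>\<^sub>M borel" .
  moreover have "(\<lambda>w. ((), w)) \<in> borel \<rightarrow>\<^sub>M count_space {()} \<Otimes>\<^sub>M borel"
    by (intro measurable_Pair measurable_const) auto
  ultimately have "(\<lambda>w. case ((), w) of (x, w) \<Rightarrow> quantile M w) \<in> borel \<rightarrow>\<^sub>M borel"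
    by (rule measurable_compose[rotated])
  then show ?thesis
    by (simp only: prod.case)
qed

section \<open>The uniform law on (0,1) and the inverse transform\<close>

definition unif :: "real measure" where
  "unif = uniform_measure lborel {0<..<1}"

lemma sets_unif [simp, measurable_cong]: "sets unif = sets borel"
  by (simp add: unif_def)

lemma space_unif [simp]: "space unif = UNIV"
  by (simp add: unif_def)

lemma prob_space_unif: "prob_space unif"
  unfolding unif_def by (rule prob_space_uniform_measure) auto

lemma real_distribution_unif: "real_distribution unif"
  using prob_space_unif by (auto simp: real_distribution_def real_distribution_axioms_def)

lemma AE_unif: "AE w in unif. 0 < w \<and> w < 1"
  unfolding unif_def by (subst AE_uniform_measure) auto

lemma emeasure_unif: "A \<in> sets borel \<Longrightarrow> emeasure unif A = emeasure lborel ({0<..<1} \<inter> A)"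
  by (simp add: unif_def divide_ennreal_def)

lemma cdf_unif: "cdf unif c = min (max c 0) 1"
proof -
  consider "c \<le> 0" | "0 < c" "c < 1" | "1 \<le> c" by linarith
  then show ?thesis
  proof cases
    case 1
    then have "{0<..<1} \<inter> {..c} = {}" by auto
    with 1 show ?thesis by (simp add: cdf_def measure_def emeasure_unif)
  next
    case 2
    then have "{0<..<1} \<inter> {..c} = {0<..c}" by auto
    with 2 show ?thesis by (simp add: cdf_def measure_def emeasure_unif)
  next
    case 3
    then have "{0<..<1} \<inter> {..c} = {0<..<1}" by auto
    with 3 show ?thesis by (simp add: cdf_def measure_def emeasure_unif)
  qed
qed

lemma measure_unif_atLeast: "0 \<le> c \<Longrightarrow> c \<le> 1 \<Longrightarrow> measure unif {c..} = 1 - c"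
proof (cases "c = 0")
  case True
  have "{0<..<1} \<inter> {0::real..} = {0<..<1}" by auto
  with True show ?thesis by (simp add: measure_def emeasure_unif)
next
  case False
  assume "0 \<le> c" "c \<le> 1"
  with False have "{0<..<1} \<inter> {c..} = {c..<1}" by auto
  with \<open>c \<le> 1\<close> show ?thesis by (simp add: measure_def emeasure_unif)
qed

lemma distr_quantile:
  assumes M: "real_distribution M"
  shows "distr unif borel (quantile M) = M"
proof (rule cdf_unique)
  note [measurable] = quantile_measurable[OF M]
  interpret U: prob_space unif by (rule prob_space_unif)
  interpret M: real_distribution M by fact
  show "real_distribution (distr unif borel (quantile M))"
    by (auto simp: real_distribution_def real_distribution_axioms_def intro!: U.prob_space_distr)
  show "cdf (distr unif borel (quantile M)) = cdf M"
  proof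
    fix c
    have "cdf (distr unif borel (quantile M)) c = measure unif {w. quantile M w \<le> c}"
      by (simp add: cdf_def measure_distr vimage_def)
    also have "\<dots> = measure unif {..cdf M c}"
    proof (rule measure_eq_AE)
      show "AE w in unif. w \<in> {w. quantile M w \<le> c} \<longleftrightarrow> w \<in> {..cdf M c}"
        using AE_unif by eventually_elim (simp add: quantile_le_iff[OF M])
    qed auto
    also have "\<dots> = cdf M c"
      using cdf_unif[of "cdf M c"] M.cdf_bounded_prob[of c] M.cdf_nonneg[of c] by (simp add: cdf_def)
    finally show "cdf (distr unif borel (quantile M)) c = cdf M c" .
  qed
qed fact

lemma quantile_mono:
  assumes M: "real_distribution M" and "0 < v" "v \<le> w" "w < 1"
  shows "quantile M v \<le> quantile M w"
  using quantile_le_iff[OF M, of w "quantile M w"] quantile_le_iff[OF M, of v "quantile M w"] assms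
  by simp

text \<open>Convergence holds at every continuity point \<open>w\<close> of the limiting quantile
  function. That function is monotone, so the exceptional set is countable and hence null.\<close>

lemma AE_quantile_tendsto:
  assumes \<mu>: "\<And>n. real_distribution (\<mu> n)" and M: "real_distribution M" and conv: "weak_conv_m \<mu> M"
  shows "AE w in unif. (\<lambda>n. quantile (\<mu> n) w) \<longlonglongrightarrow> quantile M w"
proof -
  interpret M: real_distribution M by fact
  let ?D = "{w \<in> {0<..<1}. \<not> continuous (at w within {0<..<1}) (quantile M)}"
  have "countable ?D"
    by (rule mono_on_ctble_discont) (auto simp: mono_on_def intro: quantile_mono[OF M])
  then have "AE w in lborel. w \<notin> ?D"
    by (intro AE_not_in countable_imp_null_set_lborel)
  then have "AE w in unif. w \<notin> ?D"
    unfolding unif_def by (subst AE_uniform_measure) auto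
  then show ?thesis
    using AE_unif
  proof eventually_elim
    case (elim w)
    then have w: "0 < w" "w < 1" and cont: "isCont (quantile M) w"
      by (auto simp: at_within_open[of w "{0<..<1}"])
    \<comment> \<open>The atoms of \<open>M\<close> are countable, so every interval contains a
      continuity point of the distribution function.\<close>
    have point: "\<exists>c. a < c \<and> c < b \<and> (\<lambda>n. cdf (\<mu> n) c) \<longlonglongrightarrow> cdf M c" if "a < b" for a b
    proof -
      obtain c where "c \<in> {a<..<b}" "measure M {c} = 0"
        using open_minus_countable[OF M.countable_support, of "{a<..<b}"] \<open>a < b\<close> by auto
      then show ?thesis
        using conv by (auto simp: weak_conv_m_def weak_conv_def M.isCont_cdf)
    qed
    show ?case
    proof (rule order_tendstoI)
      fix a assume "a < quantile M w"
      then obtain c where c: "a < c" "c < quantile M w" "(\<lambda>n. cdf (\<mu> n) c) \<longlonglongrightarrow> cdf M c"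
        using point by blast
      then have "cdf M c < w"
        using quantile_le_iff[OF M w, of c] by linarith
      from order_tendstoD(2)[OF c(3) this]
      show "\<forall>\<^sub>F n in sequentially. a < quantile (\<mu> n) w"
      proof eventually_elim
        case (elim n)
        with quantile_le_iff[OF \<mu> w, of n c] c(1) show ?case by linarith
      qed
    next
      fix b assume b: "quantile M w < b"
      \<comment> \<open>Only the upper bound uses continuity at \<open>w\<close>: a level
        \<open>v > w\<close> whose quantile is still below \<open>b\<close> makes
        \<open>w < cdf M c\<close> strict, so that the inequality passes to the approximating
        measures.\<close>
      have "\<forall>\<^sub>F v in at_right w. quantile M v < b"
        using cont b by (intro order_tendstoD(2)[of _ "quantile M w"])
          (auto simp: isCont_def intro: tendsto_within_subset)
      moreover have "\<forall>\<^sub>F v in at_right w. w < v \<and> v < 1"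
        using w by (auto simp: eventually_at_right[of _ 1])
      ultimately obtain v where v: "quantile M v < b" "w < v" "v < 1"
        by (metis (mono_tags, lifting) eventually_conj eventually_happens trivial_limit_at_right_real)
      obtain c where c: "quantile M v < c" "c < b" "(\<lambda>n. cdf (\<mu> n) c) \<longlonglongrightarrow> cdf M c"
        using point[OF v(1)] by blast
      then have "w < cdf M c"
        using quantile_le_iff[OF M, of v c] v w by linarith
      from order_tendstoD(1)[OF c(3) this]
      show "\<forall>\<^sub>F n in sequentially. quantile (\<mu> n) w < b"
      proof eventually_elim
        case (elim n)
        with quantile_le_iff[OF \<mu> w, of n c] c(2) show ?case by linarith
      qed
    qed
  qed
qed

text \<open>The event \<open>X \<le> q < Y\<close> has as probability the difference of the two
  distribution functions at \<open>q\<close>, hence zero for every rational \<open>q\<close>; if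
  \<open>X < Y\<close>, some rational realizes it.\<close>

lemma AE_eq_if_le_and_same_distr:
  fixes X Y :: "'a \<Rightarrow> real"
  assumes "prob_space P" and [measurable]: "X \<in> borel_measurable P" "Y \<in> borel_measurable P"
    and le: "AE z in P. X z \<le> Y z" and eq: "distr P borel X = distr P borel Y"
  shows "AE z in P. X z = Y z"
proof -
  interpret prob_space P by fact
  have "AE z in P. \<not> (X z \<le> real_of_rat q \<and> real_of_rat q < Y z)" for q
  proof -
    let ?q = "real_of_rat q"
    have "measure P {z \<in> space P. X z \<le> ?q} = measure P {z \<in> space P. Y z \<le> ?q}"
      using arg_cong[OF eq, of "\<lambda>D. measure D {..?q}"] by (simp add: measure_distr vimage_def Int_def conj_commute)
    moreover have "measure P {z \<in> space P. Y z \<le> ?q} = measure P {z \<in> space P. X z \<le> ?q \<and> Y z \<le> ?q}"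
      using le by (intro measure_eq_AE) (auto elim!: eventually_mono)
    moreover have "measure P {z \<in> space P. X z \<le> ?q} =
        measure P {z \<in> space P. X z \<le> ?q \<and> Y z \<le> ?q} + measure P {z \<in> space P. X z \<le> ?q \<and> ?q < Y z}"
      by (subst finite_measure_Union[symmetric]) (auto intro!: arg_cong[where f="measure P"])
    ultimately have "measure P {z \<in> space P. X z \<le> ?q \<and> ?q < Y z} = 0"
      by simp
    then have "{z \<in> space P. X z \<le> ?q \<and> ?q < Y z} \<in> null_sets P"
      by (auto simp: null_sets_def emeasure_eq_measure)
    from AE_not_in[OF this] show ?thesis
      by (auto elim!: AE_mp intro!: AE_I2)
  qed
  then have "AE z in P. \<forall>q. \<not> (X z \<le> real_of_rat q \<and> real_of_rat q < Y z)"
    by (simp add: AE_all_countable)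
  with le show ?thesis
  proof eventually_elim
    case (elim z)
    then show ?case
      using of_rat_dense[of "X z" "Y z"] by force
  qed
qed

text \<open>The distributional transform: for uniform \<open>v\<close>, an atom \<open>u\<close> is
  spread uniformly over the jump of the distribution function at \<open>u\<close>, so that the
  result is uniform even if \<open>M\<close> has atoms.\<close>

definition dist_transform :: "real measure \<Rightarrow> real \<times> real \<Rightarrow> real" where
  "dist_transform M = (\<lambda>(u, v). cdf M u - v * measure M {u})"

context real_distribution
begin

text \<open>The atom mass \<open>measure M {u}\<close> is Borel in \<open>u\<close> because it is
  the measure of a section of the diagonal.\<close>

lemma measurable_dist_transform [measurable]:
  "dist_transform M \<in> borel \<Otimes>\<^sub>M borel \<rightarrow>\<^sub>M borel"
proof -
  have "{z \<in> space (borel \<Otimes>\<^sub>M M). fst z = snd z} \<in> sets (borel \<Otimes>\<^sub>M M)"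
    by measurable
  moreover have "{z \<in> space (borel \<Otimes>\<^sub>M M). fst z = snd z} = {(u, v). u = v}"
    by (auto simp: space_pair_measure)
  ultimately have [measurable]: "{(u, v). u = (v::real)} \<in> sets (borel \<Otimes>\<^sub>M M)"
    by metis
  have "(\<lambda>u. emeasure M (Pair u -` {(u, v). u = v})) \<in> borel_measurable borel"
    by (rule measurable_emeasure_Pair) measurable
  then have "(\<lambda>u. emeasure M {u}) \<in> borel_measurable borel"
    by (simp add: vimage_def)
  then have [measurable]: "(\<lambda>u. measure M {u}) \<in> borel_measurable borel"
    unfolding measure_def by simp
  have [measurable]: "cdf M \<in> borel_measurable borel"
    by (intro borel_measurable_mono monoI cdf_nondecreasing)
  show ?thesis
    unfolding dist_transform_def by measurable
qed

lemma cdf_minus_atom: "cdf M u - measure M {u} = measure M {..<u}"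
proof -
  have "{..u} = {..<u} \<union> {u}" by auto
  moreover have "measure M ({..<u} \<union> {u}) = measure M {..<u} + measure M {u}"
    by (rule finite_measure_Union) auto
  ultimately show ?thesis
    by (simp add: cdf_def)
qed

text \<open>With \<open>q\<close> the \<open>s\<close>-quantile, points left of \<open>q\<close>
  count fully, an atom at \<open>q\<close> counts with the fraction \<open>c\<close>, and points
  right of \<open>q\<close> not at all. Two one-sided bounds, with weak and with strict inequality,
  are stated because on a flat piece of the distribution function at level \<open>s\<close> the
  comparison is no equality for each \<open>u\<close>.\<close>

lemma emeasure_dist_transform:
  assumes s: "0 < s" "s < 1"
  shows "ennreal s \<le> emeasure (M \<Otimes>\<^sub>M unif) {z. dist_transform M z \<le> s}"
    and "emeasure (M \<Otimes>\<^sub>M unif) {z. dist_transform M z < s} \<le> ennreal s"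
proof -
  interpret U: prob_space unif by (rule prob_space_unif)
  have MM: "real_distribution M" by unfold_locales
  define q where "q = quantile M s"
  define m where "m = measure M {q}"
  \<comment> \<open>\<open>d\<close> is the overshoot of the distribution function above
    \<open>s\<close> at \<open>q\<close>. At an atom of mass \<open>m\<close> the transform stays at
    or below \<open>s\<close> exactly for \<open>v \<ge> d / m\<close>, an event of probability
    \<open>c\<close>.\<close>
  define d where "d = cdf M q - s"
  define c where "c = (if m = 0 then 0 else 1 - d / m)"
  note q = quantile_le_iff[OF MM s, folded q_def]
  have d0: "0 \<le> d"
    using q[of q] by (simp add: d_def)
  \<comment> \<open>Left of \<open>q\<close> the distribution function is below \<open>s\<close>, so
    its left limit is at most \<open>s\<close>. This yields \<open>d \<le> m\<close>, and in
    particular \<open>d = 0\<close> when there is no atom.\<close>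
  have "measure M {..<q} \<le> s"
  proof (rule tendsto_upperbound[OF cdf_at_left])
    show "\<forall>\<^sub>F x in at_left q. cdf M x \<le> s"
      using q by (auto simp: eventually_at_filter not_le[symmetric] intro!: always_eventually)
  qed simp
  then have dm: "d \<le> m"
    using cdf_minus_atom[of q] by (simp add: d_def m_def)
  have c: "0 \<le> c" "c \<le> 1" "c * m = m - d"
    using d0 dm measure_nonneg[of M "{q}"] by (auto simp: c_def m_def[symmetric] field_simps)
  have total: "(\<integral>\<^sup>+u. indicator {..<q} u + ennreal c * indicator {q} u \<partial>M) = ennreal s"
  proof -
    have "(\<integral>\<^sup>+u. indicator {..<q} u + ennreal c * indicator {q} u \<partial>M) =
        emeasure M {..<q} + ennreal c * emeasure M {q}"
      by (subst nn_integral_add) (auto simp: nn_integral_cmult)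
    also have "\<dots> = ennreal (measure M {..<q} + c * m)"
      using c(1) by (simp add: emeasure_eq_measure m_def flip: ennreal_mult ennreal_plus)
    also have "measure M {..<q} + c * m = s"
      using cdf_minus_atom[of q] c(3) by (simp add: m_def d_def)
    finally show ?thesis .
  qed
  have ue: "emeasure unif {v. cdf M q - v * m \<le> s} = ennreal c \<and> emeasure unif {v. cdf M q - v * m < s} \<le> ennreal c"
    if "m \<noteq> 0"
  proof -
    have "0 < m" using that measure_nonneg[of M "{q}"] unfolding m_def by linarith
    then have "{v. cdf M q - v * m \<le> s} = {d / m..}"
      by (auto simp: d_def field_simps)
    moreover have "measure unif {d / m..} = c"
      using \<open>0 < m\<close> d0 dm by (subst measure_unif_atLeast) (auto simp: c_def field_simps)
    ultimately have *: "emeasure unif {v. cdf M q - v * m \<le> s} = ennreal c"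
      by (simp add: U.emeasure_eq_measure)
    moreover have "emeasure unif {v. cdf M q - v * m < s} \<le> emeasure unif {v. cdf M q - v * m \<le> s}"
      by (intro emeasure_mono) auto
    ultimately show ?thesis by simp
  qed
  have [measurable]: "{z. dist_transform M z \<le> s} \<in> sets (borel \<Otimes>\<^sub>M borel)"
      "{z. dist_transform M z < s} \<in> sets (borel \<Otimes>\<^sub>M borel)"
    using measurable_sets[OF measurable_dist_transform, of "{..s}"]
      measurable_sets[OF measurable_dist_transform, of "{..<s}"]
    by (simp_all add: vimage_def space_pair_measure)
  show "ennreal s \<le> emeasure (M \<Otimes>\<^sub>M unif) {z. dist_transform M z \<le> s}"
  proof -
    have "indicator {..<q} u + ennreal c * indicator {q} u \<le> emeasure unif {v. dist_transform M (u, v) \<le> s}" for u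
    proof -
      consider "u < q" | "u = q" | "u > q" by linarith
      then show ?thesis
      proof cases
        case 1
        then have "cdf M u < s" using q[of u] by linarith
        then have "emeasure unif {v. dist_transform M (u, v) \<le> s} \<ge> emeasure unif {0..}"
          by (intro emeasure_mono) (auto simp: dist_transform_def intro: order_trans[of _ "cdf M u"])
        moreover have "emeasure unif {0..} = 1"
          by (simp add: U.emeasure_eq_measure measure_unif_atLeast)
        ultimately show ?thesis using 1 by simp
      next
        case 2
        with ue show ?thesis by (cases "m = 0") (auto simp: dist_transform_def m_def c_def)
      qed simp
    qed
    then show ?thesis
      unfolding total[symmetric]
      by (subst U.emeasure_pair_measure_alt) (auto intro!: nn_integral_mono simp: vimage_def space_pair_measure)
  qed
  show "emeasure (M \<Otimes>\<^sub>M unif) {z. dist_transform M z < s} \<le> ennreal s"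
  proof -
    have "emeasure unif {v. dist_transform M (u, v) < s} \<le> indicator {..<q} u + ennreal c * indicator {q} u" for u
    proof -
      consider "u < q" | "u = q" | "u > q" by linarith
      then show ?thesis
      proof cases
        case 1
        then show ?thesis by (simp add: U.emeasure_le_1)
      next
        case 2
        with ue d0 show ?thesis by (cases "m = 0") (auto simp: dist_transform_def m_def c_def d_def not_less)
      next
        case 3
        have "{v. dist_transform M (u, v) < s} \<inter> {0<..<1} = {}"
        proof safe
          fix v :: real assume "v \<in> {0<..<1}" "dist_transform M (u, v) < s"
          then have "cdf M u - measure M {u} < s"
            using mult_right_mono[of v 1 "measure M {u}"] by (auto simp: dist_transform_def)
          moreover have "cdf M q \<le> measure M {..<u}"
            unfolding cdf_def using 3 by (intro finite_measure_mono) auto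
          ultimately show "v \<in> {}"
            using d0 by (simp add: cdf_minus_atom d_def)
        qed
        then have "emeasure unif {v. dist_transform M (u, v) < s} = 0"
          by (subst emeasure_unif) (auto simp: Int_commute)
        then show ?thesis by simp
      qed
    qed
    then show ?thesis
      unfolding total[symmetric]
      by (subst U.emeasure_pair_measure_alt) (auto intro!: nn_integral_mono simp: vimage_def space_pair_measure)
  qed
qed

text \<open>The distribution function at \<open>s\<close> is squeezed: the weak inequality bounds it
  below by \<open>s\<close>, the strict one at levels \<open>t > s\<close> bounds it above by every
  such \<open>t\<close>.\<close>

lemma distr_dist_transform: "distr (M \<Otimes>\<^sub>M unif) borel (dist_transform M) = unif" (is "?N = _")
proof (rule cdf_unique)
  interpret U: prob_space unif by (rule prob_space_unif)
  interpret MU: pair_prob_space M unif ..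
  show N: "real_distribution ?N"
    by (auto simp: real_distribution_def real_distribution_axioms_def intro!: MU.prob_space_distr)
  interpret N: real_distribution ?N by fact
  have le: "measure (M \<Otimes>\<^sub>M unif) {z. dist_transform M z \<le> s} = cdf ?N s" for s
    by (simp add: cdf_def measure_distr vimage_def space_pair_measure)
  have lo: "s \<le> cdf ?N s" if "0 < s" "s < 1" for s
    using emeasure_dist_transform(1)[OF that] that by (simp add: MU.emeasure_eq_measure le ennreal_le_iff[OF N.cdf_nonneg])
  have hi: "cdf ?N s \<le> t" if "s < t" "0 < t" "t < 1" for s t
  proof -
    have "cdf ?N s \<le> measure (M \<Otimes>\<^sub>M unif) {z. dist_transform M z < t}"
      unfolding le[symmetric] using that measurable_sets[OF measurable_dist_transform, of "{..<t}"]
      by (intro MU.finite_measure_mono) (auto simp: space_pair_measure vimage_def)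
    also have "\<dots> \<le> t"
      using emeasure_dist_transform(2)[OF that(2,3)] that by (simp add: MU.emeasure_eq_measure)
    finally show ?thesis .
  qed
  show "cdf ?N = cdf unif"
  proof
    fix s :: real
    consider "s \<le> 0" | "0 < s" "s < 1" | "1 \<le> s" by linarith
    then show "cdf ?N s = cdf unif s"
    proof cases
      case 1
      have "cdf ?N s \<le> 0"
        by (rule dense_ge_bounded[of 0 1]) (use hi 1 in auto)
      with 1 N.cdf_nonneg[of s] show ?thesis by (simp add: cdf_unif)
    next
      case 2
      have "cdf ?N s \<le> s"
        by (rule dense_ge_bounded[of s 1]) (use hi 2 in auto)
      with 2 lo[OF 2] show ?thesis by (simp add: cdf_unif)
    next
      case 3
      have "1 \<le> cdf ?N s"
      proof (rule dense_le_bounded[of 0 1])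
        fix w :: real assume "0 < w" "w < 1"
        with lo[of w] N.cdf_nondecreasing[of w s] 3 show "w \<le> cdf ?N s" by linarith
      qed simp
      with 3 N.cdf_bounded_prob[of s] show ?thesis by (simp add: cdf_unif)
    qed
  qed
qed (rule real_distribution_unif)

text \<open>The transform is at most \<open>cdf M u\<close>, so its quantile is at most
  \<open>u\<close>. Both have the law \<open>M\<close>, and
  \<open>AE_eq_if_le_and_same_distr\<close> forces equality.\<close>

lemma AE_quantile_dist_transform:
  "AE (u, v) in M \<Otimes>\<^sub>M unif. quantile M (dist_transform M (u, v)) = u"
proof -
  interpret U: prob_space unif by (rule prob_space_unif)
  interpret MU: pair_prob_space M unif ..
  have MM: "real_distribution M" by unfold_locales
  note [measurable] = quantile_measurable[OF MM]
  have "AE z in M \<Otimes>\<^sub>M unif. quantile M (dist_transform M z) = fst z"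
  proof (rule AE_eq_if_le_and_same_distr)
    show "prob_space (M \<Otimes>\<^sub>M unif)" by unfold_locales
    have "AE w in distr (M \<Otimes>\<^sub>M unif) borel (dist_transform M). 0 < w \<and> w < 1"
      unfolding distr_dist_transform by (rule AE_unif)
    then have 1: "AE z in M \<Otimes>\<^sub>M unif. 0 < dist_transform M z \<and> dist_transform M z < 1"
      by (subst (asm) AE_distr_iff) auto
    have 2: "AE z in M \<Otimes>\<^sub>M unif. 0 < snd z \<and> snd z < 1"
    proof (rule MU.AE_pair_measure)
      show "{z \<in> space (M \<Otimes>\<^sub>M unif). 0 < snd z \<and> snd z < 1} \<in> sets (M \<Otimes>\<^sub>M unif)"
        by measurable
      show "AE u in M. AE v in unif. 0 < snd (u, v) \<and> snd (u, v) < 1"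
        using AE_unif by simp
    qed
    from 1 2 show "AE z in M \<Otimes>\<^sub>M unif. quantile M (dist_transform M z) \<le> fst z"
    proof eventually_elim
      case (elim z)
      then have "dist_transform M z \<le> cdf M (fst z)"
        by (cases z) (auto simp: dist_transform_def)
      with elim show ?case by (simp add: quantile_le_iff[OF MM])
    qed
    have "distr (M \<Otimes>\<^sub>M unif) borel (\<lambda>z. quantile M (dist_transform M z)) =
        distr (distr (M \<Otimes>\<^sub>M unif) borel (dist_transform M)) borel (quantile M)"
      by (simp add: distr_distr o_def)
    also have "\<dots> = M"
      by (simp add: distr_dist_transform distr_quantile[OF MM])
    also have "M = distr (M \<Otimes>\<^sub>M unif) borel fst"
      using U.distr_pair_fst[of M] by (simp cong: distr_cong)
    finally show "distr (M \<Otimes>\<^sub>M unif) borel (\<lambda>z. quantile M (dist_transform M z)) = distr (M \<Otimes>\<^sub>M unif) borel fst" .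
  qed measurable
  then show ?thesis by (simp add: case_prod_beta)
qed

end

section \<open>Convergence and measurability for paths as total functions\<close>

lemma tendsto_fun_iff:
  fixes x :: "'i \<Rightarrow> 'a::topological_space"
  shows "(X \<longlongrightarrow> x) F \<longleftrightarrow> (\<forall>i. ((\<lambda>n. X n i) \<longlongrightarrow> x i) F)"
  using limitin_componentwise[of "\<lambda>_::'i. euclidean :: 'a topology" UNIV X x F]
  by (simp add: euclidean_product_topology)

lemma tendsto_fun_upd:
  fixes x :: "'i \<Rightarrow> 'a::topological_space"
  assumes "(X \<longlongrightarrow> x) F" and "(U \<longlongrightarrow> u) F"
  shows "((\<lambda>n. (X n)(t := U n)) \<longlongrightarrow> x(t := u)) F"
  using assms by (auto simp: tendsto_fun_iff)

lemma measurable_fun_upd_borel [measurable (raw)]: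
  fixes f :: "'s \<Rightarrow> nat \<Rightarrow> real"
  assumes [measurable]: "f \<in> M \<rightarrow>\<^sub>M borel" "g \<in> M \<rightarrow>\<^sub>M borel"
  shows "(\<lambda>z. (f z)(t := g z)) \<in> M \<rightarrow>\<^sub>M borel"
proof (rule measurable_coordinatewise_then_product)
  fix i
  have "(\<lambda>z. f z i) \<in> M \<rightarrow>\<^sub>M borel"
    using measurable_product_then_coordinatewise[OF assms(1)] .
  then show "(\<lambda>z. ((f z)(t := g z)) i) \<in> M \<rightarrow>\<^sub>M borel"
    by (cases "i = t") auto
qed

lemma measurable_fst_snd_borel [measurable]:
  "fst \<in> (borel :: ('a::topological_space \<times> 'b::topological_space) measure) \<rightarrow>\<^sub>M borel"
  "snd \<in> (borel :: ('a::topological_space \<times> 'b::topological_space) measure) \<rightarrow>\<^sub>M borel"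
  by (intro borel_measurable_continuous_onI continuous_on_fst continuous_on_snd continuous_on_id)+

lemma pcost_less_iff:
  assumes "0 < p" and "0 < \<delta>"
  shows "pcost p \<pi> < ennreal \<delta> \<longleftrightarrow> (\<integral>\<^sup>+(x, y). ennreal (\<bar>x - y\<bar> powr p) \<partial>\<pi>) < ennreal (\<delta> powr p)"
proof (cases "\<integral>\<^sup>+(x, y). ennreal (\<bar>x - y\<bar> powr p) \<partial>\<pi>")
  case (real r)
  have "r powr (1 / p) < \<delta> \<longleftrightarrow> r < \<delta> powr p"
  proof
    assume "r powr (1 / p) < \<delta>"
    from powr_less_mono2[OF assms(1) _ this] show "r < \<delta> powr p"
      using assms real by (simp add: powr_powr)
  next
    assume "r < \<delta> powr p"
    from powr_less_mono2[OF _ _ this, of "1 / p"] show "r powr (1 / p) < \<delta>"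
      using assms real by (simp add: powr_powr)
  qed
  with real show ?thesis
    by (simp add: pcost_def ennreal_powr_def ennreal_less_iff)
next
  case top
  then show ?thesis
    by (simp add: pcost_def ennreal_powr_def)
qed

section \<open>Reparametrization of the set of couplings by quantiles\<close>

definition shifts :: "real \<Rightarrow> real \<Rightarrow> (real \<times> real) measure set" where
  "shifts p \<delta> = {\<Gamma> \<in> space (prob_algebra borel). distr \<Gamma> borel fst = unif \<and>
     (\<integral>\<^sup>+(w, z). ennreal (\<bar>z\<bar> powr p) \<partial>\<Gamma>) < ennreal (\<delta> powr p)}"

definition lift_shift :: "real measure \<Rightarrow> (real \<times> real) measure \<Rightarrow> (real \<times> real) measure" where
  "lift_shift \<eta> \<Gamma> = distr \<Gamma> borel (\<lambda>(w, z). (quantile \<eta> w, quantile \<eta> w + z))"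

lemma measurable_lift_shift:
  assumes [measurable]: "k \<in> S \<rightarrow>\<^sub>M prob_algebra borel" and \<Gamma>: "\<Gamma> \<in> shifts p \<delta>"
  shows "(\<lambda>x. lift_shift (k x) \<Gamma>) \<in> S \<rightarrow>\<^sub>M prob_algebra borel"
proof -
  have [measurable]: "(\<lambda>(x, w). quantile (k x) w) \<in> S \<Otimes>\<^sub>M borel \<rightarrow>\<^sub>M borel"
    by (rule measurable_quantile) measurable
  have [measurable]: "(\<lambda>x. \<Gamma>) \<in> S \<rightarrow>\<^sub>M prob_algebra (borel \<Otimes>\<^sub>M borel)"
    using \<Gamma> by (auto simp: shifts_def borel_prod)
  show ?thesis
    unfolding lift_shift_def borel_prod[symmetric] by measurable
qed

lemma lift_shift_in_Pi_delta_real: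
  assumes \<Gamma>: "\<Gamma> \<in> shifts p \<delta>" and p: "0 < p" "0 < \<delta>" and \<eta>: "real_distribution \<eta>"
  shows "lift_shift \<eta> \<Gamma> \<in> Pi_delta_real p \<delta> \<eta>"
proof -
  have "\<Gamma> \<in> space (prob_algebra borel)"
    using \<Gamma> by (simp add: shifts_def)
  then have [measurable_cong]: "sets \<Gamma> = sets (borel \<Otimes>\<^sub>M borel)" and "prob_space \<Gamma>"
    unfolding space_prob_algebra borel_prod by simp_all
  interpret prob_space \<Gamma> by fact
  note [measurable] = quantile_measurable[OF \<eta>]
  have M: "(\<lambda>(w, z). (quantile \<eta> w, quantile \<eta> w + z)) \<in> \<Gamma> \<rightarrow>\<^sub>M borel"
    unfolding borel_prod[symmetric] by measurable
  have "distr (lift_shift \<eta> \<Gamma>) borel fst = distr \<Gamma> borel (\<lambda>z. quantile \<eta> (fst z))"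
    unfolding lift_shift_def by (subst distr_distr[OF _ M]) (auto simp: o_def case_prod_beta)
  also have "\<dots> = distr (distr \<Gamma> borel fst) borel (quantile \<eta>)"
    by (subst distr_distr) (auto simp: o_def)
  also have "\<dots> = \<eta>"
    using \<Gamma> distr_quantile[OF \<eta>] by (simp add: shifts_def)
  finally have "distr (lift_shift \<eta> \<Gamma>) borel fst = \<eta>" .
  moreover have "(\<integral>\<^sup>+(x, y). ennreal (\<bar>x - y\<bar> powr p) \<partial>lift_shift \<eta> \<Gamma>) = (\<integral>\<^sup>+(w, z). ennreal (\<bar>z\<bar> powr p) \<partial>\<Gamma>)"
    unfolding lift_shift_def
    by (subst nn_integral_distr[OF M]) (auto simp: case_prod_beta' borel_prod[symmetric])
  then have "pcost p (lift_shift \<eta> \<Gamma>) < ennreal \<delta>"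
    unfolding pcost_less_iff[OF p] using \<Gamma> by (simp add: shifts_def)
  moreover have "lift_shift \<eta> \<Gamma> \<in> space (prob_algebra borel)"
    using prob_space_distr[OF M] by (simp add: space_prob_algebra lift_shift_def)
  ultimately show ?thesis
    by (simp add: Pi_delta_real_def)
qed

text \<open>An independent uniform variable is adjoined to \<open>\<pi>\<close> to resolve the atoms
  of \<open>\<eta>\<close>: \<open>w\<close> is the distributional transform of \<open>x\<close>,
  and \<open>z\<close> is \<open>y - x\<close>. Since \<open>quantile \<eta> w = x\<close> almost
  surely, lifting returns \<open>\<pi>\<close>. In general \<open>w\<close> and \<open>z\<close> are
  dependent, which is why \<open>shifts\<close> consists of joint laws.\<close>

lemma Pi_delta_real_subset_lift_shift:
  assumes \<pi>: "\<pi> \<in> Pi_delta_real p \<delta> \<eta>" and p: "0 < p" "0 < \<delta>" and \<eta>: "real_distribution \<eta>"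
  obtains \<Gamma> where "\<Gamma> \<in> shifts p \<delta>" and "\<pi> = lift_shift \<eta> \<Gamma>"
proof -
  interpret real_distribution \<eta> by fact
  interpret U: prob_space unif by (rule prob_space_unif)
  have "\<pi> \<in> space (prob_algebra borel)" and fst: "distr \<pi> borel fst = \<eta>"
      and cost: "(\<integral>\<^sup>+(x, y). ennreal (\<bar>x - y\<bar> powr p) \<partial>\<pi>) < ennreal (\<delta> powr p)"
    using \<pi> by (simp_all add: Pi_delta_real_def pcost_less_iff[OF p])
  then have s[measurable_cong]: "sets \<pi> = sets (borel \<Otimes>\<^sub>M borel)" and "prob_space \<pi>"
    unfolding space_prob_algebra borel_prod by simp_all
  interpret \<pi>: prob_space \<pi> by fact
  interpret P: pair_prob_space \<pi> unif ..
  note [measurable] = measurable_dist_transform quantile_measurable[OF \<eta>]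
  let ?T = "\<lambda>z. dist_transform \<eta> (fst (fst z), snd z)"
  let ?f = "\<lambda>z. (?T z, snd (fst z) - fst (fst z))"
  have f[measurable]: "?f \<in> \<pi> \<Otimes>\<^sub>M unif \<rightarrow>\<^sub>M borel \<Otimes>\<^sub>M borel"
    by measurable
  have "distr \<pi> \<eta> fst = \<eta>"
    using fst by (simp cong: distr_cong)
  then have "distr (\<pi> \<Otimes>\<^sub>M unif) (\<eta> \<Otimes>\<^sub>M unif) (\<lambda>(x, y). (fst x, y)) = \<eta> \<Otimes>\<^sub>M unif"
    using pair_measure_distr[of fst \<pi> \<eta> "\<lambda>x. x" unif unif] U.sigma_finite_measure_axioms
    by (simp add: distr_id)
  then have D: "distr (\<pi> \<Otimes>\<^sub>M unif) (\<eta> \<Otimes>\<^sub>M unif) (\<lambda>z. (fst (fst z), snd z)) = \<eta> \<Otimes>\<^sub>M unif"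
    by (simp add: case_prod_beta')
  define \<Gamma> where "\<Gamma> = distr (\<pi> \<Otimes>\<^sub>M unif) (borel \<Otimes>\<^sub>M borel) ?f"
  show thesis
  proof
    have "distr \<Gamma> borel fst = distr (\<pi> \<Otimes>\<^sub>M unif) borel ?T"
      unfolding \<Gamma>_def by (subst distr_distr) (auto simp: o_def)
    also have "\<dots> = distr (distr (\<pi> \<Otimes>\<^sub>M unif) (\<eta> \<Otimes>\<^sub>M unif) (\<lambda>z. (fst (fst z), snd z))) borel (dist_transform \<eta>)"
      by (subst distr_distr) (auto simp: o_def)
    also have "\<dots> = unif"
      unfolding D by (rule distr_dist_transform)
    finally have "distr \<Gamma> borel fst = unif" .
    moreover have "(\<integral>\<^sup>+(w, z). ennreal (\<bar>z\<bar> powr p) \<partial>\<Gamma>) = (\<integral>\<^sup>+(x, y). ennreal (\<bar>x - y\<bar> powr p) \<partial>\<pi>)"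
    proof -
      have "(\<integral>\<^sup>+(w, z). ennreal (\<bar>z\<bar> powr p) \<partial>\<Gamma>) = (\<integral>\<^sup>+z. ennreal (\<bar>snd (fst z) - fst (fst z)\<bar> powr p) \<partial>(\<pi> \<Otimes>\<^sub>M unif))"
        unfolding \<Gamma>_def by (subst nn_integral_distr) (auto simp: case_prod_beta)
      also have "\<dots> = (\<integral>\<^sup>+(x, y). ennreal (\<bar>x - y\<bar> powr p) \<partial>\<pi>)"
        by (subst U.nn_integral_fst[symmetric])
          (auto simp: U.emeasure_space_1[unfolded space_unif] case_prod_beta' abs_minus_commute)
      finally show ?thesis .
    qed
    moreover have "\<Gamma> \<in> space (prob_algebra borel)"
      using P.prob_space_distr[OF f] by (simp add: space_prob_algebra \<Gamma>_def borel_prod)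
    ultimately show "\<Gamma> \<in> shifts p \<delta>"
      using cost by (simp add: shifts_def)
    have ae: "AE z in \<pi> \<Otimes>\<^sub>M unif. quantile \<eta> (?T z) = fst (fst z)"
    proof -
      have "AE z in distr (\<pi> \<Otimes>\<^sub>M unif) (\<eta> \<Otimes>\<^sub>M unif) (\<lambda>z. (fst (fst z), snd z)). quantile \<eta> (dist_transform \<eta> z) = fst z"
        unfolding D using AE_quantile_dist_transform by (simp add: case_prod_beta)
      from AE_distrD[OF _ this] show ?thesis
        by simp
    qed
    have "lift_shift \<eta> \<Gamma> = distr \<Gamma> (borel \<Otimes>\<^sub>M borel) (\<lambda>(w, z). (quantile \<eta> w, quantile \<eta> w + z))"
      by (simp add: lift_shift_def borel_prod)
    also have "\<dots> = distr (\<pi> \<Otimes>\<^sub>M unif) (borel \<Otimes>\<^sub>M borel)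
        (\<lambda>z. (quantile \<eta> (?T z), quantile \<eta> (?T z) + (snd (fst z) - fst (fst z))))"
      unfolding \<Gamma>_def by (subst distr_distr) (auto simp: o_def)
    also have "\<dots> = distr (\<pi> \<Otimes>\<^sub>M unif) (borel \<Otimes>\<^sub>M borel) fst"
      using ae by (intro distr_cong_AE) (auto elim!: eventually_mono)
    also have "\<dots> = distr (\<pi> \<Otimes>\<^sub>M unif) \<pi> fst"
      by (intro distr_cong) (auto simp: s)
    also have "\<dots> = \<pi>"
      by (rule U.distr_pair_fst)
    finally show "\<pi> = lift_shift \<eta> \<Gamma>" ..
  qed
qed

lemma SUP_Pi_delta_real:
  assumes "0 < p" "0 < \<delta>" and "real_distribution \<eta>"
  shows "(SUP \<pi>\<in>Pi_delta_real p \<delta> \<eta>. F \<pi>) = (SUP \<Gamma>\<in>shifts p \<delta>. F (lift_shift \<eta> \<Gamma>))"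
proof -
  have "Pi_delta_real p \<delta> \<eta> = lift_shift \<eta> ` shifts p \<delta>"
    using lift_shift_in_Pi_delta_real[OF _ assms] Pi_delta_real_subset_lift_shift[OF _ assms] by blast
  then show ?thesis by (simp add: image_image)
qed

text \<open>The zero shift corresponds to the identity coupling, whose cost is 0.\<close>

lemma shifts_nonempty:
  assumes "0 < \<delta>"
  shows "distr unif borel (\<lambda>w. (w, 0)) \<in> shifts p \<delta>"
proof -
  interpret U: prob_space unif by (rule prob_space_unif)
  have M: "(\<lambda>w. (w, 0)) \<in> unif \<rightarrow>\<^sub>M (borel :: (real \<times> real) measure)"
    unfolding borel_prod[symmetric] by measurable
  have "distr (distr unif borel (\<lambda>w. (w, 0::real))) borel fst = unif"
    by (subst distr_distr[OF _ M]) (auto simp: o_def intro!: distr_id2)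
  then show ?thesis
    using U.prob_space_distr[OF M] assms
    by (simp add: shifts_def space_prob_algebra nn_integral_distr[OF M] borel_prod)
qed

section \<open>Second coordinates that encode first coordinates\<close>

definition squash :: "real \<Rightarrow> real" where
  "squash u = arctan u / pi + 1 / 2"

text \<open>\<open>v\<close> is rounded down to the grid of mesh \<open>1 / (n + 1)\<close>, and
  \<open>u\<close>, squeezed into (0,1), is stored as the position inside the cell. So
  \<open>v\<close> moves by at most one mesh, and the new value determines \<open>u\<close>.\<close>

definition encode :: "nat \<Rightarrow> real \<Rightarrow> real \<Rightarrow> real" where
  "encode n u v = (of_int \<lfloor>real (Suc n) * v\<rfloor> + squash u) / real (Suc n)"

definition decode :: "nat \<Rightarrow> real \<Rightarrow> real" where
  "decode n v = tan (pi * (frac (real (Suc n) * v) - 1 / 2))"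

lemma squash_bounds: "0 < squash u" "squash u < 1"
  using arctan_lbound[of u] arctan_ubound[of u] by (auto simp: squash_def field_simps)

lemma decode_encode [simp]: "decode n (encode n u v) = u"
proof -
  have "real (Suc n) * encode n u v = of_int \<lfloor>real (Suc n) * v\<rfloor> + squash u"
    by (simp add: encode_def)
  then have "frac (real (Suc n) * encode n u v) = squash u"
    using squash_bounds[of u] by (simp add: frac_unique_iff)
  then show ?thesis
    by (simp add: decode_def squash_def tan_arctan)
qed

lemma encode_close: "\<bar>encode n u v - v\<bar> \<le> 1 / real (Suc n)"
proof -
  define x where "x = real (Suc n) * v"
  have "real (Suc n) * (encode n u v - v) = of_int \<lfloor>x\<rfloor> + squash u - x"
    by (simp add: encode_def right_diff_distrib x_def del: of_nat_Suc)
  then have "\<bar>real (Suc n) * (encode n u v - v)\<bar> \<le> 1"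
    using squash_bounds[of u] floor_correct[of x] by (simp only:) linarith
  then have "real (Suc n) * \<bar>encode n u v - v\<bar> \<le> 1"
    by (simp add: abs_mult del: of_nat_Suc)
  then show ?thesis
    by (simp add: pos_le_divide_eq mult.commute del: of_nat_Suc)
qed

lemma encode_tendsto: "(\<lambda>n. encode n u v) \<longlonglongrightarrow> v"
proof -
  have "(\<lambda>n. encode n u v - v) \<longlonglongrightarrow> 0"
    by (rule Lim_null_comparison[OF _ LIMSEQ_inverse_real_of_nat])
      (use encode_close in \<open>auto simp: inverse_eq_divide\<close>)
  then show ?thesis by (simp add: LIM_zero_iff)
qed

lemma measurable_encode [measurable]: "(\<lambda>(u, v). encode n u v) \<in> borel \<Otimes>\<^sub>M borel \<rightarrow>\<^sub>M borel"
proof -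
  have [measurable]: "arctan \<in> borel_measurable borel"
    by (intro borel_measurable_continuous_onI continuous_on_arctan continuous_on_id)
  show ?thesis
    unfolding encode_def squash_def by measurable
qed

lemma measurable_decode [measurable]: "decode n \<in> borel \<rightarrow>\<^sub>M borel"
  unfolding decode_def frac_def tan_def by measurable

section \<open>Strict lower approximations of extended nonnegative numbers\<close>

definition low_term :: "ennreal \<Rightarrow> nat \<Rightarrow> ennreal" where
  "low_term s i = (if ennreal (real_of_rat (from_nat i)) < s then ennreal (real_of_rat (from_nat i)) else 0)"

text \<open>The best lower bound for \<open>s\<close> among the first \<open>m + 1\<close> rationals
  of an enumeration. It is strictly below \<open>s\<close> unless it is 0, is Borel in
  \<open>s\<close>, and increases to \<open>s\<close>, so it serves as a target that leaves
  slack.\<close>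

definition low :: "nat \<Rightarrow> ennreal \<Rightarrow> ennreal" where
  "low m s = Max (low_term s ` {..m})"

lemma low_less: "low m s < s \<or> low m s = 0"
proof (cases "s = 0")
  case False
  then have "low_term s i < s" for i
    by (simp add: low_term_def zero_less_iff_neq_zero)
  then show ?thesis
    unfolding low_def by (simp add: Max_less_iff)
next
  case True
  then have "low_term s = (\<lambda>_. 0)"
    by (auto simp: low_term_def)
  then show ?thesis
    by (simp add: low_def image_constant_conv)
qed

lemma incseq_low: "incseq (\<lambda>m. low m s)"
  unfolding low_def by (intro monoI Max_mono image_mono) auto

lemma SUP_low: "(SUP m. low m s) = s"
proof (rule antisym)
  show "(SUP m. low m s) \<le> s"
    using low_less[of _ s] by (intro SUP_least) (metis less_imp_le zero_le)
  show "s \<le> (SUP m. low m s)"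
  proof (rule dense_le)
    fix c assume "c < s"
    then obtain c' where c': "c < c'" "c' < s" using dense by blast
    obtain r where r: "c = ennreal r" "0 \<le> r"
      using c'(1) by (cases c) auto
    obtain r' where r': "c' = ennreal r'" "r < r'"
      using c' r by (cases c') (auto simp: ennreal_less_iff)
    obtain q where q: "r < real_of_rat q" "real_of_rat q < r'"
      using of_rat_dense[OF r'(2)] by blast
    let ?i = "to_nat q"
    have "ennreal (real_of_rat q) < s"
      using ennreal_leI[of "real_of_rat q" r'] q r' c'(2) by auto
    then have "ennreal (real_of_rat q) \<le> low ?i s"
      unfolding low_def by (intro Max_ge image_eqI[of _ _ ?i]) (auto simp: low_term_def)
    moreover have "c \<le> ennreal (real_of_rat q)"
      using q r by (auto intro: ennreal_leI)
    ultimately show "c \<le> (SUP m. low m s)"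
      by (intro SUP_upper2[of ?i]) auto
  qed
qed

lemma measurable_low [measurable]: "low m \<in> borel \<rightarrow>\<^sub>M borel"
proof -
  have "low m = (\<lambda>s. SUP i\<in>{..m}. low_term s i)"
    unfolding low_def by (auto simp: Max_Sup)
  moreover have [measurable]: "(\<lambda>s. low_term s i) \<in> borel_measurable borel" for i
    unfolding low_term_def by measurable
  ultimately show ?thesis by simp
qed

section \<open>One step of the dynamic programming recursion\<close>

text \<open>Paths are total functions, so that the product topology, its second countability and the
  Borel sets come from type classes. Kernels and terminal costs look at them through restrictions to
  the relevant coordinates. A state holds the path of \<open>x\<close>, the path of \<open>y\<close>
  and the controls.\<close>

type_synonym path = "nat \<Rightarrow> real"
type_synonym state = "path \<times> path \<times> path"

definition upd :: "nat \<Rightarrow> state \<Rightarrow> real \<Rightarrow> real \<times> real \<Rightarrow> state" where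
  "upd t z b uv = ((fst z)(t := fst uv), (fst (snd z))(t := snd uv), (snd (snd z))(t := b))"

lemma tendsto_upd:
  assumes "(Z \<longlongrightarrow> z) F" and "(B \<longlongrightarrow> b) F" and "(UV \<longlongrightarrow> uv) F"
  shows "((\<lambda>n. upd t (Z n) (B n) (UV n)) \<longlongrightarrow> upd t z b uv) F"
  unfolding upd_def using assms by (intro tendsto_Pair tendsto_fun_upd tendsto_fst tendsto_snd)

lemma measurable_upd [measurable (raw)]:
  assumes [measurable]: "Z \<in> S \<rightarrow>\<^sub>M borel" "B \<in> S \<rightarrow>\<^sub>M borel" "UV \<in> S \<rightarrow>\<^sub>M borel"
  shows "(\<lambda>s. upd t (Z s) (B s) (UV s)) \<in> S \<rightarrow>\<^sub>M borel"
  unfolding upd_def by (intro borel_measurable_Pair) measurable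

locale kernel_step =
  fixes k :: "path \<Rightarrow> real measure" and p \<delta> :: real and K :: "real set"
  assumes k: "k \<in> borel \<rightarrow>\<^sub>M prob_algebra borel"
    and k_conv: "\<And>X x. X \<longlonglongrightarrow> x \<Longrightarrow> weak_conv_m (\<lambda>n. k (X n)) (k x)"
    and p: "0 < p" and \<delta>: "0 < \<delta>" and K: "compact K" "K \<noteq> {}"
begin

lemma real_distribution_k: "real_distribution (k x)"
  using measurable_space[OF k, of x]
  by (auto simp: space_prob_algebra real_distribution_def real_distribution_axioms_def)

definition gain :: "nat \<Rightarrow> (state \<Rightarrow> ennreal) \<Rightarrow> state \<Rightarrow> real \<Rightarrow> ennreal" where
  "gain t W z b = (SUP \<pi>\<in>Pi_delta_real p \<delta> (k (fst z)). \<integral>\<^sup>+uv. W (upd t z b uv) \<partial>\<pi>)"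

definition val :: "nat \<Rightarrow> (state \<Rightarrow> ennreal) \<Rightarrow> state \<Rightarrow> ennreal" where
  "val t W z = (INF b\<in>K. gain t W z b)"

definition shift_map :: "path \<Rightarrow> real \<times> real \<Rightarrow> real \<times> real" where
  "shift_map x = (\<lambda>(w, s). (quantile (k x) w, quantile (k x) w + s))"

lemma measurable_shift_map [measurable]: "shift_map x \<in> borel \<rightarrow>\<^sub>M borel"
  using quantile_measurable[OF real_distribution_k]
  unfolding shift_map_def borel_prod[symmetric] by measurable

lemma shifts_sets:
  assumes "\<Gamma> \<in> shifts p \<delta>"
  shows "sets \<Gamma> = sets borel" and "prob_space \<Gamma>"
  using assms by (simp_all add: shifts_def space_prob_algebra)

lemma lift_shift_sets:
  assumes "\<Gamma> \<in> shifts p \<delta>"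
  shows "sets (lift_shift (k x) \<Gamma>) = sets borel" and "prob_space (lift_shift (k x) \<Gamma>)"
  using lift_shift_in_Pi_delta_real[OF assms p \<delta> real_distribution_k, of x]
  by (simp_all add: Pi_delta_real_def space_prob_algebra)

lemma nn_integral_lift_shift:
  assumes \<Gamma>: "\<Gamma> \<in> shifts p \<delta>" and [measurable]: "h \<in> borel_measurable borel"
  shows "(\<integral>\<^sup>+uv. h uv \<partial>lift_shift (k x) \<Gamma>) = (\<integral>\<^sup>+ws. h (shift_map x ws) \<partial>\<Gamma>)"
proof -
  note [measurable_cong] = shifts_sets(1)[OF \<Gamma>]
  show ?thesis
    unfolding lift_shift_def shift_map_def[symmetric] by (rule nn_integral_distr) measurable
qed

lemma measurable_W_upd:
  assumes "lsc W"
  shows "(\<lambda>uv. W (upd t z b uv)) \<in> borel_measurable borel"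
  using lsc_measurable[OF assms] by measurable

text \<open>The law \<open>\<Gamma>\<close> does not move with the state, only
  \<open>shift_map\<close> does. Weak continuity of \<open>k\<close> makes the quantiles converge
  for almost every \<open>w\<close>, hence also the transported points, and
  \<open>lsc_nn_integral\<close> applies.\<close>

lemma lsc_lift_shift:
  assumes W: "lsc W" and \<Gamma>: "\<Gamma> \<in> shifts p \<delta>"
  shows "lsc (\<lambda>(z, b). \<integral>\<^sup>+uv. W (upd t z b uv) \<partial>lift_shift (k (fst z)) \<Gamma>)"
proof -
  note [measurable_cong] = shifts_sets(1)[OF \<Gamma>]
  let ?T = "\<lambda>zb ws. upd t (fst zb) (snd zb) (shift_map (fst (fst zb)) ws)"
  have "lsc (\<lambda>zb. \<integral>\<^sup>+ws. W (?T zb ws) \<partial>\<Gamma>)"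
  proof (rule lsc_nn_integral[OF W])
    show "?T zb \<in> \<Gamma> \<rightarrow>\<^sub>M borel" for zb
      by measurable
    fix X :: "nat \<Rightarrow> (state) \<times> real" and zb assume X: "X \<longlonglongrightarrow> zb"
    have "AE w in unif. (\<lambda>n. quantile (k (fst (fst (X n)))) w) \<longlonglongrightarrow> quantile (k (fst (fst zb))) w"
      by (intro AE_quantile_tendsto k_conv real_distribution_k tendsto_fst X)
    moreover have D: "distr \<Gamma> borel fst = unif"
      using \<Gamma> by (simp add: shifts_def)
    ultimately have "AE w in distr \<Gamma> borel fst. (\<lambda>n. quantile (k (fst (fst (X n)))) w) \<longlonglongrightarrow> quantile (k (fst (fst zb))) w"
      unfolding D by simp
    from AE_distrD[OF _ this]
    have "AE ws in \<Gamma>. (\<lambda>n. quantile (k (fst (fst (X n)))) (fst ws)) \<longlonglongrightarrow> quantile (k (fst (fst zb))) (fst ws)"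
      by simp
    then show "AE ws in \<Gamma>. (\<lambda>n. ?T (X n) ws) \<longlonglongrightarrow> ?T zb ws"
    proof eventually_elim
      case (elim ws)
      then show ?case
        unfolding shift_map_def case_prod_beta
        by (intro tendsto_upd tendsto_Pair tendsto_add tendsto_fst tendsto_snd tendsto_const X)
    qed
  qed
  then show ?thesis
    using nn_integral_lift_shift[OF \<Gamma> measurable_W_upd[OF W]] by (simp add: case_prod_beta')
qed

lemma gain_eq: "gain t W z b = (SUP \<Gamma>\<in>shifts p \<delta>. \<integral>\<^sup>+uv. W (upd t z b uv) \<partial>lift_shift (k (fst z)) \<Gamma>)"
  unfolding gain_def by (rule SUP_Pi_delta_real[OF p \<delta> real_distribution_k])

lemma lsc_gain:
  assumes "lsc W"
  shows "lsc (\<lambda>(z, b). gain t W z b)"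
  unfolding gain_eq case_prod_beta'
  by (intro lsc_SUP) (use lsc_lift_shift[OF assms] in \<open>simp add: case_prod_beta'\<close>)

lemma lsc_val: "lsc W \<Longrightarrow> lsc (val t W)"
  unfolding val_def using lsc_INF[OF lsc_gain K(1)] by simp

lemma measurable_minimizer:
  assumes "lsc W"
  obtains m where "m \<in> borel_measurable borel" and "\<And>z. m z \<in> K" and "\<And>z. gain t W z (m z) = val t W z"
  using lsc_measurable_minimizer[OF lsc_gain[OF assms] K] unfolding val_def by metis

definition coded :: "(real \<times> real) measure \<Rightarrow> nat \<Rightarrow> path \<Rightarrow> (real \<times> real) measure" where
  "coded \<Gamma> n x = distr (lift_shift (k x) \<Gamma>) borel (\<lambda>uv. (fst uv, encode n (fst uv) (snd uv)))"

lemma measurable_code: "(\<lambda>uv. (fst uv, encode n (fst uv) (snd uv))) \<in> borel \<rightarrow>\<^sub>M borel"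
  unfolding borel_prod[symmetric] by measurable

context
  fixes \<Gamma> assumes \<Gamma>: "\<Gamma> \<in> shifts p \<delta>"
begin

lemma measurable_coded: "coded \<Gamma> n \<in> borel \<rightarrow>\<^sub>M prob_algebra borel"
proof -
  have "(\<lambda>x. lift_shift (k x) \<Gamma>) \<in> borel \<rightarrow>\<^sub>M prob_algebra borel"
    by (rule measurable_lift_shift[OF k \<Gamma>])
  from measurable_compose[OF this measurable_distr_prob_space[OF measurable_code]]
  show ?thesis by (simp add: coded_def[abs_def])
qed

lemma nn_integral_coded:
  assumes "h \<in> borel_measurable borel"
  shows "(\<integral>\<^sup>+uv. h uv \<partial>coded \<Gamma> n x) = (\<integral>\<^sup>+uv. h (fst uv, encode n (fst uv) (snd uv)) \<partial>lift_shift (k x) \<Gamma>)"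
proof -
  note [measurable_cong] = lift_shift_sets(1)[OF \<Gamma>, of x]
  show ?thesis
    unfolding coded_def using measurable_code[of n] assms by (intro nn_integral_distr) measurable
qed

lemma AE_coded: "AE uv in coded \<Gamma> n x. decode n (snd uv) = fst uv"
proof -
  note [measurable_cong] = lift_shift_sets(1)[OF \<Gamma>, of x]
  have [measurable]: "Measurable.pred borel (\<lambda>uv. decode n (snd uv) = fst uv)"
    by measurable
  show ?thesis
    unfolding coded_def using measurable_code[of n] by (subst AE_distr_iff) auto
qed

text \<open>Encoding leaves the first coordinate alone, so only the transport cost has to be
  controlled.\<close>

lemma coded_in_Pi_delta_real:
  assumes "(\<integral>\<^sup>+uv. ennreal (\<bar>fst uv - snd uv\<bar> powr p) \<partial>coded \<Gamma> n x) < ennreal (\<delta> powr p)"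
  shows "coded \<Gamma> n x \<in> Pi_delta_real p \<delta> (k x)"
proof -
  note [measurable_cong] = lift_shift_sets(1)[OF \<Gamma>, of x]
  have "distr (coded \<Gamma> n x) borel fst = distr (lift_shift (k x) \<Gamma>) borel fst"
    unfolding coded_def using measurable_code[of n]
    by (subst distr_distr) (auto simp: o_def)
  also have "\<dots> = k x"
    using lift_shift_in_Pi_delta_real[OF \<Gamma> p \<delta> real_distribution_k, of x] by (simp add: Pi_delta_real_def)
  finally show ?thesis
    using assms measurable_space[OF measurable_coded[of n], of x]
    by (simp add: Pi_delta_real_def pcost_less_iff[OF p \<delta>] case_prod_beta')
qed

text \<open>The cost bound in \<open>shifts\<close> is strict, and the encoded costs converge to the
  original one by dominated convergence; so they satisfy the bound for all large
  \<open>n\<close>.\<close>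

lemma coded_cost:
  "\<forall>\<^sub>F n in sequentially. (\<integral>\<^sup>+uv. ennreal (\<bar>fst uv - snd uv\<bar> powr p) \<partial>coded \<Gamma> n x) < ennreal (\<delta> powr p)"
proof -
  let ?L = "lift_shift (k x) \<Gamma>"
  note [measurable_cong] = lift_shift_sets(1)[OF \<Gamma>, of x]
  interpret L: prob_space ?L by (rule lift_shift_sets(2)[OF \<Gamma>])
  have [measurable]: "(\<lambda>uv. encode n (fst uv) (snd uv)) \<in> borel_measurable borel" for n
    using measurable_compose[OF measurable_code measurable_fst_snd_borel(2), of n] by simp
  have fin: "(\<integral>\<^sup>+uv. ennreal (\<bar>fst uv - snd uv\<bar> powr p) \<partial>?L) < ennreal (\<delta> powr p)"
    using lift_shift_in_Pi_delta_real[OF \<Gamma> p \<delta> real_distribution_k, of x]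
    by (simp add: Pi_delta_real_def pcost_less_iff[OF p \<delta>] case_prod_beta')
  have "(\<lambda>n. \<integral>\<^sup>+uv. ennreal (\<bar>fst uv - encode n (fst uv) (snd uv)\<bar> powr p) \<partial>?L) \<longlonglongrightarrow>
      (\<integral>\<^sup>+uv. ennreal (\<bar>fst uv - snd uv\<bar> powr p) \<partial>?L)"
  proof (rule nn_integral_dominated_convergence)
    \<comment> \<open>The mesh is at most 1, so the new distance is at most
      \<open>d + 1 \<le> 2 * max d 1\<close>, and the majorant bounds the p-th power of
      this.\<close>
    let ?w = "\<lambda>uv. ennreal (2 powr p) * (ennreal (\<bar>fst uv - snd uv\<bar> powr p) + 1)"
    show "AE uv in ?L. ennreal (\<bar>fst uv - encode n (fst uv) (snd uv)\<bar> powr p) \<le> ?w uv" for n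
    proof (rule AE_I2)
      fix uv :: "real \<times> real"
      let ?d = "\<bar>fst uv - snd uv\<bar>" and ?e = "\<bar>fst uv - encode n (fst uv) (snd uv)\<bar>"
      have "?e \<le> ?d + 1 / real (Suc n)"
        using encode_close[of n "fst uv" "snd uv"] by linarith
      also have "\<dots> \<le> ?d + 1"
        by simp
      also have "\<dots> \<le> 2 * max ?d 1"
        by (simp add: max_def)
      finally have "?e powr p \<le> (2 * max ?d 1) powr p"
        using p by (intro powr_mono2) auto
      also have "\<dots> = 2 powr p * max ?d 1 powr p"
        by (simp add: powr_mult)
      also have "\<dots> \<le> 2 powr p * (?d powr p + 1)"
        by (intro mult_left_mono) (auto simp: max_def)
      finally have "ennreal (?e powr p) \<le> ennreal (2 powr p * (?d powr p + 1))"
        by (rule ennreal_leI)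
      then show "ennreal (?e powr p) \<le> ?w uv"
        by (simp add: ennreal_mult ennreal_plus)
    qed
    show "(\<integral>\<^sup>+uv. ?w uv \<partial>?L) < \<infinity>"
      using fin by (simp add: nn_integral_cmult nn_integral_add L.emeasure_space_1 ennreal_mult_less_top order.strict_trans[OF _ ennreal_less_top])
    show "AE uv in ?L. (\<lambda>n. ennreal (\<bar>fst uv - encode n (fst uv) (snd uv)\<bar> powr p)) \<longlonglongrightarrow> ennreal (\<bar>fst uv - snd uv\<bar> powr p)"
      using p by (intro AE_I2 tendsto_ennrealI tendsto_powr' tendsto_rabs tendsto_diff tendsto_const encode_tendsto) auto
  qed measurable
  from order_tendstoD(2)[OF this fin] show ?thesis
    by (subst nn_integral_coded) (auto simp: )
qed

text \<open>The reward is not lost either: encoded points converge pointwise, so Fatou's lemma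
  combines with the lower semicontinuity of \<open>W\<close>.\<close>

lemma coded_liminf:
  assumes W: "lsc W"
  shows "(\<integral>\<^sup>+uv. W (upd t z b uv) \<partial>lift_shift (k x) \<Gamma>) \<le> liminf (\<lambda>n. \<integral>\<^sup>+uv. W (upd t z b uv) \<partial>coded \<Gamma> n x)"
proof -
  let ?L = "lift_shift (k x) \<Gamma>"
  note [measurable_cong] = lift_shift_sets(1)[OF \<Gamma>, of x]
  note [measurable] = measurable_code lsc_measurable[OF W]
  have "(\<integral>\<^sup>+uv. W (upd t z b uv) \<partial>?L) \<le> (\<integral>\<^sup>+uv. liminf (\<lambda>n. W (upd t z b (fst uv, encode n (fst uv) (snd uv)))) \<partial>?L)"
  proof (intro nn_integral_mono lsc_liminf[OF W] tendsto_upd tendsto_const)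
    fix uv :: "real \<times> real"
    show "(\<lambda>n. (fst uv, encode n (fst uv) (snd uv))) \<longlonglongrightarrow> uv"
      by (cases uv) (auto intro!: tendsto_Pair tendsto_const encode_tendsto)
  qed
  also have "\<dots> \<le> liminf (\<lambda>n. \<integral>\<^sup>+uv. W (upd t z b (fst uv, encode n (fst uv) (snd uv))) \<partial>?L)"
    by (intro nn_integral_liminf) measurable
  finally show ?thesis
    by (simp add: nn_integral_coded[OF measurable_W_upd[OF W]])
qed

end

text \<open>The coupling is the first admissible one in an enumeration of countably many candidates.\<close>

lemma measurable_near_maximizer:
  assumes W: "lsc W"
    and Z: "Z \<in> S \<rightarrow>\<^sub>M borel" and b: "b \<in> S \<rightarrow>\<^sub>M borel" and h: "h \<in> S \<rightarrow>\<^sub>M borel"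
    and less: "\<And>s. s \<in> space S \<Longrightarrow> h s < gain t W (Z s) (b s) \<or> h s = 0"
  obtains g m n where "g \<in> S \<rightarrow>\<^sub>M prob_algebra borel"
    and "m \<in> S \<rightarrow>\<^sub>M count_space UNIV" and "n \<in> S \<rightarrow>\<^sub>M count_space UNIV"
    and "\<And>s. s \<in> space S \<Longrightarrow> g s \<in> Pi_delta_real p \<delta> (k (fst (Z s)))"
    and "\<And>s. s \<in> space S \<Longrightarrow> h s \<le> (\<integral>\<^sup>+uv. low (m s) (W (upd t (Z s) (b s) uv)) \<partial>g s)"
    and "\<And>s. s \<in> space S \<Longrightarrow> AE uv in g s. decode (n s) (snd uv) = fst uv"
proof -
  note [measurable] = Z b h lsc_measurable[OF W]
  define \<Phi> where "\<Phi> \<Gamma> = (\<lambda>(z, b). \<integral>\<^sup>+uv. W (upd t z b uv) \<partial>lift_shift (k (fst z)) \<Gamma>)" for \<Gamma>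
  have "lsc (\<Phi> \<Gamma>)" if "\<Gamma> \<in> shifts p \<delta>" for \<Gamma>
    unfolding \<Phi>_def by (rule lsc_lift_shift[OF W that])
  from lsc_SUP_countable[of "shifts p \<delta>" \<Phi>, OF this]
  obtain C where C: "C \<subseteq> shifts p \<delta>" "countable C"
      "\<And>zb. (SUP \<Gamma>\<in>shifts p \<delta>. \<Phi> \<Gamma> zb) = (SUP \<Gamma>\<in>C. \<Phi> \<Gamma> zb)"
    by blast
  \<comment> \<open>The zero shift is added because \<open>C\<close> may be empty, whereas an
    enumeration by all natural numbers needs an element.\<close>
  define C' where "C' = insert (distr unif borel (\<lambda>w. (w, 0))) C"
  have C': "C' \<subseteq> shifts p \<delta>" "countable C'" "C' \<noteq> {}"
    using C shifts_nonempty[OF \<delta>] by (auto simp: C'_def)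
  define G where "G j = from_nat_into C' j" for j
  have G: "G j \<in> shifts p \<delta>" for j
    using from_nat_into[OF C'(3)] C'(1) by (auto simp: G_def)
  have range_G: "range G = C'"
    unfolding G_def using C' by (simp add: range_from_nat_into)
  have gain: "gain t W z b = (SUP j. \<integral>\<^sup>+uv. W (upd t z b uv) \<partial>lift_shift (k (fst z)) (G j))" for z b
  proof (rule antisym)
    have "gain t W z b = (SUP \<Gamma>\<in>C. \<integral>\<^sup>+uv. W (upd t z b uv) \<partial>lift_shift (k (fst z)) \<Gamma>)"
      using C(3)[of "(z, b)"] by (simp add: gain_eq \<Phi>_def)
    also have "\<dots> \<le> (SUP \<Gamma>\<in>range G. \<integral>\<^sup>+uv. W (upd t z b uv) \<partial>lift_shift (k (fst z)) \<Gamma>)"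
      unfolding range_G by (intro SUP_subset_mono) (auto simp: C'_def)
    finally show "gain t W z b \<le> (SUP j. \<integral>\<^sup>+uv. W (upd t z b uv) \<partial>lift_shift (k (fst z)) (G j))"
      by (simp add: image_image)
    show "(SUP j. \<integral>\<^sup>+uv. W (upd t z b uv) \<partial>lift_shift (k (fst z)) (G j)) \<le> gain t W z b"
      unfolding gain_eq using G by (intro SUP_mono) blast
  qed
  \<comment> \<open>The triple consists of the index of a shift, the index of a mesh and a level of
    \<open>low\<close>. Both conditions compare measurable functions of \<open>s\<close>, so the
    first valid triple is a measurable choice.\<close>
  define Q where "Q i s \<longleftrightarrow>
      (\<integral>\<^sup>+uv. ennreal (\<bar>fst uv - snd uv\<bar> powr p) \<partial>coded (G (fst i)) (fst (snd i)) (fst (Z s))) < ennreal (\<delta> powr p) \<and>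
      h s \<le> (\<integral>\<^sup>+uv. low (snd (snd i)) (W (upd t (Z s) (b s) uv)) \<partial>coded (G (fst i)) (fst (snd i)) (fst (Z s)))"
    for i :: "nat \<times> nat \<times> nat" and s
  have coded_S: "(\<lambda>s. coded (G j) n (fst (Z s))) \<in> S \<rightarrow>\<^sub>M prob_algebra borel" for j n
    by (rule measurable_compose[OF _ measurable_coded[OF G]]) measurable
  note coded_S' [measurable] = measurable_prob_algebraD[OF coded_S]
  have Q_meas: "Measurable.pred S (Q i)" for i
  proof -
    have [measurable]: "(\<lambda>s. \<integral>\<^sup>+uv. low m (W (upd t (Z s) (b s) uv)) \<partial>coded (G j) n (fst (Z s))) \<in> borel_measurable S" for m j n
      by (rule nn_integral_measurable_subprob_algebra2[OF _ coded_S']) measurable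
    have [measurable]: "(\<lambda>s. \<integral>\<^sup>+uv. ennreal (\<bar>fst uv - snd uv\<bar> powr p) \<partial>coded (G j) n (fst (Z s))) \<in> borel_measurable S" for j n
      by (rule nn_integral_measurable_subprob_algebra2[OF _ coded_S']) measurable
    show ?thesis
      unfolding Q_def by measurable
  qed
  \<comment> \<open>A strict excess over \<open>h s\<close> passes from the supremum to one shift,
    from there by Fatou to all fine encodings, and by monotone convergence to some level of
    \<open>low\<close>. For \<open>h s = 0\<close> only the cost condition matters.\<close>
  have Q_ex: "\<exists>i. Q i s" if s: "s \<in> space S" for s
  proof -
    let ?z = "Z s"
    have *: "\<exists>j n. (\<integral>\<^sup>+uv. ennreal (\<bar>fst uv - snd uv\<bar> powr p) \<partial>coded (G j) n (fst ?z)) < ennreal (\<delta> powr p) \<and>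
        (h s < (\<integral>\<^sup>+uv. W (upd t ?z (b s) uv) \<partial>coded (G j) n (fst ?z)) \<or> h s = 0)"
    proof (cases "h s = 0")
      case True
      then show ?thesis
        using eventually_happens[OF coded_cost[OF G, of 0 "fst ?z"]] by auto
    next
      case False
      with less[OF s] obtain j where "h s < (\<integral>\<^sup>+uv. W (upd t ?z (b s) uv) \<partial>lift_shift (k (fst ?z)) (G j))"
        by (auto simp: gain less_SUP_iff)
      then have "h s < liminf (\<lambda>n. \<integral>\<^sup>+uv. W (upd t ?z (b s) uv) \<partial>coded (G j) n (fst ?z))"
        using coded_liminf[OF G W] by (rule order.strict_trans2)
      then have "\<forall>\<^sub>F n in sequentially. h s < (\<integral>\<^sup>+uv. W (upd t ?z (b s) uv) \<partial>coded (G j) n (fst ?z))"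
        by (rule less_LiminfD)
      from eventually_happens[OF eventually_conj[OF this coded_cost[OF G, of j "fst ?z"]]] show ?thesis
        by auto
    qed
    then obtain j n where jn: "(\<integral>\<^sup>+uv. ennreal (\<bar>fst uv - snd uv\<bar> powr p) \<partial>coded (G j) n (fst ?z)) < ennreal (\<delta> powr p)"
        "h s < (\<integral>\<^sup>+uv. W (upd t ?z (b s) uv) \<partial>coded (G j) n (fst ?z)) \<or> h s = 0" by blast
    note [measurable_cong] = subprob_measurableD(2)[OF coded_S' s, of j n]
    have "(\<integral>\<^sup>+uv. W (upd t ?z (b s) uv) \<partial>coded (G j) n (fst ?z)) =
        (\<integral>\<^sup>+uv. (SUP m. low m (W (upd t ?z (b s) uv))) \<partial>coded (G j) n (fst ?z))"
      by (simp add: SUP_low)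
    also have "\<dots> = (SUP m. \<integral>\<^sup>+uv. low m (W (upd t ?z (b s) uv)) \<partial>coded (G j) n (fst ?z))"
    proof (rule nn_integral_monotone_convergence_SUP)
      show "incseq (\<lambda>m uv. low m (W (upd t ?z (b s) uv)))"
        using incseqD[OF incseq_low] by (auto intro!: monoI le_funI)
    qed measurable
    finally obtain m where "h s \<le> (\<integral>\<^sup>+uv. low m (W (upd t ?z (b s) uv)) \<partial>coded (G j) n (fst ?z))"
      using jn(2) by (auto simp: less_SUP_iff intro: less_imp_le)
    with jn(1) have "Q (j, n, m) s"
      by (simp add: Q_def)
    then show ?thesis by blast
  qed
  define i where "i s = (from_nat (LEAST j. Q (from_nat j) s) :: nat \<times> nat \<times> nat)" for s
  have Q_i: "Q (i s) s" if s: "s \<in> space S" for s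
  proof -
    obtain i' where "Q i' s" using Q_ex[OF s] by blast
    then have "Q (from_nat (to_nat i')) s" by simp
    from LeastI[of "\<lambda>j. Q (from_nat j) s", OF this] show ?thesis
      by (simp add: i_def)
  qed
  have i_meas [measurable]: "i \<in> S \<rightarrow>\<^sub>M count_space UNIV"
  proof -
    have "(\<lambda>s. LEAST j. Q (from_nat j) s) \<in> S \<rightarrow>\<^sub>M count_space UNIV"
      using Q_meas by measurable
    then show ?thesis
      unfolding i_def[abs_def] by (rule measurable_compose) simp
  qed
  show thesis
  proof
    show "(\<lambda>s. coded (G (fst (i s))) (fst (snd (i s))) (fst (Z s))) \<in> S \<rightarrow>\<^sub>M prob_algebra borel"
      by (rule measurable_compose_countable[OF coded_S i_meas, of "\<lambda>i. fst i" "\<lambda>i. fst (snd i)"])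
    show "(\<lambda>s. snd (snd (i s))) \<in> S \<rightarrow>\<^sub>M count_space UNIV" "(\<lambda>s. fst (snd (i s))) \<in> S \<rightarrow>\<^sub>M count_space UNIV"
      by (rule measurable_compose[OF i_meas], simp)+
    fix s assume s: "s \<in> space S"
    show "coded (G (fst (i s))) (fst (snd (i s))) (fst (Z s)) \<in> Pi_delta_real p \<delta> (k (fst (Z s)))"
      using Q_i[OF s] by (intro coded_in_Pi_delta_real G) (simp add: Q_def)
    show "h s \<le> (\<integral>\<^sup>+uv. low (snd (snd (i s))) (W (upd t (Z s) (b s) uv)) \<partial>coded (G (fst (i s))) (fst (snd (i s))) (fst (Z s)))"
      using Q_i[OF s] by (simp add: Q_def)
    show "AE uv in coded (G (fst (i s))) (fst (snd (i s))) (fst (Z s)). decode (fst (snd (i s))) (snd uv) = fst uv"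
      by (rule AE_coded[OF G])
  qed
qed

end

section \<open>Products of kernels\<close>

abbreviation Rn2 :: "nat \<Rightarrow> (path \<times> path) measure" where
  "Rn2 n \<equiv> Rn n \<Otimes>\<^sub>M Rn n"

lemma measurable_Rn_upd [measurable (raw)]:
  assumes "f \<in> M \<rightarrow>\<^sub>M Rn n" and "h \<in> M \<rightarrow>\<^sub>M borel"
  shows "(\<lambda>z. (f z)(n := h z)) \<in> M \<rightarrow>\<^sub>M Rn (Suc n)"
  using assms by (intro measurable_fun_upd) (auto simp: lessThan_Suc)

lemma measurable_Rn_restrict:
  assumes "t \<le> n"
  shows "(\<lambda>x. restrict x {..<t}) \<in> Rn n \<rightarrow>\<^sub>M Rn t"
  using assms by (intro measurable_restrict_subset) auto

lemma restrict_Rn: "x \<in> space (Rn n) \<Longrightarrow> restrict x {..<n} = x"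
  by (auto simp: space_PiM)

text \<open>Coordinates from \<open>n\<close> on are constantly \<open>undefined\<close>, so the
  embedding of the extensional space into all paths is measurable.\<close>

lemma measurable_Rn_borel: "(\<lambda>x. x) \<in> Rn n \<rightarrow>\<^sub>M (borel :: (nat \<Rightarrow> real) measure)"
proof (rule measurable_coordinatewise_then_product)
  fix i
  show "(\<lambda>x. x i) \<in> Rn n \<rightarrow>\<^sub>M (borel :: real measure)"
  proof (cases "i < n")
    case False
    have "(\<lambda>x. x i) \<in> Rn n \<rightarrow>\<^sub>M (borel :: real measure) \<longleftrightarrow> (\<lambda>x. undefined) \<in> Rn n \<rightarrow>\<^sub>M (borel :: real measure)"
      by (rule measurable_cong) (use False in \<open>auto simp: space_PiM PiE_def extensional_def\<close>)
    then show ?thesis by simp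
  qed simp
qed

lemma measurable_borel_Rn: "(\<lambda>x. restrict x {..<n}) \<in> (borel :: (nat \<Rightarrow> real) measure) \<rightarrow>\<^sub>M Rn n"
  by (intro measurable_restrict) simp

lemma space_Rn_0: "space (Rn 0) = {\<lambda>_. undefined}"
  by (simp add: space_PiM_empty)

lemma upd_in_Rn: "x \<in> space (Rn n) \<Longrightarrow> x(n := u) \<in> space (Rn (Suc n))"
  by (auto simp: space_PiM PiE_def extensional_def)

definition pair_upd :: "nat \<Rightarrow> path \<times> path \<Rightarrow> real \<times> real \<Rightarrow> path \<times> path" where
  "pair_upd n xy uv = ((fst xy)(n := fst uv), (snd xy)(n := snd uv))"

lemma measurable_pair_upd [measurable (raw)]:
  assumes [measurable]: "f \<in> M \<rightarrow>\<^sub>M Rn2 n" "h \<in> M \<rightarrow>\<^sub>M borel"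
  shows "(\<lambda>z. pair_upd n (f z) (h z)) \<in> M \<rightarrow>\<^sub>M Rn2 (Suc n)"
  unfolding pair_upd_def by measurable

lemma pair_kernel_prod_Suc:
  "pair_kernel_prod g (Suc n) =
     pair_kernel_prod g n \<bind> (\<lambda>xy. distr (g n xy) (Rn2 (Suc n)) (pair_upd n xy))"
  by (simp add: pair_upd_def[abs_def] case_prod_beta')

locale pair_kernels =
  fixes g :: pair_kernels and n :: nat
  assumes g: "\<And>s. s < n \<Longrightarrow> g s \<in> Rn2 s \<rightarrow>\<^sub>M prob_algebra borel"
begin

lemma measurable_step:
  assumes "s < n"
  shows "(\<lambda>xy. distr (g s xy) (Rn2 (Suc s)) (pair_upd s xy)) \<in>
    Rn2 s \<rightarrow>\<^sub>M prob_algebra (Rn2 (Suc s))"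
  using g[OF assms] by measurable

lemma pair_kernel_prod_in:
  assumes "s \<le> n"
  shows "pair_kernel_prod g s \<in> space (prob_algebra (Rn2 s))"
  using assms
proof (induction s)
  case 0
  have "(\<lambda>_. undefined, \<lambda>_. undefined) \<in> space (Rn2 0)"
    by (simp add: space_pair_measure space_Rn_0)
  from measurable_space[OF measurable_return_prob_space this] show ?case
    by simp
next
  case (Suc s)
  \<comment> \<open>Membership in \<open>prob_algebra\<close> is phrased as measurability from a
    one-point space, so that the lemma on measurable binds applies.\<close>
  then have "(\<lambda>_. pair_kernel_prod g s) \<in> count_space {()} \<rightarrow>\<^sub>M prob_algebra (Rn2 s)"
    by simp
  from measurable_bind_prob_space[OF this measurable_step[of s]] Suc.prems
  have "(\<lambda>_. pair_kernel_prod g (Suc s)) \<in> count_space {()} \<rightarrow>\<^sub>M prob_algebra (Rn2 (Suc s))"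
    unfolding pair_kernel_prod_Suc by simp
  from measurable_space[OF this] show ?case
    by simp
qed

lemma sets_pair_kernel_prod:
  assumes "s \<le> n"
  shows "sets (pair_kernel_prod g s) = sets (Rn2 s)"
  using pair_kernel_prod_in[OF assms] by (simp add: space_prob_algebra)

lemma space_pair_kernel_prod:
  assumes "s \<le> n"
  shows "space (pair_kernel_prod g s) = space (Rn2 s)"
  using sets_pair_kernel_prod[OF assms] by (rule sets_eq_imp_space_eq)

lemma sets_g:
  assumes "s < n" and "xy \<in> space (Rn2 s)"
  shows "sets (g s xy) = sets borel" and "prob_space (g s xy)"
  using measurable_space[OF g[OF assms(1)] assms(2)] by (simp_all add: space_prob_algebra)

lemma measurable_step':
  assumes "s < n"
  shows "(\<lambda>xy. distr (g s xy) (Rn2 (Suc s)) (pair_upd s xy)) \<in>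
    pair_kernel_prod g s \<rightarrow>\<^sub>M subprob_algebra (Rn2 (Suc s))"
  using measurable_prob_algebraD[OF measurable_step[OF assms]] sets_pair_kernel_prod[of s] assms
  by (simp cong: measurable_cong_sets)

lemma measurable_pair_upd_g:
  assumes "s < n" and "xy \<in> space (Rn2 s)"
  shows "pair_upd s xy \<in> g s xy \<rightarrow>\<^sub>M Rn2 (Suc s)"
proof -
  note [measurable_cong] = sets_g(1)[OF assms]
  show ?thesis using assms(2) by measurable
qed

lemma nn_integral_Suc:
  assumes s: "s < n" and h: "h \<in> borel_measurable (Rn2 (Suc s))"
  shows "(\<integral>\<^sup>+z. h z \<partial>pair_kernel_prod g (Suc s)) =
    (\<integral>\<^sup>+xy. \<integral>\<^sup>+uv. h (pair_upd s xy uv) \<partial>g s xy \<partial>pair_kernel_prod g s)"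
  unfolding pair_kernel_prod_Suc nn_integral_bind[OF h measurable_step'[OF s]]
  using s space_pair_kernel_prod[of s] h
  by (intro nn_integral_cong nn_integral_distr measurable_pair_upd_g) auto

lemma AE_Suc:
  assumes s: "s < n" and P: "Measurable.pred (Rn2 (Suc s)) P"
  shows "(AE z in pair_kernel_prod g (Suc s). P z) \<longleftrightarrow>
    (AE xy in pair_kernel_prod g s. AE uv in g s xy. P (pair_upd s xy uv))"
  unfolding pair_kernel_prod_Suc AE_bind[OF measurable_step'[OF s] P]
  using s space_pair_kernel_prod[of s] P
  by (intro AE_cong AE_distr_iff measurable_pair_upd_g) auto

end

section \<open>Bicausality\<close>

text \<open>If at each step the first new coordinate can be read off the second one and the history,
  then the whole first path is recovered recursively from the second.\<close>

locale decodable_kernels = pair_kernels g n for g n +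
  fixes dec :: "nat \<Rightarrow> (path \<times> path) \<times> real \<Rightarrow> real"
  assumes dec: "\<And>s. s < n \<Longrightarrow> dec s \<in> (Rn2 s) \<Otimes>\<^sub>M borel \<rightarrow>\<^sub>M borel"
    and dec_g: "\<And>s xy. s < n \<Longrightarrow> xy \<in> space (Rn2 s) \<Longrightarrow> AE uv in g s xy. dec s (xy, snd uv) = fst uv"
begin

primrec dec_path :: "nat \<Rightarrow> path \<Rightarrow> path" where
  "dec_path 0 y = (\<lambda>_. undefined)"
| "dec_path (Suc s) y = (dec_path s y)(s := dec s ((dec_path s y, restrict y {..<s}), y s))"

lemma measurable_dec_path: "s \<le> m \<Longrightarrow> m \<le> n \<Longrightarrow> dec_path s \<in> Rn m \<rightarrow>\<^sub>M Rn s"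
proof (induction s)
  case 0
  show ?case by (auto intro!: measurable_const simp: space_Rn_0)
next
  case (Suc s)
  then have [measurable]: "dec_path s \<in> Rn m \<rightarrow>\<^sub>M Rn s" "(\<lambda>y. restrict y {..<s}) \<in> Rn m \<rightarrow>\<^sub>M Rn s"
      "(\<lambda>y. y s) \<in> Rn m \<rightarrow>\<^sub>M borel" "dec s \<in> (Rn2 s) \<Otimes>\<^sub>M borel \<rightarrow>\<^sub>M borel"
    using dec by (auto intro: measurable_Rn_restrict measurable_component_singleton)
  have eq: "dec_path (Suc s) = (\<lambda>y. (dec_path s y)(s := dec s ((dec_path s y, restrict y {..<s}), y s)))"
    by (rule ext) (rule dec_path.simps)
  show ?case
    unfolding eq by measurable
qed

lemma dec_path_cong: "(\<And>i. i < s \<Longrightarrow> y i = y' i) \<Longrightarrow> dec_path s y = dec_path s y'"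
proof (induction s)
  case (Suc s)
  then have "restrict y {..<s} = restrict y' {..<s}" by auto
  with Suc show ?case by simp
qed simp

lemma dec_path_extensional: "dec_path s y \<in> extensional {..<s}"
  by (induction s) (auto simp: extensional_def)

lemma restrict_dec_path: "s \<le> m \<Longrightarrow> restrict (dec_path m y) {..<s} = dec_path s (restrict y {..<s})"
proof (induction m)
  case 0
  then show ?case by auto
next
  case (Suc m)
  show ?case
  proof (cases "s = Suc m")
    case True
    have "restrict (dec_path s y) {..<s} = dec_path s y"
      using dec_path_extensional by (rule extensional_restrict)
    moreover have "dec_path s y = dec_path s (restrict y {..<s})"
      by (rule dec_path_cong) auto
    ultimately show ?thesis
      unfolding True[symmetric] by (rule trans)
  next
    case False
    with Suc.prems have "s \<le> m" by simp
    then have "restrict (dec_path (Suc m) y) {..<s} = restrict (dec_path m y) {..<s}"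
      by (auto simp: restrict_def fun_eq_iff)
    also have "\<dots> = dec_path s (restrict y {..<s})"
      by (rule Suc.IH) fact
    finally show ?thesis .
  qed
qed

lemma AE_dec_path: "s \<le> n \<Longrightarrow> AE xy in pair_kernel_prod g s. fst xy = dec_path s (snd xy)"
proof (induction s)
  case 0
  then show ?case
    using space_pair_kernel_prod[of 0]
    by (intro AE_I2) (auto simp: space_pair_measure space_PiM_empty)
next
  case (Suc s)
  \<comment> \<open>Equality of extensional paths is a finite conjunction over coordinates, which
    makes the predicate measurable.\<close>
  have eq: "Measurable.pred (Rn2 (Suc s)) (\<lambda>xy. fst xy = dec_path (Suc s) (snd xy))"
  proof -
    have [measurable]: "dec_path (Suc s) \<in> Rn (Suc s) \<rightarrow>\<^sub>M Rn (Suc s)"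
      using Suc.prems by (intro measurable_dec_path) auto
    have comp: "Measurable.pred (Rn2 (Suc s)) (\<lambda>xy. fst xy i = dec_path (Suc s) (snd xy) i)"
      if "i \<in> {..<Suc s}" for i
    proof -
      have [measurable]: "(\<lambda>x. x i) \<in> Rn (Suc s) \<rightarrow>\<^sub>M (borel :: real measure)"
        using that by (rule measurable_component_singleton)
      show ?thesis by measurable
    qed
    have "Measurable.pred (Rn2 (Suc s)) (\<lambda>xy. \<forall>i\<in>{..<Suc s}. fst xy i = dec_path (Suc s) (snd xy) i)"
      by (rule pred_intros_finite(3)[OF finite_lessThan comp])
    also have "?this \<longleftrightarrow> ?thesis"
    proof (rule measurable_cong)
      fix xy assume "xy \<in> space (Rn2 (Suc s))"
      then have "fst xy \<in> extensional {..<Suc s}"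
        by (auto simp: space_pair_measure space_PiM PiE_def)
      then show "(\<forall>i\<in>{..<Suc s}. fst xy i = dec_path (Suc s) (snd xy) i) \<longleftrightarrow> fst xy = dec_path (Suc s) (snd xy)"
        using dec_path_extensional[of "Suc s" "snd xy"]
        by (auto simp del: dec_path.simps intro: extensionalityI[where A="{..<Suc s}"])
    qed
    finally show ?thesis .
  qed
  have "AE xy in pair_kernel_prod g s. AE uv in g s xy. fst (pair_upd s xy uv) = dec_path (Suc s) (snd (pair_upd s xy uv))"
    using Suc.IH[OF Suc_leD[OF Suc.prems]] AE_space
  proof eventually_elim
    case (elim xy)
    with Suc.prems have xy: "xy \<in> space (Rn2 s)"
      by (simp add: space_pair_kernel_prod)
    then have r: "restrict (snd xy) {..<s} = snd xy"
      by (auto simp: space_pair_measure restrict_Rn)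
    have "AE uv in g s xy. dec s (xy, snd uv) = fst uv"
      using Suc.prems xy by (intro dec_g) auto
    then show ?case
    proof eventually_elim
      case (elim uv)
      have "dec_path s ((snd xy)(s := snd uv)) = dec_path s (snd xy)"
        by (rule dec_path_cong) auto
      moreover have "restrict ((snd xy)(s := snd uv)) {..<s} = restrict (snd xy) {..<s}"
        by (auto simp: restrict_def)
      ultimately show ?case
        using elim \<open>fst xy = dec_path s (snd xy)\<close>[symmetric] r by (simp add: pair_upd_def)
    qed
  qed
  then show ?case
    by (rule AE_Suc[OF Suc_le_lessD[OF Suc.prems] eq, THEN iffD2])
qed

text \<open>A version of the conditional law of the next \<open>y\<close> given the past of
  \<open>y\<close> alone: the past of \<open>x\<close> is almost surely \<open>dec_path s y\<close>,
  so conditioning on both pasts adds nothing.\<close>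

definition snd_kernel :: "nat \<Rightarrow> path \<Rightarrow> real measure" where
  "snd_kernel s y = distr (g s (dec_path s y, y)) borel snd"

lemma measurable_snd_kernel:
  assumes "s < n"
  shows "snd_kernel s \<in> Rn s \<rightarrow>\<^sub>M prob_algebra borel"
proof -
  have [measurable]: "g s \<in> Rn2 s \<rightarrow>\<^sub>M prob_algebra borel" "dec_path s \<in> Rn s \<rightarrow>\<^sub>M Rn s"
    using assms by (auto intro!: g measurable_dec_path)
  have "(\<lambda>y. g s (dec_path s y, y)) \<in> Rn s \<rightarrow>\<^sub>M prob_algebra borel"
    by measurable
  from measurable_compose[OF this measurable_distr_prob_space[OF measurable_fst_snd_borel(2)]]
  show ?thesis
    by (simp add: snd_kernel_def[abs_def])
qed

lemma distr_snd_pair_kernel_prod: "s \<le> n \<Longrightarrow> distr (pair_kernel_prod g s) (Rn s) snd = kernel_prod snd_kernel s"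
proof (induction s)
  case 0
  show ?case
    by (simp add: space_pair_measure space_Rn_0 distr_return)
next
  case (Suc s)
  then have s: "s < n" by simp
  have sets_s [measurable_cong]: "sets (pair_kernel_prod g s) = sets (Rn2 s)"
    using s by (intro sets_pair_kernel_prod) simp
  have sets_Ss [measurable_cong]: "sets (pair_kernel_prod g (Suc s)) = sets (Rn2 (Suc s))"
    using s by (intro sets_pair_kernel_prod) simp
  note [measurable] = measurable_snd_kernel[OF s]
  have H: "(\<lambda>y. distr (snd_kernel s y) (Rn (Suc s)) (\<lambda>u. y(s := u))) \<in> Rn s \<rightarrow>\<^sub>M subprob_algebra (Rn (Suc s))"
    by (rule measurable_prob_algebraD) measurable
  have H': "(\<lambda>y. distr (snd_kernel s y) (Rn (Suc s)) (\<lambda>u. y(s := u))) \<in>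
      distr (pair_kernel_prod g s) (Rn s) snd \<rightarrow>\<^sub>M subprob_algebra (Rn (Suc s))"
    using H by simp
  have ne: "space (pair_kernel_prod g s) \<noteq> {}"
    using pair_kernel_prod_in[of s] s by (auto simp: space_prob_algebra prob_space.not_empty)
  show ?case
  proof (rule measure_eqI)
    show "sets (distr (pair_kernel_prod g (Suc s)) (Rn (Suc s)) snd) = sets (kernel_prod snd_kernel (Suc s))"
      using ne by (simp add: Suc.IH[symmetric] s less_imp_le sets_bind[OF sets_kernel[OF H']])
    fix A assume "A \<in> sets (distr (pair_kernel_prod g (Suc s)) (Rn (Suc s)) snd)"
    then have A [measurable]: "A \<in> sets (Rn (Suc s))" by simp
    have "emeasure (distr (pair_kernel_prod g (Suc s)) (Rn (Suc s)) snd) A =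
        (\<integral>\<^sup>+xy. indicator A (snd xy) \<partial>pair_kernel_prod g (Suc s))"
      by (simp add: nn_integral_distr[symmetric, of snd _ "Rn (Suc s)" "indicator A"] del: pair_kernel_prod.simps)
    also have "\<dots> = (\<integral>\<^sup>+xy. \<integral>\<^sup>+uv. indicator A ((snd xy)(s := snd uv)) \<partial>g s xy \<partial>pair_kernel_prod g s)"
      by (subst nn_integral_Suc[OF s]) (auto simp: pair_upd_def)
    \<comment> \<open>Almost surely \<open>g s xy\<close> is the kernel at the decoded path; after
      this replacement the integrand depends on \<open>y\<close> only and can be integrated against
      the second marginal.\<close>
    also have "\<dots> = (\<integral>\<^sup>+xy. emeasure (distr (snd_kernel s (snd xy)) (Rn (Suc s)) (\<lambda>u. (snd xy)(s := u))) A \<partial>pair_kernel_prod g s)"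
    proof (rule nn_integral_cong_AE)
      show "AE xy in pair_kernel_prod g s. (\<integral>\<^sup>+uv. indicator A ((snd xy)(s := snd uv)) \<partial>g s xy) =
          emeasure (distr (snd_kernel s (snd xy)) (Rn (Suc s)) (\<lambda>u. (snd xy)(s := u))) A"
        using AE_dec_path[OF less_imp_le[OF s]] AE_space
      proof eventually_elim
        case (elim xy)
        then have xy: "xy \<in> space (Rn2 s)"
          using s by (simp add: space_pair_kernel_prod)
        then have y [measurable]: "snd xy \<in> space (Rn s)"
          by (auto simp: space_pair_measure)
        note [measurable_cong] = sets_g(1)[OF s xy]
        have sk: "snd_kernel s (snd xy) = distr (g s xy) borel snd"
          using elim(1) unfolding snd_kernel_def by (metis prod.collapse)
        show ?case
          unfolding sk by (subst distr_distr) (auto simp: o_def nn_integral_distr[symmetric, of "\<lambda>uv. (snd xy)(s := snd uv)" _ "Rn (Suc s)" "indicator A"])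
      qed
    qed
    also have "\<dots> = (\<integral>\<^sup>+y. emeasure (distr (snd_kernel s y) (Rn (Suc s)) (\<lambda>u. y(s := u))) A \<partial>distr (pair_kernel_prod g s) (Rn s) snd)"
      using measurable_emeasure_kernel[OF H A] by (subst nn_integral_distr) auto
    also have "\<dots> = emeasure (distr (pair_kernel_prod g s) (Rn s) snd \<bind> (\<lambda>y. distr (snd_kernel s y) (Rn (Suc s)) (\<lambda>u. y(s := u)))) A"
      using ne by (subst emeasure_bind[OF _ H' A]) auto
    finally show "emeasure (distr (pair_kernel_prod g (Suc s)) (Rn (Suc s)) snd) A = emeasure (kernel_prod snd_kernel (Suc s)) A"
      using Suc by simp
  qed
qed

text \<open>The first marginal of \<open>g t\<close> is right by assumption, and the second one is
  \<open>snd_kernel t y\<close> by definition as soon as \<open>x\<close> is the decoded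
  path.\<close>

lemma bicausal:
  assumes \<kappa>: "\<And>t x y. t < n \<Longrightarrow> x \<in> space (Rn t) \<Longrightarrow> y \<in> space (Rn t) \<Longrightarrow> distr (g t (x, y)) borel fst = \<kappa> t x"
  shows "bicausal n \<kappa> g"
  unfolding bicausal_def
proof (intro exI conjI allI impI)
  show "disintegration n (distr (pair_kernel_prod g n) (Rn n) snd) snd_kernel"
    using measurable_snd_kernel distr_snd_pair_kernel_prod by (auto simp: disintegration_def)
  fix t assume t: "t < n"
  have "AE xy in pair_kernel_prod g n. g t (restrict (fst xy) {..<t}, restrict (snd xy) {..<t})
             \<in> couplings (\<kappa> t (restrict (fst xy) {..<t})) (snd_kernel t (restrict (snd xy) {..<t}))"
    using AE_dec_path[OF order_refl] AE_space
  proof eventually_elim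
    case (elim xy)
    define x y where "x = restrict (fst xy) {..<t}" and "y = restrict (snd xy) {..<t}"
    have xy: "x \<in> space (Rn t)" "y \<in> space (Rn t)"
      by (auto simp: x_def y_def space_PiM)
    \<comment> \<open>Decoding is nonanticipative, so the identity at the horizon restricts to time
      \<open>t\<close>.\<close>
    have x: "x = dec_path t y"
      using elim(1) restrict_dec_path[of t n "snd xy"] t by (simp add: x_def y_def)
    have g_sets: "sets (g t (x, y)) = sets borel" "prob_space (g t (x, y))"
      using xy by (auto intro!: sets_g[OF t] simp: space_pair_measure)
    have \<kappa>': "distr (g t (x, y)) borel fst = \<kappa> t x"
      using \<kappa> t xy by simp
    have \<nu>: "distr (g t (x, y)) borel snd = snd_kernel t y"
      by (simp add: snd_kernel_def x)
    have s: "sets (\<kappa> t x) = sets borel" "sets (snd_kernel t y) = sets borel"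
      unfolding \<kappa>'[symmetric] \<nu>[symmetric] by simp_all
    have "g t (x, y) \<in> couplings (\<kappa> t x) (snd_kernel t y)"
      using \<kappa>' \<nu> g_sets
      by (simp add: couplings_def space_prob_algebra sets_pair_measure_cong[OF s] s borel_prod[symmetric] cong: distr_cong)
    then show ?case by (simp add: x_def y_def)
  qed
  then show "AE (x, y) in pair_kernel_prod g n. g t (restrict x {..<t}, restrict y {..<t})
             \<in> couplings (\<kappa> t (restrict x {..<t})) (snd_kernel t (restrict y {..<t}))"
    by (simp add: case_prod_beta')
qed

end

section \<open>Dynamic programming for nonnegative costs\<close>

primrec feedback :: "(nat \<Rightarrow> state \<Rightarrow> real) \<Rightarrow> nat \<Rightarrow> path \<times> path \<Rightarrow> path" where
  "feedback m 0 xy = (\<lambda>_. undefined)"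
| "feedback m (Suc t) xy =
     (feedback m t xy)(t := m t (restrict (fst xy) {..<t}, restrict (snd xy) {..<t}, feedback m t xy))"

text \<open>The latest of the first \<open>t\<close> controls has index \<open>t - 1\<close> and
  sees only coordinates below \<open>t - 1\<close>; hence the condition
  \<open>Suc i < t\<close>.\<close>

lemma feedback_cong:
  "(\<And>i. Suc i < t \<Longrightarrow> x i = x' i \<and> y i = y' i) \<Longrightarrow> feedback m t (x, y) = feedback m t (x', y')"
proof (induction t)
  case (Suc t)
  then have "restrict x {..<t} = restrict x' {..<t}" "restrict y {..<t} = restrict y' {..<t}"
    by auto
  with Suc show ?case by simp
qed simp

lemma feedback_nth: "i < t \<Longrightarrow> feedback m t xy i =
    m i (restrict (fst xy) {..<i}, restrict (snd xy) {..<i}, feedback m i xy)"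
  by (induction t) (auto simp: less_Suc_eq)

lemma measurable_feedback:
  assumes "\<And>s. s < t \<Longrightarrow> m s \<in> borel_measurable borel" and "t \<le> n"
  shows "feedback m t \<in> Rn2 n \<rightarrow>\<^sub>M Rn t"
  using assms
proof (induction t)
  case 0
  show ?case by (auto intro!: measurable_const simp: space_Rn_0)
next
  case (Suc t)
  then have [measurable]: "feedback m t \<in> Rn2 n \<rightarrow>\<^sub>M Rn t" "m t \<in> borel_measurable borel"
      "(\<lambda>x. restrict x {..<t}) \<in> Rn n \<rightarrow>\<^sub>M Rn t"
    by (auto intro: measurable_Rn_restrict)
  note [measurable] = measurable_Rn_borel measurable_compose[OF _ measurable_Rn_borel]
  have "(\<lambda>xy. (restrict (fst xy) {..<t}, restrict (snd xy) {..<t}, feedback m t xy)) \<in> Rn2 n \<rightarrow>\<^sub>M borel"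
    by (intro borel_measurable_Pair measurable_compose[OF _ measurable_Rn_borel]) measurable
  then have [measurable]: "(\<lambda>xy. m t (restrict (fst xy) {..<t}, restrict (snd xy) {..<t}, feedback m t xy)) \<in> borel_measurable (Rn2 n)"
    by measurable
  have eq: "feedback m (Suc t) = (\<lambda>xy. (feedback m t xy)(t := m t (restrict (fst xy) {..<t}, restrict (snd xy) {..<t}, feedback m t xy)))"
    by (rule ext) (rule feedback.simps)
  show ?case
    unfolding eq by measurable
qed

lemma pair_kernels_delta_kernels: "delta_kernels p \<delta> N \<kappa> g \<Longrightarrow> pair_kernels g N"
  by unfold_locales (simp add: delta_kernels_def)

lemma delta_kernels_cases:
  assumes "delta_kernels p \<delta> N \<kappa> g" and "t < N" and "xy \<in> space (Rn2 t)"
  shows "g t xy \<in> Pi_delta_real p \<delta> (\<kappa> t (fst xy))"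
  using assms by (cases xy) (auto simp: delta_kernels_def space_pair_measure)

locale control_problem =
  fixes N :: nat and p \<delta> :: real and K :: "real set" and \<kappa> :: "nat \<Rightarrow> path \<Rightarrow> real measure"
    and F :: "state \<Rightarrow> ennreal"
  assumes \<kappa>: "\<And>t. t < N \<Longrightarrow> \<kappa> t \<in> Rn t \<rightarrow>\<^sub>M prob_algebra borel"
    and \<kappa>_conv: "\<And>t X x. t < N \<Longrightarrow> X \<longlonglongrightarrow> x \<Longrightarrow>
      weak_conv_m (\<lambda>n. \<kappa> t (restrict (X n) {..<t})) (\<kappa> t (restrict x {..<t}))"
    and p: "0 < p" and \<delta>: "0 < \<delta>" and K: "compact K" "K \<noteq> {}" and F: "lsc F"
begin

definition kr :: "nat \<Rightarrow> path \<Rightarrow> real measure" where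
  "kr t x = \<kappa> t (restrict x {..<t})"

lemma kernel_step_kr: "t < N \<Longrightarrow> kernel_step (kr t) p \<delta> K"
  using measurable_compose[OF measurable_borel_Rn \<kappa>] \<kappa>_conv p \<delta> K
  by unfold_locales (auto simp: kr_def[abs_def])

text \<open>Indexed by the number of remaining steps, which makes the backward recursion primitive;
  \<open>U\<close> restores the time index.\<close>

primrec val_to_go :: "nat \<Rightarrow> state \<Rightarrow> ennreal" where
  "val_to_go 0 = F"
| "val_to_go (Suc n) = kernel_step.val (kr (N - Suc n)) p \<delta> K (N - Suc n) (val_to_go n)"

definition U :: "nat \<Rightarrow> state \<Rightarrow> ennreal" where
  "U t = val_to_go (N - t)"

lemma U_N: "U N = F"
  by (simp add: U_def)

lemma U_step: "t < N \<Longrightarrow> U t = kernel_step.val (kr t) p \<delta> K t (U (Suc t))"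
  by (simp add: U_def Suc_diff_Suc[symmetric])

lemma lsc_U: "t \<le> N \<Longrightarrow> lsc (U t)"
proof (induction t rule: inc_induct)
  case base
  show ?case by (simp add: U_N F)
next
  case (step t)
  interpret S: kernel_step "kr t" p \<delta> K by (rule kernel_step_kr) fact
  show ?case
    using step by (simp add: U_step S.lsc_val)
qed

lemma measurable_U_Rn:
  assumes t: "t \<le> N" and A: "A \<in> Rn2 t \<rightarrow>\<^sub>M Rn t"
  shows "(\<lambda>xy. U t (fst xy, snd xy, A xy)) \<in> borel_measurable (Rn2 t)"
proof -
  note [measurable] = A lsc_measurable[OF lsc_U[OF t]]
  have "(\<lambda>xy. (fst xy, snd xy, A xy)) \<in> Rn2 t \<rightarrow>\<^sub>M borel"
    by (intro borel_measurable_Pair measurable_compose[OF _ measurable_Rn_borel]) measurable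
  then show ?thesis by measurable
qed

abbreviation start :: "state" where
  "start \<equiv> (\<lambda>_. undefined, \<lambda>_. undefined, \<lambda>_. undefined)"

text \<open>If the controls follow measurable minimizers, \<open>U\<close> along the controlled
  paths is a supermartingale under every choice of admissible kernels, so the expected terminal cost
  is at most the initial value.\<close>

lemma minimizing_control:
  obtains \<alpha> where "\<alpha> \<in> controls N K"
    and "\<And>g. delta_kernels p \<delta> N \<kappa> g \<Longrightarrow> (\<integral>\<^sup>+xy. F (fst xy, snd xy, \<alpha> xy) \<partial>pair_kernel_prod g N) \<le> U 0 start"
proof -
  have "\<exists>m. m \<in> borel_measurable borel \<and> (\<forall>z. m z \<in> K) \<and> (\<forall>z. kernel_step.gain (kr t) p \<delta> t (U (Suc t)) z (m z) = U t z)"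
    if "t < N" for t
  proof -
    interpret S: kernel_step "kr t" p \<delta> K by (rule kernel_step_kr) fact
    have "lsc (U (Suc t))" using that by (intro lsc_U) simp
    from S.measurable_minimizer[OF this, of t] show ?thesis
      unfolding U_step[OF that] by metis
  qed
  then obtain m where m: "\<And>t. t < N \<Longrightarrow> m t \<in> borel_measurable borel" "\<And>t z. t < N \<Longrightarrow> m t z \<in> K"
      "\<And>t z. t < N \<Longrightarrow> kernel_step.gain (kr t) p \<delta> t (U (Suc t)) z (m t z) = U t z"
    by metis
  let ?\<alpha> = "feedback m N"
  show thesis
  proof
    have "?\<alpha> (x, y) t = ?\<alpha> (x', y') t" if "t < N" "\<forall>i<t. x i = x' i \<and> y i = y' i" for x x' y y' t
    proof -
      have "restrict x {..<t} = restrict x' {..<t}" "restrict y {..<t} = restrict y' {..<t}"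
        using that by auto
      moreover have "feedback m t (x, y) = feedback m t (x', y')"
        using that by (intro feedback_cong) auto
      ultimately show ?thesis using that(1) by (simp add: feedback_nth)
    qed
    then show "?\<alpha> \<in> controls N K"
      using measurable_feedback[of N m N] m by (auto simp: controls_def feedback_nth)
    fix g assume dk: "delta_kernels p \<delta> N \<kappa> g"
    interpret pair_kernels g N by (rule pair_kernels_delta_kernels[OF dk])
    have meas: "(\<lambda>xy. U t (fst xy, snd xy, feedback m t xy)) \<in> borel_measurable (Rn2 t)" if "t \<le> N" for t
      using that m by (intro measurable_U_Rn measurable_feedback) auto
    have "t \<le> N \<Longrightarrow> (\<integral>\<^sup>+xy. U t (fst xy, snd xy, feedback m t xy) \<partial>pair_kernel_prod g t) \<le> U 0 start" for t
    proof (induction t)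
      case 0
      show ?case
        using meas[of 0] by (simp add: nn_integral_return space_pair_measure space_PiM_empty)
    next
      case (Suc t)
      then have t: "t < N" by simp
      interpret S: kernel_step "kr t" p \<delta> K by (rule kernel_step_kr) fact
      have "(\<integral>\<^sup>+xy. U (Suc t) (fst xy, snd xy, feedback m (Suc t) xy) \<partial>pair_kernel_prod g (Suc t)) =
          (\<integral>\<^sup>+xy. \<integral>\<^sup>+uv. U (Suc t) (fst (pair_upd t xy uv), snd (pair_upd t xy uv), feedback m (Suc t) (pair_upd t xy uv)) \<partial>g t xy \<partial>pair_kernel_prod g t)"
        by (rule nn_integral_Suc[OF t meas]) fact
      also have "\<dots> \<le> (\<integral>\<^sup>+xy. U t (fst xy, snd xy, feedback m t xy) \<partial>pair_kernel_prod g t)"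
      proof (rule nn_integral_mono)
        fix xy assume "xy \<in> space (pair_kernel_prod g t)"
        then have xy: "xy \<in> space (Rn2 t)"
          using t by (simp add: space_pair_kernel_prod)
        then have r: "restrict (fst xy) {..<t} = fst xy" "restrict (snd xy) {..<t} = snd xy"
          by (auto simp: space_pair_measure restrict_Rn)
        let ?z = "(fst xy, snd xy, feedback m t xy)"
        \<comment> \<open>The control at time \<open>t\<close> is fixed before the pair of that time
          is drawn.\<close>
        have "feedback m (Suc t) (pair_upd t xy uv) = feedback m (Suc t) xy" for uv
          unfolding pair_upd_def by (cases xy) (auto simp del: feedback.simps intro: feedback_cong)
        also have "feedback m (Suc t) xy = (feedback m t xy)(t := m t ?z)"
          using r by simp
        finally have "(\<integral>\<^sup>+uv. U (Suc t) (fst (pair_upd t xy uv), snd (pair_upd t xy uv), feedback m (Suc t) (pair_upd t xy uv)) \<partial>g t xy)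
            = (\<integral>\<^sup>+uv. U (Suc t) (upd t ?z (m t ?z) uv) \<partial>g t xy)"
          by (simp add: upd_def pair_upd_def)
        also have "\<dots> \<le> S.gain t (U (Suc t)) ?z (m t ?z)"
          unfolding S.gain_def using delta_kernels_cases[OF dk t xy] r
          by (intro SUP_upper) (simp add: kr_def)
        also have "\<dots> = U t ?z"
          by (rule m(3)[OF t])
        finally show "(\<integral>\<^sup>+uv. U (Suc t) (fst (pair_upd t xy uv), snd (pair_upd t xy uv), feedback m (Suc t) (pair_upd t xy uv)) \<partial>g t xy) \<le> U t ?z" .
      qed
      also have "\<dots> \<le> U 0 start"
        using Suc by simp
      finally show ?case .
    qed
    from this[of N] show "(\<integral>\<^sup>+xy. F (fst xy, snd xy, ?\<alpha> xy) \<partial>pair_kernel_prod g N) \<le> U 0 start"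
      by (simp add: U_N)
  qed
qed

end

text \<open>The missing future coordinates are filled with zeros, which is harmless by predictability.\<close>

definition zero_ext :: "nat \<Rightarrow> nat \<Rightarrow> path \<Rightarrow> path" where
  "zero_ext N t x = (\<lambda>i\<in>{..<N}. if i < t then x i else 0)"

definition known :: "nat \<Rightarrow> (path \<times> path \<Rightarrow> path) \<Rightarrow> nat \<Rightarrow> path \<times> path \<Rightarrow> path" where
  "known N \<alpha> t xy = restrict (\<alpha> (zero_ext N t (fst xy), zero_ext N t (snd xy))) {..<t}"

definition next_control :: "nat \<Rightarrow> (path \<times> path \<Rightarrow> path) \<Rightarrow> nat \<Rightarrow> path \<times> path \<Rightarrow> real" where
  "next_control N \<alpha> t xy = \<alpha> (zero_ext N t (fst xy), zero_ext N t (snd xy)) t"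

lemma zero_ext_space: "zero_ext N t x \<in> space (Rn N)"
  by (auto simp: zero_ext_def space_PiM)

lemma measurable_zero_ext: "zero_ext N t \<in> Rn t \<rightarrow>\<^sub>M Rn N"
  unfolding zero_ext_def
proof (rule measurable_restrict)
  fix i assume "i \<in> {..<N}"
  show "(\<lambda>x. if i < t then x i else 0) \<in> Rn t \<rightarrow>\<^sub>M (borel :: real measure)"
    by (cases "i < t") auto
qed

lemma zero_ext_self: "x \<in> space (Rn N) \<Longrightarrow> zero_ext N N x = x"
  by (auto simp: zero_ext_def space_PiM PiE_def extensional_def fun_eq_iff)

context
  fixes N K \<alpha> assumes \<alpha>: "\<alpha> \<in> controls N K"
begin

lemma control_cong:
  assumes "t < N" and "x \<in> space (Rn N)" "y \<in> space (Rn N)" "x' \<in> space (Rn N)" "y' \<in> space (Rn N)"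
    and "\<And>i. i < t \<Longrightarrow> x i = x' i" and "\<And>i. i < t \<Longrightarrow> y i = y' i"
  shows "\<alpha> (x, y) t = \<alpha> (x', y') t"
proof -
  have "\<forall>x\<in>space (Rn N). \<forall>y\<in>space (Rn N). \<forall>x'\<in>space (Rn N). \<forall>y'\<in>space (Rn N). \<forall>t<N.
      (\<forall>i<t. x i = x' i \<and> y i = y' i) \<longrightarrow> \<alpha> (x, y) t = \<alpha> (x', y') t"
    using \<alpha> unfolding controls_def mem_Collect_eq by (elim conjE)
  from this[rule_format, OF assms(2-5,1)] show ?thesis
    using assms(6,7) by simp
qed

lemma measurable_control_zero_ext:
  "(\<lambda>xy. \<alpha> (zero_ext N t (fst xy), zero_ext N t (snd xy))) \<in> Rn2 t \<rightarrow>\<^sub>M Rn N"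
proof -
  have [measurable]: "zero_ext N t \<in> Rn t \<rightarrow>\<^sub>M Rn N" "\<alpha> \<in> Rn2 N \<rightarrow>\<^sub>M Rn N"
    using \<alpha> measurable_zero_ext unfolding controls_def by blast+
  show ?thesis by measurable
qed

lemma measurable_known: "t \<le> N \<Longrightarrow> known N \<alpha> t \<in> Rn2 t \<rightarrow>\<^sub>M Rn t"
  unfolding known_def
  by (rule measurable_compose[OF measurable_control_zero_ext measurable_Rn_restrict])

lemma measurable_next_control: "t < N \<Longrightarrow> next_control N \<alpha> t \<in> borel_measurable (Rn2 t)"
  unfolding next_control_def
  by (rule measurable_compose[OF measurable_control_zero_ext measurable_component_singleton]) simp

lemma next_control_in: "t < N \<Longrightarrow> next_control N \<alpha> t xy \<in> K"
  using \<alpha> zero_ext_space unfolding next_control_def controls_def mem_Collect_eq by blast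

lemma known_Suc:
  assumes "t < N"
  shows "known N \<alpha> (Suc t) (pair_upd t xy uv) = (known N \<alpha> t xy)(t := next_control N \<alpha> t xy)"
proof
  fix i
  have "\<alpha> (zero_ext N (Suc t) (fst (pair_upd t xy uv)), zero_ext N (Suc t) (snd (pair_upd t xy uv))) i =
      \<alpha> (zero_ext N t (fst xy), zero_ext N t (snd xy)) i" if "i \<le> t"
    using that assms by (intro control_cong zero_ext_space) (auto simp: zero_ext_def pair_upd_def)
  then show "known N \<alpha> (Suc t) (pair_upd t xy uv) i = ((known N \<alpha> t xy)(t := next_control N \<alpha> t xy)) i"
    by (auto simp: known_def next_control_def)
qed

lemma known_N:
  assumes "xy \<in> space (Rn2 N)"
  shows "known N \<alpha> N xy = \<alpha> xy"
proof -
  have "\<alpha> \<in> Rn2 N \<rightarrow>\<^sub>M Rn N"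
    using \<alpha> unfolding controls_def by blast
  from measurable_space[OF this assms] show ?thesis
    using assms by (cases xy) (simp add: known_def zero_ext_self space_pair_measure restrict_Rn)
qed

end

context control_problem
begin

text \<open>Targets \<open>h t\<close> are kept strictly below \<open>U t\<close> along the given
  control, and couplings are selected whose mean of the next target is at least the current one; so
  the targets form a submartingale starting at \<open>c\<close>. The next target is a value of
  \<open>low\<close>, which recreates the strict slack. The alternative \<open>c = 0\<close> yields
  an admissible bicausal coupling even if the value is 0.\<close>

lemma near_optimal_kernels:
  assumes \<alpha>: "\<alpha> \<in> controls N K" and c: "c < U 0 start \<or> c = 0"
  obtains g where "delta_kernels p \<delta> N \<kappa> g" and "bicausal N \<kappa> g"
    and "c \<le> (\<integral>\<^sup>+xy. F (fst xy, snd xy, \<alpha> xy) \<partial>pair_kernel_prod g N)"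
proof -
  let ?A = "known N \<alpha>" and ?B = "next_control N \<alpha>"
  let ?Z = "\<lambda>t xy. (fst xy, snd xy, ?A t xy)"
  \<comment> \<open>The guard \<open>t \<le> N\<close> makes the property vacuous after the horizon,
    so that dependent choice can run over all natural numbers.\<close>
  define P where "P t h \<longleftrightarrow> (t \<le> N \<longrightarrow> h \<in> borel_measurable (Rn2 t) \<and>
      (\<forall>xy\<in>space (Rn2 t). h xy < U t (?Z t xy) \<or> h xy = 0))" for t h
  define R where "R t h h' g n \<longleftrightarrow> g \<in> Rn2 t \<rightarrow>\<^sub>M prob_algebra borel \<and>
      n \<in> Rn2 t \<rightarrow>\<^sub>M count_space UNIV \<and>
      (\<forall>xy\<in>space (Rn2 t). g xy \<in> Pi_delta_real p \<delta> (\<kappa> t (fst xy)) \<and>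
         h xy \<le> (\<integral>\<^sup>+uv. h' (pair_upd t xy uv) \<partial>g xy) \<and> (AE uv in g xy. decode (n xy) (snd uv) = fst uv))"
    for t and h h' :: "path \<times> path \<Rightarrow> ennreal" and g and n :: "path \<times> path \<Rightarrow> nat"
  have step_ex: "\<exists>h' g n. P (Suc t) h' \<and> R t h h' g n" if t: "t < N" and h: "P t h" for t h
  proof -
    interpret S: kernel_step "kr t" p \<delta> K by (rule kernel_step_kr) fact
    have [measurable]: "?A t \<in> Rn2 t \<rightarrow>\<^sub>M Rn t"
        and B_meas: "?B t \<in> Rn2 t \<rightarrow>\<^sub>M borel" and h_meas: "h \<in> borel_measurable (Rn2 t)"
      using t h by (auto intro!: measurable_known[OF \<alpha>] measurable_next_control[OF \<alpha>] simp: P_def)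
    have Z: "?Z t \<in> Rn2 t \<rightarrow>\<^sub>M borel"
      by (intro borel_measurable_Pair measurable_compose[OF _ measurable_Rn_borel]) measurable
    have W: "lsc (U (Suc t))"
      using t by (intro lsc_U) simp
    have "h xy < S.gain t (U (Suc t)) (?Z t xy) (?B t xy) \<or> h xy = 0" if "xy \<in> space (Rn2 t)" for xy
    proof -
      have "h xy < U t (?Z t xy) \<or> h xy = 0"
        using h t that by (auto simp: P_def)
      moreover have "U t (?Z t xy) \<le> S.gain t (U (Suc t)) (?Z t xy) (?B t xy)"
        unfolding U_step[OF t] S.val_def by (intro INF_lower next_control_in[OF \<alpha> t])
      ultimately show ?thesis by auto
    qed
    from S.measurable_near_maximizer[OF W Z B_meas h_meas this]
    obtain g m n where g: "g \<in> Rn2 t \<rightarrow>\<^sub>M prob_algebra borel"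
        and m: "m \<in> Rn2 t \<rightarrow>\<^sub>M count_space UNIV" and n: "n \<in> Rn2 t \<rightarrow>\<^sub>M count_space UNIV"
        and gmn: "\<And>xy. xy \<in> space (Rn2 t) \<Longrightarrow> g xy \<in> Pi_delta_real p \<delta> (kr t (fst (?Z t xy)))"
          "\<And>xy. xy \<in> space (Rn2 t) \<Longrightarrow> h xy \<le> (\<integral>\<^sup>+uv. low (m xy) (U (Suc t) (upd t (?Z t xy) (?B t xy) uv)) \<partial>g xy)"
          "\<And>xy. xy \<in> space (Rn2 t) \<Longrightarrow> AE uv in g xy. decode (n xy) (snd uv) = fst uv"
      by blast
    \<comment> \<open>The level \<open>m\<close> was chosen from the history before time
      \<open>t\<close>; restriction recovers this history from the longer paths.\<close>
    define h' where "h' xy = low (m (restrict (fst xy) {..<t}, restrict (snd xy) {..<t})) (U (Suc t) (?Z (Suc t) xy))" for xy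
    have "h' \<in> borel_measurable (Rn2 (Suc t))"
    proof -
      have [measurable]: "(\<lambda>x. restrict x {..<t}) \<in> Rn (Suc t) \<rightarrow>\<^sub>M Rn t"
        by (rule measurable_Rn_restrict) simp
      have [measurable]: "(\<lambda>xy. m (restrict (fst xy) {..<t}, restrict (snd xy) {..<t})) \<in> Rn2 (Suc t) \<rightarrow>\<^sub>M count_space UNIV"
        by (rule measurable_compose[OF _ m]) measurable
      have U_meas: "(\<lambda>xy. U (Suc t) (?Z (Suc t) xy)) \<in> borel_measurable (Rn2 (Suc t))"
        using t by (intro measurable_U_Rn measurable_known[OF \<alpha>]) auto
      show ?thesis
        unfolding h'_def[abs_def]
        by (rule measurable_compose_countable[of "\<lambda>i xy. low i (U (Suc t) (?Z (Suc t) xy))"])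
          (use U_meas in measurable)
    qed
    moreover have "h' xy < U (Suc t) (?Z (Suc t) xy) \<or> h' xy = 0" for xy
      unfolding h'_def by (rule low_less)
    ultimately have "P (Suc t) h'"
      by (auto simp: P_def)
    moreover have "R t h h' g n"
      unfolding R_def
    proof (intro conjI ballI g n)
      fix xy assume xy: "xy \<in> space (Rn2 t)"
      then have r: "restrict (fst xy) {..<t} = fst xy" "restrict (snd xy) {..<t} = snd xy"
        by (auto simp: space_pair_measure restrict_Rn)
      show "g xy \<in> Pi_delta_real p \<delta> (\<kappa> t (fst xy))"
        using gmn(1)[OF xy] r by (simp add: kr_def)
      show "AE uv in g xy. decode (n xy) (snd uv) = fst uv"
        by (rule gmn(3)[OF xy])
      have "h' (pair_upd t xy uv) = low (m xy) (U (Suc t) (upd t (?Z t xy) (?B t xy) uv))" for uv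
      proof -
        have "restrict (fst (pair_upd t xy uv)) {..<t} = restrict (fst xy) {..<t}"
            "restrict (snd (pair_upd t xy uv)) {..<t} = restrict (snd xy) {..<t}"
          by (auto simp: pair_upd_def)
        then show ?thesis
          using r by (simp add: h'_def known_Suc[OF \<alpha> t] upd_def) (simp add: pair_upd_def)
      qed
      then show "h xy \<le> (\<integral>\<^sup>+uv. h' (pair_upd t xy uv) \<partial>g xy)"
        using gmn(2)[OF xy] by simp
    qed
    ultimately show ?thesis by blast
  qed
  have P0: "P 0 (\<lambda>_. c)"
    using c by (simp add: P_def known_def space_pair_measure space_PiM_empty restrict_def)
  have ex: "\<exists>h'. P (Suc t) h' \<and> (t < N \<longrightarrow> (\<exists>g n. R t h h' g n))" if "P t h" for t h
    using step_ex[OF _ that] by (cases "t < N") (auto simp: P_def)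
  \<comment> \<open>The target at \<open>Suc t\<close> depends on the level selected at
    \<open>t\<close>, so the targets are obtained by dependent choice and the kernels
    afterwards.\<close>
  have "\<exists>h. \<forall>t. (P t (h t) \<and> (t = 0 \<longrightarrow> h t = (\<lambda>_. c))) \<and> (t < N \<longrightarrow> (\<exists>g n. R t (h t) (h (Suc t)) g n))"
    by (rule dependent_nat_choice) (use P0 ex in auto)
  then obtain h where h: "\<And>t. P t (h t)" "h 0 = (\<lambda>_. c)" "\<And>t. t < N \<Longrightarrow> \<exists>g n. R t (h t) (h (Suc t)) g n"
    by blast
  then obtain g n where gn: "\<And>t. t < N \<Longrightarrow> R t (h t) (h (Suc t)) (g t) (n t)"
    by metis
  have delta: "delta_kernels p \<delta> N \<kappa> g"
    using gn by (force simp: delta_kernels_def R_def space_pair_measure)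
  interpret decodable_kernels g N "\<lambda>t (xy, v). decode (n t xy) v"
  proof
    fix s assume s: "s < N"
    show "g s \<in> Rn2 s \<rightarrow>\<^sub>M prob_algebra borel"
      using gn[OF s] by (simp add: R_def)
    have [measurable]: "n s \<in> Rn2 s \<rightarrow>\<^sub>M count_space UNIV"
      using gn[OF s] by (simp add: R_def)
    have "(\<lambda>z. decode (n s (fst z)) (snd z)) \<in> (Rn2 s) \<Otimes>\<^sub>M borel \<rightarrow>\<^sub>M borel"
      by (rule measurable_compose_countable[of "\<lambda>i z. decode i (snd z)"]) measurable
    then show "(\<lambda>(xy, v). decode (n s xy) v) \<in> (Rn2 s) \<Otimes>\<^sub>M borel \<rightarrow>\<^sub>M borel"
      by (simp add: case_prod_beta')
    fix xy assume "xy \<in> space (Rn2 s)"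
    with gn[OF s] show "AE uv in g s xy. (case (xy, snd uv) of (xy, v) \<Rightarrow> decode (n s xy) v) = fst uv"
      by (simp add: R_def)
  qed
  have bic: "bicausal N \<kappa> g"
  proof (rule bicausal)
    fix t x y assume "t < N" "x \<in> space (Rn t)" "y \<in> space (Rn t)"
    then show "distr (g t (x, y)) borel fst = \<kappa> t x"
      using delta by (auto simp: delta_kernels_def Pi_delta_real_def)
  qed
  have lower: "t \<le> N \<Longrightarrow> c \<le> (\<integral>\<^sup>+xy. h t xy \<partial>pair_kernel_prod g t)" for t
  proof (induction t)
    case 0
    interpret P: prob_space "pair_kernel_prod g 0"
      using pair_kernel_prod_in[of 0] by (simp add: space_prob_algebra del: pair_kernel_prod.simps)
    show ?case
      by (simp add: h(2) P.emeasure_space_1 del: pair_kernel_prod.simps)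
  next
    case (Suc t)
    then have t: "t < N" by simp
    have "c \<le> (\<integral>\<^sup>+xy. h t xy \<partial>pair_kernel_prod g t)"
      using Suc by simp
    also have "\<dots> \<le> (\<integral>\<^sup>+xy. \<integral>\<^sup>+uv. h (Suc t) (pair_upd t xy uv) \<partial>g t xy \<partial>pair_kernel_prod g t)"
      using gn[OF t] t by (intro nn_integral_mono) (simp add: R_def space_pair_kernel_prod)
    also have "\<dots> = (\<integral>\<^sup>+xy. h (Suc t) xy \<partial>pair_kernel_prod g (Suc t))"
      using h(1)[of "Suc t"] t by (intro nn_integral_Suc[symmetric]) (auto simp: P_def)
    finally show ?case .
  qed
  have "c \<le> (\<integral>\<^sup>+xy. h N xy \<partial>pair_kernel_prod g N)"
    by (rule lower) simp
  also have "\<dots> \<le> (\<integral>\<^sup>+xy. F (fst xy, snd xy, \<alpha> xy) \<partial>pair_kernel_prod g N)"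
  proof (rule nn_integral_mono)
    fix xy assume "xy \<in> space (pair_kernel_prod g N)"
    then have xy: "xy \<in> space (Rn2 N)"
      by (simp add: space_pair_kernel_prod)
    then have "h N xy < U N (?Z N xy) \<or> h N xy = 0"
      using h(1)[of N] by (auto simp: P_def)
    then show "h N xy \<le> F (fst xy, snd xy, \<alpha> xy)"
      by (auto simp: U_N known_N[OF \<alpha> xy])
  qed
  finally show thesis
    using that delta bic by blast
qed

lemma Pi_bc_delta_nonempty:
  assumes "\<alpha> \<in> controls N K"
  shows "Pi_bc_delta p \<delta> N \<kappa> \<noteq> {}"
  using near_optimal_kernels[OF assms, of 0] by (auto simp: Pi_bc_delta_def)

theorem dynamic_programming:
  "(INF \<alpha>\<in>controls N K. SUP \<gamma>\<in>Pi_bc_delta p \<delta> N \<kappa>. \<integral>\<^sup>+xy. F (fst xy, snd xy, \<alpha> xy) \<partial>\<gamma>) = U 0 start"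
proof (rule antisym)
  obtain \<alpha> where \<alpha>: "\<alpha> \<in> controls N K"
      "\<And>g. delta_kernels p \<delta> N \<kappa> g \<Longrightarrow> (\<integral>\<^sup>+xy. F (fst xy, snd xy, \<alpha> xy) \<partial>pair_kernel_prod g N) \<le> U 0 start"
    using minimizing_control by blast
  show "(INF \<alpha>\<in>controls N K. SUP \<gamma>\<in>Pi_bc_delta p \<delta> N \<kappa>. \<integral>\<^sup>+xy. F (fst xy, snd xy, \<alpha> xy) \<partial>\<gamma>) \<le> U 0 start"
    by (rule INF_lower2[OF \<alpha>(1)]) (auto simp: Pi_bc_delta_def intro!: SUP_least \<alpha>(2))
  show "U 0 start \<le> (INF \<alpha>\<in>controls N K. SUP \<gamma>\<in>Pi_bc_delta p \<delta> N \<kappa>. \<integral>\<^sup>+xy. F (fst xy, snd xy, \<alpha> xy) \<partial>\<gamma>)"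
  proof (rule INF_greatest, rule dense_le)
    fix \<alpha> c assume "\<alpha> \<in> controls N K" "c < U 0 start"
    then have "\<alpha> \<in> controls N K" "c < U 0 start \<or> c = 0" by auto
    from near_optimal_kernels[OF this] obtain g where g: "delta_kernels p \<delta> N \<kappa> g" "bicausal N \<kappa> g"
        "c \<le> (\<integral>\<^sup>+xy. F (fst xy, snd xy, \<alpha> xy) \<partial>pair_kernel_prod g N)" by blast
    then have "pair_kernel_prod g N \<in> Pi_bc_delta p \<delta> N \<kappa>"
      by (auto simp: Pi_bc_delta_def)
    then show "c \<le> (SUP \<gamma>\<in>Pi_bc_delta p \<delta> N \<kappa>. \<integral>\<^sup>+xy. F (fst xy, snd xy, \<alpha> xy) \<partial>\<gamma>)"
      using g(3) by (rule SUP_upper2)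
  qed
qed

end

section \<open>Integrals of extended real functions\<close>

lemma ereal_integral_mono_AE:
  assumes "AE z in M. V z \<le> W z"
  shows "ereal_integral M V \<le> ereal_integral M W"
  unfolding ereal_integral_def
  using assms
  by (intro ereal_minus_mono) (auto simp: less_eq_ennreal.rep_eq[symmetric] intro!: nn_integral_mono_AE e2ennreal_mono elim!: eventually_mono)

text \<open>Where \<open>\<psi>\<close> is finite, the positive and negative parts of
  \<open>U - \<psi>\<close> satisfy pos + \<open>\<psi>\<close> = \<open>U\<close> + neg and neg
  \<le> \<open>\<psi>\<close>. Integrating this identity and cancelling the finite terms works even
  if the integral of \<open>U\<close> is infinite.\<close>

lemma ereal_integral_diff:
  assumes [measurable]: "U \<in> borel_measurable M" "\<psi> \<in> borel_measurable M"
    and fin: "(\<integral>\<^sup>+z. \<psi> z \<partial>M) < \<top>"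
  shows "ereal_integral M (\<lambda>z. enn2ereal (U z) - enn2ereal (\<psi> z)) + enn2ereal (\<integral>\<^sup>+z. \<psi> z \<partial>M) = enn2ereal (\<integral>\<^sup>+z. U z \<partial>M)"
proof -
  let ?pos = "\<lambda>z. e2ennreal (enn2ereal (U z) - enn2ereal (\<psi> z))"
  let ?neg = "\<lambda>z. e2ennreal (- (enn2ereal (U z) - enn2ereal (\<psi> z)))"
  have psi: "AE z in M. \<psi> z \<noteq> \<top>"
    using nn_integral_PInf_AE[of \<psi> M] fin by simp
  have ptw: "?pos z + \<psi> z = U z + ?neg z \<and> ?neg z \<le> \<psi> z" if nt: "\<psi> z \<noteq> \<top>" for z
  proof -
    obtain s where s: "\<psi> z = ennreal s" "0 \<le> s"
      using nt by (cases "\<psi> z") auto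
    show ?thesis
    proof (cases "U z")
      case (real r)
      show ?thesis
      proof (cases "s \<le> r")
        case True
        then have "ennreal (s - r) = 0"
          by (intro ennreal_neg) simp
        with True show ?thesis
          using real s by (simp flip: ennreal_plus)
      next
        case False
        then show ?thesis
          using real s by (simp add: e2ennreal_neg ennreal_neg flip: ennreal_plus)
      qed
    next
      case top
      then show ?thesis
        using s by (simp add: e2ennreal_neg)
    qed
  qed
  have [measurable]: "?pos \<in> borel_measurable M" "?neg \<in> borel_measurable M"
    by measurable
  have neg: "(\<integral>\<^sup>+z. ?neg z \<partial>M) \<le> (\<integral>\<^sup>+z. \<psi> z \<partial>M)"
    using psi ptw by (intro nn_integral_mono_AE) (auto elim!: eventually_mono)
  have "(\<integral>\<^sup>+z. ?pos z \<partial>M) + (\<integral>\<^sup>+z. \<psi> z \<partial>M) = (\<integral>\<^sup>+z. ?pos z + \<psi> z \<partial>M)"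
    by (rule nn_integral_add[symmetric]) measurable
  also have "\<dots> = (\<integral>\<^sup>+z. U z + ?neg z \<partial>M)"
    using psi ptw by (intro nn_integral_cong_AE) (auto elim!: eventually_mono)
  also have "\<dots> = (\<integral>\<^sup>+z. U z \<partial>M) + (\<integral>\<^sup>+z. ?neg z \<partial>M)"
    by (rule nn_integral_add) measurable
  finally have eq: "(\<integral>\<^sup>+z. ?pos z \<partial>M) + (\<integral>\<^sup>+z. \<psi> z \<partial>M) = (\<integral>\<^sup>+z. U z \<partial>M) + (\<integral>\<^sup>+z. ?neg z \<partial>M)" .
  obtain s where s: "(\<integral>\<^sup>+z. \<psi> z \<partial>M) = ennreal s" "0 \<le> s"
    using fin by (cases "\<integral>\<^sup>+z. \<psi> z \<partial>M") auto
  obtain n where n: "(\<integral>\<^sup>+z. ?neg z \<partial>M) = ennreal n" "0 \<le> n"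
    using neg fin by (cases "\<integral>\<^sup>+z. ?neg z \<partial>M") (auto simp: top_unique)
  show ?thesis
    unfolding ereal_integral_def n s
    using arg_cong[OF eq[unfolded n s], of enn2ereal] n(2) s(2)
    by (cases "enn2ereal (\<integral>\<^sup>+z. ?pos z \<partial>M)"; cases "enn2ereal (\<integral>\<^sup>+z. U z \<partial>M)")
      (auto simp: plus_ennreal.rep_eq)
qed

text \<open>\<open>V\<close> is compared with \<open>U - \<psi>\<close> by monotonicity of the
  integral alone, which suits \<open>dpp_value\<close>, whose measurability is not established. The
  guard admits a \<open>\<psi>\<close> that is infinite on a null set.\<close>

lemma ereal_integral_add_le:
  assumes "U \<in> borel_measurable M" "\<psi> \<in> borel_measurable M" and fin: "(\<integral>\<^sup>+z. \<psi> z \<partial>M) < \<top>"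
    and le: "AE z in M. \<psi> z \<noteq> \<top> \<longrightarrow> V z + enn2ereal (\<psi> z) \<le> enn2ereal (U z)"
  shows "ereal_integral M V + enn2ereal (\<integral>\<^sup>+z. \<psi> z \<partial>M) \<le> enn2ereal (\<integral>\<^sup>+z. U z \<partial>M)"
proof -
  have "AE z in M. \<psi> z \<noteq> \<top>"
    using nn_integral_PInf_AE[of \<psi> M] assms(2) fin by simp
  with le have "AE z in M. V z \<le> enn2ereal (U z) - enn2ereal (\<psi> z)"
  proof eventually_elim
    case (elim z)
    then show ?case
      by (cases "\<psi> z") (auto simp: ereal_le_minus)
  qed
  then show ?thesis
    unfolding ereal_integral_diff[OF assms(1-3), symmetric]
    by (intro add_right_mono ereal_integral_mono_AE)
qed

lemma ereal_integral_add_ge: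
  assumes "U \<in> borel_measurable M" "\<psi> \<in> borel_measurable M" and fin: "(\<integral>\<^sup>+z. \<psi> z \<partial>M) < \<top>"
    and le: "AE z in M. \<psi> z \<noteq> \<top> \<longrightarrow> enn2ereal (U z) \<le> V z + enn2ereal (\<psi> z)"
  shows "enn2ereal (\<integral>\<^sup>+z. U z \<partial>M) \<le> ereal_integral M V + enn2ereal (\<integral>\<^sup>+z. \<psi> z \<partial>M)"
proof -
  have "AE z in M. \<psi> z \<noteq> \<top>"
    using nn_integral_PInf_AE[of \<psi> M] assms(2) fin by simp
  with le have "AE z in M. enn2ereal (U z) - enn2ereal (\<psi> z) \<le> V z"
  proof eventually_elim
    case (elim z)
    then show ?case
      by (cases "\<psi> z") (auto simp: ereal_minus_le)
  qed
  then show ?thesis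
    unfolding ereal_integral_diff[OF assms(1-3), symmetric]
    by (intro add_right_mono ereal_integral_mono_AE)
qed

lemma INF_SUP_add_le:
  fixes I J :: "'b \<Rightarrow> 'c \<Rightarrow> ereal"
  assumes "\<And>b \<gamma>. b \<in> B \<Longrightarrow> \<gamma> \<in> G \<Longrightarrow> I b \<gamma> + ereal r \<le> J b \<gamma>"
  shows "(INF b\<in>B. SUP \<gamma>\<in>G. I b \<gamma>) + ereal r \<le> (INF b\<in>B. SUP \<gamma>\<in>G. J b \<gamma>)"
proof (rule INF_greatest)
  fix b assume b: "b \<in> B"
  have "(INF b\<in>B. SUP \<gamma>\<in>G. I b \<gamma>) \<le> (SUP \<gamma>\<in>G. I b \<gamma>)"
    using b by (rule INF_lower)
  also have "\<dots> \<le> (SUP \<gamma>\<in>G. J b \<gamma>) - ereal r"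
  proof (rule SUP_least)
    fix \<gamma> assume \<gamma>: "\<gamma> \<in> G"
    then have "I b \<gamma> + ereal r \<le> (SUP \<gamma>\<in>G. J b \<gamma>)"
      using assms[OF b \<gamma>] by (rule SUP_upper2)
    then show "I b \<gamma> \<le> (SUP \<gamma>\<in>G. J b \<gamma>) - ereal r"
      by (simp add: ereal_le_minus)
  qed
  finally show "(INF b\<in>B. SUP \<gamma>\<in>G. I b \<gamma>) + ereal r \<le> (SUP \<gamma>\<in>G. J b \<gamma>)"
    by (simp add: ereal_le_minus)
qed

text \<open>The assumption on \<open>G\<close> is about the empty supremum, which is 0 in
  \<open>ennreal\<close> but minus infinity in \<open>ereal\<close>.\<close>

lemma enn2ereal_INF_SUP:
  assumes "G \<noteq> {}"
  shows "enn2ereal (INF b\<in>B. SUP \<gamma>\<in>G. j b \<gamma>) = (INF b\<in>B. SUP \<gamma>\<in>G. enn2ereal (j b \<gamma>))"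
proof -
  have "enn2ereal (SUP \<gamma>\<in>G. j b \<gamma>) = (SUP \<gamma>\<in>G. enn2ereal (j b \<gamma>))" for b
  proof -
    obtain \<gamma> where "\<gamma> \<in> G" using assms by blast
    then have "0 \<le> (SUP \<gamma>\<in>G. enn2ereal (j b \<gamma>))"
      by (rule SUP_upper2) simp
    then show ?thesis
      by (simp add: Sup_ennreal.rep_eq image_image max_absorb2)
  qed
  then show ?thesis
    by (simp add: Inf_ennreal.rep_eq image_image)
qed

section \<open>Wasserstein continuity implies weak continuity\<close>

text \<open>By Markov's inequality the coordinates differ by \<open>h\<close> or more with
  probability at most \<open>d\<close>; off that event, one coordinate below \<open>c\<close> keeps
  the other below \<open>c + h\<close>.\<close>

lemma cdf_le_cdf_coupling:
  assumes \<pi>: "prob_space \<pi>" "sets \<pi> = sets (borel :: (real \<times> real) measure)" and h: "0 < h" and d: "0 \<le> d"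
    and cost: "(\<integral>\<^sup>+z. ennreal (\<bar>fst z - snd z\<bar> powr p) \<partial>\<pi>) \<le> ennreal (d * h powr p)" and p: "0 < p"
  shows "measure \<pi> {z. fst z \<le> c} \<le> measure \<pi> {z. snd z \<le> c + h} + d"
    and "measure \<pi> {z. snd z \<le> c} \<le> measure \<pi> {z. fst z \<le> c + h} + d"
proof -
  interpret prob_space \<pi> by fact
  note [measurable_cong] = \<pi>(2)
  have sp: "space \<pi> = UNIV"
    using sets_eq_imp_space_eq[OF \<pi>(2)] by simp
  let ?B = "{z. h \<le> \<bar>fst z - snd z\<bar>}"
  have S [measurable]: "{z \<in> space \<pi>. h \<le> \<bar>fst z - snd z\<bar>} \<in> sets \<pi>" "{z \<in> space \<pi>. fst z \<le> c} \<in> sets \<pi>" "{z \<in> space \<pi>. snd z \<le> c} \<in> sets \<pi>" for c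
    by measurable
  have "ennreal (h powr p) * emeasure \<pi> ?B = (\<integral>\<^sup>+z. ennreal (h powr p) * indicator ?B z \<partial>\<pi>)"
    using S(1) by (simp add: nn_integral_cmult_indicator sp)
  also have "\<dots> \<le> (\<integral>\<^sup>+z. ennreal (\<bar>fst z - snd z\<bar> powr p) \<partial>\<pi>)"
    using h p by (intro nn_integral_mono) (auto simp: indicator_def intro!: ennreal_leI powr_mono2)
  also have "\<dots> \<le> ennreal (d * h powr p)"
    by (rule cost)
  finally have "ennreal (h powr p * measure \<pi> ?B) \<le> ennreal (d * h powr p)"
    by (simp add: emeasure_eq_measure ennreal_mult)
  then have B: "measure \<pi> ?B \<le> d"
    using h d by (simp add: ennreal_le_iff mult.commute)
  have "measure \<pi> {z. fst z \<le> c} \<le> measure \<pi> ({z. snd z \<le> c + h} \<union> ?B)"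
    using S by (intro finite_measure_mono) (auto simp: sp)
  also have "\<dots> \<le> measure \<pi> {z. snd z \<le> c + h} + measure \<pi> ?B"
    using S by (intro measure_Un_le) (auto simp: sp)
  finally show "measure \<pi> {z. fst z \<le> c} \<le> measure \<pi> {z. snd z \<le> c + h} + d"
    using B by simp
  have "measure \<pi> {z. snd z \<le> c} \<le> measure \<pi> ({z. fst z \<le> c + h} \<union> ?B)"
    using S by (intro finite_measure_mono) (auto simp: sp)
  also have "\<dots> \<le> measure \<pi> {z. fst z \<le> c + h} + measure \<pi> ?B"
    using S by (intro measure_Un_le) (auto simp: sp)
  finally show "measure \<pi> {z. snd z \<le> c} \<le> measure \<pi> {z. fst z \<le> c + h} + d"
    using B by simp
qed

text \<open>The threshold \<open>(d * h powr p) powr (1 / p)\<close> is the transport cost at which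
  Markov's inequality yields the probability \<open>d\<close>.\<close>

lemma cdf_le_cdf_wasserstein:
  assumes \<eta>: "real_distribution \<eta>" and \<nu>: "real_distribution \<nu>" and h: "0 < h" and d: "0 < d" and p: "0 < p"
    and W: "wasserstein p \<eta> \<nu> < ennreal ((d * h powr p) powr (1 / p))"
  shows "cdf \<eta> c \<le> cdf \<nu> (c + h) + d" and "cdf \<nu> c \<le> cdf \<eta> (c + h) + d"
proof -
  interpret \<eta>: real_distribution \<eta> by fact
  interpret \<nu>: real_distribution \<nu> by fact
  obtain \<pi> where \<pi>: "\<pi> \<in> couplings \<eta> \<nu>" and cost: "pcost p \<pi> < ennreal ((d * h powr p) powr (1 / p))"
    using W unfolding wasserstein_def by (auto simp: INF_less_iff)
  have dh: "0 < d * h powr p" using h d by simp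
  have "((d * h powr p) powr (1 / p)) powr p = d * h powr p"
    using dh p by (simp add: powr_powr)
  then have c: "(\<integral>\<^sup>+z. ennreal (\<bar>fst z - snd z\<bar> powr p) \<partial>\<pi>) \<le> ennreal (d * h powr p)"
    using cost dh h d pcost_less_iff[OF p, of "(d * h powr p) powr (1 / p)" \<pi>]
    by (simp add: case_prod_beta' less_imp_le)
  have s: "sets \<pi> = sets (borel \<Otimes>\<^sub>M borel)" and P: "prob_space \<pi>"
      and fst: "distr \<pi> \<eta> fst = \<eta>" and snd: "distr \<pi> \<nu> snd = \<nu>"
    using \<pi> sets_pair_measure_cong[OF \<eta>.events_eq_borel \<nu>.events_eq_borel]
    by (simp_all add: couplings_def space_prob_algebra)
  have s': "sets \<pi> = sets borel"
    using s unfolding borel_prod .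
  note [measurable_cong] = s' \<eta>.events_eq_borel \<nu>.events_eq_borel
  have sp: "space \<pi> = UNIV"
    using sets_eq_imp_space_eq[OF s'] by simp
  have f: "cdf \<eta> c = measure \<pi> {z. fst z \<le> c}" for c
    using arg_cong[OF trans[OF distr_cong[OF refl \<eta>.events_eq_borel[symmetric] refl] fst], of "\<lambda>D. measure D {..c}"]
    by (simp add: cdf_def measure_distr vimage_def sp)
  have g: "cdf \<nu> c = measure \<pi> {z. snd z \<le> c}" for c
    using arg_cong[OF trans[OF distr_cong[OF refl \<nu>.events_eq_borel[symmetric] refl] snd], of "\<lambda>D. measure D {..c}"]
    by (simp add: cdf_def measure_distr vimage_def sp)
  show "cdf \<eta> c \<le> cdf \<nu> (c + h) + d" "cdf \<nu> c \<le> cdf \<eta> (c + h) + d"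
    unfolding f g using cdf_le_cdf_coupling[OF P s' h _ c p] d by auto
qed

text \<open>At a continuity point \<open>c\<close> of the limit, the approximating distribution
  functions are squeezed between the limit at \<open>c - h\<close> and at \<open>c + h\<close>, up
  to \<open>r / 2\<close>; continuity bounds the remaining difference by
  \<open>r / 2\<close>.\<close>

lemma successively_continuous_weak:
  assumes sc: "successively_continuous p N \<kappa>" and p: "0 < p" and t: "t < N" and X: "X \<longlonglongrightarrow> x"
  shows "weak_conv_m (\<lambda>n. \<kappa> t (restrict (X n) {..<t})) (\<kappa> t (restrict x {..<t}))"
proof -
  let ?x = "restrict x {..<t}" and ?X = "\<lambda>n. restrict (X n) {..<t}"
  have sp: "restrict y {..<t} \<in> space (Rn t)" for y :: path
    by (auto simp: space_PiM)
  have rd: "real_distribution (\<kappa> t (restrict y {..<t}))" for y :: path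
    using sc t sp[of y] by (auto simp: successively_continuous_def Pp_real_def space_prob_algebra
        real_distribution_def real_distribution_axioms_def)
  have tend: "((\<lambda>x'. wasserstein p (\<kappa> t x') (\<kappa> t ?x)) \<longlongrightarrow> 0) (atin (Rn_top t) ?x)"
    using sc t sp[of x] by (auto simp: successively_continuous_def)
  have lim: "limitin (Rn_top t) ?X ?x sequentially"
    using X by (auto simp: limitin_componentwise tendsto_fun_iff)
  \<comment> \<open>The filter \<open>atin\<close> omits the point itself, but the sequence may hit
    it, hence the disjunction.\<close>
  have ev: "\<forall>\<^sub>F n in sequentially. ?X n = ?x \<or> wasserstein p (\<kappa> t (?X n)) (\<kappa> t ?x) < ennreal e" if "0 < e" for e
  proof -
    have "\<forall>\<^sub>F x' in atin (Rn_top t) ?x. wasserstein p (\<kappa> t x') (\<kappa> t ?x) < ennreal e"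
      using that by (intro order_tendstoD(2)[OF tend]) simp
    moreover have "?x \<in> topspace (Rn_top t)"
      by auto
    ultimately obtain Q where Q: "openin (Rn_top t) Q" "?x \<in> Q"
        "\<And>x'. x' \<in> Q - {?x} \<Longrightarrow> wasserstein p (\<kappa> t x') (\<kappa> t ?x) < ennreal e"
      unfolding eventually_atin by blast
    have "\<forall>\<^sub>F n in sequentially. ?X n \<in> Q"
      using lim Q(1,2) by (auto simp: limitin_def)
    then show ?thesis
      by eventually_elim (use Q(3) in blast)
  qed
  show ?thesis
    unfolding weak_conv_m_def weak_conv_def
  proof (intro allI impI)
    fix c assume c: "isCont (cdf (\<kappa> t ?x)) c"
    show "(\<lambda>n. cdf (\<kappa> t (?X n)) c) \<longlonglongrightarrow> cdf (\<kappa> t ?x) c"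
    proof (rule LIMSEQ_I)
      fix r :: real assume r: "0 < r"
      obtain s where s: "0 < s" "\<And>y. \<bar>y - c\<bar> < s \<Longrightarrow> \<bar>cdf (\<kappa> t ?x) y - cdf (\<kappa> t ?x) c\<bar> < r / 2"
        using c r unfolding continuous_at_eps_delta by (metis dist_real_def half_gt_zero)
      define h where "h = s / 2"
      have h: "0 < h" "\<bar>(c + h) - c\<bar> < s" "\<bar>(c - h) - c\<bar> < s"
        using s(1) by (auto simp: h_def)
      have "0 < ((r / 2) * h powr p) powr (1 / p)"
        using h r by simp
      from ev[OF this] have "\<forall>\<^sub>F n in sequentially. norm (cdf (\<kappa> t (?X n)) c - cdf (\<kappa> t ?x) c) < r"
      proof eventually_elim
        case (elim n)
        then show ?case
        proof
          assume "?X n = ?x"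
          then show ?thesis using r by simp
        next
          assume W: "wasserstein p (\<kappa> t (?X n)) (\<kappa> t ?x) < ennreal (((r / 2) * h powr p) powr (1 / p))"
          have "cdf (\<kappa> t (?X n)) c \<le> cdf (\<kappa> t ?x) (c + h) + r / 2"
            by (rule cdf_le_cdf_wasserstein(1)[OF rd rd h(1) _ p W]) (use r in simp)
          moreover have "cdf (\<kappa> t ?x) (c - h) \<le> cdf (\<kappa> t (?X n)) ((c - h) + h) + r / 2"
            by (rule cdf_le_cdf_wasserstein(2)[OF rd rd h(1) _ p W]) (use r in simp)
          ultimately show ?thesis
            using s(2)[OF h(2)] s(2)[OF h(3)] unfolding real_norm_def abs_less_iff by simp
        qed
      qed
      then show "\<exists>no. \<forall>n\<ge>no. norm (cdf (\<kappa> t (?X n)) c - cdf (\<kappa> t ?x) c) < r"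
        by (simp add: eventually_sequentially)
    qed
  qed
qed

section \<open>Sums of p-th powers of coordinates\<close>

definition psum :: "real \<Rightarrow> nat \<Rightarrow> (nat \<Rightarrow> real) \<Rightarrow> real" where
  "psum p k x = (\<Sum>i<k. \<bar>x i\<bar> powr p)"

lemma psum_nonneg: "0 \<le> psum p k x"
  by (auto simp: psum_def intro: sum_nonneg)

lemma pnorm_powr: "0 < p \<Longrightarrow> pnorm p k x powr p = psum p k x"
  using psum_nonneg[of p k x] by (simp add: pnorm_def psum_def powr_powr)

lemma psum_le_diff:
  assumes p: "0 < p"
  shows "psum p k y \<le> 2 powr p * (psum p k x + psum p k (\<lambda>i. y i - x i))"
proof -
  have "\<bar>y i\<bar> powr p \<le> 2 powr p * (\<bar>x i\<bar> powr p + \<bar>y i - x i\<bar> powr p)" for i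
  proof -
    have "\<bar>y i\<bar> \<le> 2 * max \<bar>x i\<bar> \<bar>y i - x i\<bar>"
      using abs_triangle_ineq[of "x i" "y i - x i"] by (auto simp: max_def)
    then have "\<bar>y i\<bar> powr p \<le> (2 * max \<bar>x i\<bar> \<bar>y i - x i\<bar>) powr p"
      using p by (intro powr_mono2) auto
    also have "\<dots> = 2 powr p * max \<bar>x i\<bar> \<bar>y i - x i\<bar> powr p"
      by (simp add: powr_mult)
    also have "\<dots> \<le> 2 powr p * (\<bar>x i\<bar> powr p + \<bar>y i - x i\<bar> powr p)"
      by (intro mult_left_mono) (auto simp: max_def)
    finally show ?thesis .
  qed
  then show ?thesis
    unfolding psum_def by (simp add: sum_distrib_left flip: sum.distrib) (intro sum_mono, simp)
qed

lemma continuous_on_psum: "0 < p \<Longrightarrow> continuous_on UNIV (psum p k)"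
  unfolding psum_def
  by (intro continuous_on_sum continuous_on_powr' continuous_intros) auto

section \<open>Reduction to nonnegative costs\<close>

text \<open>Restriction is continuous from total paths to \<open>Rn_top N\<close>, which transfers
  semicontinuity from the explicit product topology to the type class topology.\<close>

lemma open_lower_semicont:
  assumes f: "lower_semicont N f"
  shows "open {z :: state. c < f (restrict (fst (snd z)) {..<N}) (restrict (snd (snd z)) {..<N})}"
proof -
  let ?h = "\<lambda>z :: state. (restrict (fst (snd z)) {..<N}, restrict (snd (snd z)) {..<N})"
  have r: "continuous_map euclidean (Rn_top N) (\<lambda>z :: state. restrict (g z) {..<N})"
    if "continuous_on UNIV g" for g :: "state \<Rightarrow> path"
    using that by (auto simp: continuous_map_componentwise intro: continuous_on_product_then_coordinatewise)
  have h: "continuous_map euclidean (prod_topology (Rn_top N) (Rn_top N)) ?h"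
    by (intro continuous_map_pairedI r continuous_intros)
  have "openin (prod_topology (Rn_top N) (Rn_top N)) {(x, a). x \<in> space (Rn N) \<and> a \<in> space (Rn N) \<and> c < f x a}"
    using f by (auto simp: lower_semicont_def)
  from openin_continuous_map_preimage[OF h this]
  show ?thesis
    by (simp add: space_PiM)
qed

definition penalized :: "real \<Rightarrow> nat \<Rightarrow> (path \<Rightarrow> path \<Rightarrow> real) \<Rightarrow> real \<Rightarrow> real \<Rightarrow> state \<Rightarrow> real" where
  "penalized p N f A \<theta> = (\<lambda>(x, y, a). f (restrict y {..<N}) (restrict a {..<N}) +
     (A + \<theta> * psum p N x + \<theta> * psum p N (\<lambda>i. y i - x i)))"

text \<open>A lower semicontinuous function plus a continuous one. \<open>ennreal\<close> truncates
  at 0, which preserves semicontinuity; once the penalized cost is nonnegative for controls in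
  \<open>K\<close>, the truncation acts on other controls only.\<close>

lemma lsc_penalized:
  assumes f: "lower_semicont N f" and p: "0 < p"
  shows "lsc (\<lambda>z. ennreal (penalized p N f A \<theta> z))"
proof -
  let ?f = "\<lambda>z :: state. f (restrict (fst (snd z)) {..<N}) (restrict (snd (snd z)) {..<N})"
  let ?g = "\<lambda>z :: state. A + \<theta> * psum p N (fst z) + \<theta> * psum p N (\<lambda>i. fst (snd z) i - fst z i)"
  have c: "continuous_on UNIV (\<lambda>z :: state. fst (snd z) i - fst z i)" for i
    by (rule continuous_on_diff[OF
        continuous_on_product_then_coordinatewise[OF continuous_on_fst[OF continuous_on_snd[OF continuous_on_id]]]
        continuous_on_product_then_coordinatewise[OF continuous_on_fst[OF continuous_on_id]]])
  have c': "continuous_on UNIV (\<lambda>(z :: state) i. fst (snd z) i - fst z i)"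
    by (rule continuous_on_coordinatewise_then_product) (rule c)
  have g: "continuous_on UNIV ?g"
  proof (intro continuous_intros)
    show "continuous_on UNIV (\<lambda>z :: state. psum p N (fst z))"
      by (rule continuous_on_compose2[OF continuous_on_psum[OF p] continuous_on_fst[OF continuous_on_id]]) simp
    show "continuous_on UNIV (\<lambda>z :: state. psum p N (\<lambda>i. fst (snd z) i - fst z i))"
      by (rule continuous_on_compose2[OF continuous_on_psum[OF p] c']) simp
  qed
  have "open {z. r < ?f z + ?g z}" for r
  proof -
    \<comment> \<open>The sum exceeds \<open>r\<close> when some \<open>q\<close> separates
      \<open>?f z\<close> from \<open>r - ?g z\<close>.\<close>
    have eq: "{z. r < ?f z + ?g z} = (\<Union>q. {z. q < ?f z} \<inter> {z. r - q < ?g z})"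
    proof safe
      fix x y a :: path assume "r < ?f (x, y, a) + ?g (x, y, a)"
      then obtain q where "r - ?g (x, y, a) < q" "q < ?f (x, y, a)"
        using dense[of "r - ?g (x, y, a)" "?f (x, y, a)"] by auto
      then show "(x, y, a) \<in> (\<Union>q. {z. q < ?f z} \<inter> {z. r - q < ?g z})"
        by (intro UN_I[of q]) auto
    qed auto
    have o: "open ({z. q < ?f z} \<inter> {z. r - q < ?g z})" for q
      using g by (intro open_Int open_lower_semicont[OF f] open_Collect_less continuous_on_const)
    show ?thesis
      unfolding eq by (intro open_UN ballI o)
  qed
  then have o: "open {z. r < penalized p N f A \<theta> z}" for r
    by (simp add: penalized_def case_prod_beta')
  show ?thesis
    unfolding lsc_def
  proof
    fix c
    show "open {z. c < ennreal (penalized p N f A \<theta> z)}"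
    proof (cases c)
      case (real r)
      then have "{z. c < ennreal (penalized p N f A \<theta> z)} = {z. r < penalized p N f A \<theta> z}"
        by (auto simp: ennreal_less_iff)
      with o show ?thesis by simp
    qed simp
  qed
qed

text \<open>Below \<open>M\<close> the lower power is bounded by a constant; above \<open>M\<close>
  it is \<open>s powr p\<close> times a factor of at most \<open>M powr (r - p)\<close>, which is
  small for large \<open>M\<close>.\<close>

lemma powr_le_add:
  fixes s r p M :: real
  assumes r: "0 \<le> s" "0 < r" "r < p" and M: "0 < M"
  shows "s powr r \<le> M powr r + M powr (r - p) * s powr p"
proof (cases "s \<le> M")
  case True
  then have "s powr r \<le> M powr r"
    using r by (intro powr_mono2) auto
  then show ?thesis by (simp add: add_increasing2)
next
  case False
  then have "s powr (r - p) \<le> M powr (r - p)"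
    using r M by (intro powr_mono2') auto
  moreover have "s powr r = s powr (r - p) * s powr p"
    by (simp flip: powr_add)
  ultimately show ?thesis
    by (simp add: add_increasing mult_right_mono)
qed

text \<open>On the unit cube the cost is bounded below by compactness; outside of it a negative power
  of the norm is at most one.\<close>

lemma lower_semicont_bounded_below:
  assumes f: "lower_semicont N f" and K: "compact K" and p: "0 < p" and r: "r \<le> 0"
    and C: "\<And>x a. x \<in> space (Rn N) \<Longrightarrow> a \<in> space (Rn N) \<Longrightarrow> \<bar>f x a\<bar> \<le> C * (1 + pnorm p N x powr r)"
  obtains c where "\<And>x a. x \<in> space (Rn N) \<Longrightarrow> a \<in> {..<N} \<rightarrow>\<^sub>E K \<Longrightarrow> c \<le> f x a"
proof -
  let ?D = "(PiE {..<N} (\<lambda>_. {-1..1::real})) \<times> (PiE {..<N} (\<lambda>_. K))"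
  let ?O = "\<lambda>n::nat. {(x, a). x \<in> space (Rn N) \<and> a \<in> space (Rn N) \<and> - real n < f x a}"
  have D: "compactin (prod_topology (Rn_top N) (Rn_top N)) ?D"
    using K by (auto simp: compactin_Times compactin_PiE)
  have O: "\<And>U. U \<in> range ?O \<Longrightarrow> openin (prod_topology (Rn_top N) (Rn_top N)) U"
    using f by (auto simp: lower_semicont_def)
  have "?D \<subseteq> \<Union>(range ?O)"
  proof safe
    fix x a assume xa: "x \<in> PiE {..<N} (\<lambda>_. {-1..1::real})" "a \<in> PiE {..<N} (\<lambda>_. K)"
    obtain n :: nat where "- f x a < real n"
      using reals_Archimedean2 by blast
    then have "- real n < f x a" by linarith
    with xa show "(x, a) \<in> \<Union>(range ?O)"
      by (auto simp: space_PiM PiE_def)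
  qed
  from compactinD[OF D O this]
  obtain \<F> where F: "finite \<F>" "\<F> \<subseteq> range ?O" "?D \<subseteq> \<Union>\<F>"
    by blast
  from finite_subset_image[OF F(1,2)] obtain I where I: "finite I" "\<F> = ?O ` I"
    by blast
  define m where "m = (\<Sum>n\<in>I. real n)"
  have m: "- m \<le> f x a" if "x \<in> PiE {..<N} (\<lambda>_. {-1..1})" "a \<in> PiE {..<N} (\<lambda>_. K)" for x a
  proof -
    have "(x, a) \<in> \<Union>\<F>" using F(3) that by blast
    then obtain n where n: "n \<in> I" "- real n < f x a"
      unfolding I(2) by auto
    then have "real n \<le> m"
      unfolding m_def using I(1) by (intro member_le_sum) auto
    with n show ?thesis by linarith
  qed
  show thesis
  proof
    fix x a assume x: "x \<in> space (Rn N)" and a: "a \<in> {..<N} \<rightarrow>\<^sub>E K"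
    then have a': "a \<in> space (Rn N)" by (auto simp: space_PiM)
    show "min (- m) (- (2 * \<bar>C\<bar>)) \<le> f x a"
    proof (cases "x \<in> PiE {..<N} (\<lambda>_. {-1..1})")
      case True
      from m[OF True a] show ?thesis by simp
    next
      case False
      with x obtain i where "i < N" "\<not> (- 1 \<le> x i \<and> x i \<le> 1)"
        by (auto simp: space_PiM PiE_iff)
      then have i: "i < N" "1 < \<bar>x i\<bar>"
        by auto
      have "1 \<le> \<bar>x i\<bar> powr p"
        using i p by (intro ge_one_powr_ge_zero) auto
      also have "\<dots> \<le> psum p N x"
        unfolding psum_def using i by (intro member_le_sum) auto
      finally have "1 \<le> pnorm p N x"
        unfolding pnorm_def psum_def using p by (intro ge_one_powr_ge_zero) auto
      then have "pnorm p N x powr r \<le> 1 powr r"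
        using r by (intro powr_mono2') auto
      then have "\<bar>f x a\<bar> \<le> \<bar>C\<bar> * 2"
        using C[OF x a'] by (intro order_trans[OF C[OF x a']] mult_mono) auto
      then show ?thesis by linarith
    qed
  qed
qed

definition growth :: "real \<Rightarrow> nat \<Rightarrow> (path \<Rightarrow> path \<Rightarrow> real) \<Rightarrow> bool" where
  "growth p N f \<longleftrightarrow> (\<exists>\<epsilon>>0. \<exists>C. \<forall>x\<in>space (Rn N). \<forall>a\<in>space (Rn N).
     \<bar>f x a\<bar> \<le> C * (1 + pnorm p N x powr (p - \<epsilon>)))"

definition bounded_below :: "nat \<Rightarrow> (path \<Rightarrow> path \<Rightarrow> real) \<Rightarrow> bool" where
  "bounded_below N f \<longleftrightarrow> (\<exists>c. \<forall>x\<in>space (Rn N). \<forall>a\<in>space (Rn N). c \<le> f x a)"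

text \<open>Growth of order \<open>p - \<epsilon>\<close> is dominated by a constant plus a small
  multiple of the p-th power, and \<open>psum_le_diff\<close> distributes the p-th power of
  \<open>y\<close> over \<open>x\<close> and \<open>y - x\<close>. A cost with a lower bound takes
  \<open>\<theta> = 0\<close>.\<close>

lemma penalty_exists:
  assumes f: "lower_semicont N f" and K: "compact K" and p: "0 < p" and \<tau>: "0 < \<tau>"
    and fb: "bounded_below N f \<or> growth p N f \<and> kernel_prod \<kappa> N \<in> Pp p N"
  obtains A \<theta> where "0 \<le> A" and "0 \<le> \<theta>" and "\<theta> \<le> \<tau>"
    and "\<theta> = 0 \<or> kernel_prod \<kappa> N \<in> Pp p N"
    and "\<And>x y a. y \<in> space (Rn N) \<Longrightarrow> a \<in> {..<N} \<rightarrow>\<^sub>E K \<Longrightarrow>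
      0 \<le> f y a + (A + \<theta> * psum p N x + \<theta> * psum p N (\<lambda>i. y i - x i))"
proof -
  note found = that
  have bb: thesis if c: "\<And>x a. x \<in> space (Rn N) \<Longrightarrow> a \<in> {..<N} \<rightarrow>\<^sub>E K \<Longrightarrow> c \<le> f x a" for c
  proof (rule found[of "max 0 (- c)" 0])
    fix x y :: path and a assume "y \<in> space (Rn N)" "a \<in> {..<N} \<rightarrow>\<^sub>E K"
    from c[OF this] show "0 \<le> f y a + (max 0 (- c) + 0 * psum p N x + 0 * psum p N (\<lambda>i. y i - x i))"
      by simp
  qed (use \<tau> in auto)
  have aK: "a \<in> space (Rn N)" if "a \<in> {..<N} \<rightarrow>\<^sub>E K" for a
    using that by (auto simp: space_PiM)
  show thesis
  proof (cases "bounded_below N f")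
    case True
    then obtain c where "\<And>x a. x \<in> space (Rn N) \<Longrightarrow> a \<in> space (Rn N) \<Longrightarrow> c \<le> f x a"
      by (auto simp: bounded_below_def)
    with bb aK show thesis by blast
  next
    case False
    with fb obtain \<epsilon> C where \<epsilon>: "0 < \<epsilon>"
        and C: "\<And>x a. x \<in> space (Rn N) \<Longrightarrow> a \<in> space (Rn N) \<Longrightarrow> \<bar>f x a\<bar> \<le> C * (1 + pnorm p N x powr (p - \<epsilon>))"
        and Pp: "kernel_prod \<kappa> N \<in> Pp p N"
      by (auto simp: growth_def)
    show thesis
    proof (cases "p \<le> \<epsilon>")
      \<comment> \<open>For a negative exponent the growth bound can blow up at the origin, so a
        lower bound is taken from compactness instead.\<close>
      case True
      then have "p - \<epsilon> \<le> 0" by simp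
      from lower_semicont_bounded_below[OF f K p this C] bb show thesis by blast
    next
      case False
      define C' where "C' = \<bar>C\<bar> + 1"
      \<comment> \<open>\<open>M\<close> solves
        \<open>C' * 2 powr p * M powr (- \<epsilon>) = \<tau>\<close>: the factors are the growth
        constant, the loss in \<open>psum_le_diff\<close> and the small factor of
        \<open>powr_le_add\<close>.\<close>
      define M where "M = (\<tau> / (C' * 2 powr p)) powr (- 1 / \<epsilon>)"
      have C': "0 < C'" by (simp add: C'_def)
      then have M: "0 < M" "M powr (- \<epsilon>) = \<tau> / (C' * 2 powr p)"
        using \<tau> \<epsilon> by (auto simp: M_def powr_powr)
      show thesis
      proof (rule found[of "C' * (1 + M powr (p - \<epsilon>))" \<tau>])
        fix x y :: path and a assume y: "y \<in> space (Rn N)" and a: "a \<in> {..<N} \<rightarrow>\<^sub>E K"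
        have "pnorm p N y powr (p - \<epsilon>) \<le> M powr (p - \<epsilon>) + M powr (p - \<epsilon> - p) * pnorm p N y powr p"
          using False \<epsilon> M by (intro powr_le_add) (auto simp: pnorm_def)
        also have "\<dots> = M powr (p - \<epsilon>) + \<tau> / (C' * 2 powr p) * psum p N y"
          using p M(2) by (simp add: pnorm_powr)
        also have "\<dots> \<le> M powr (p - \<epsilon>) + \<tau> / (C' * 2 powr p) * (2 powr p * (psum p N x + psum p N (\<lambda>i. y i - x i)))"
          using psum_le_diff[OF p, of N y x] \<tau> C' by (intro add_left_mono mult_left_mono) auto
        also have "\<dots> = M powr (p - \<epsilon>) + \<tau> / C' * (psum p N x + psum p N (\<lambda>i. y i - x i))"
          using C' by (simp add: field_simps)
        finally have *: "pnorm p N y powr (p - \<epsilon>) \<le> M powr (p - \<epsilon>) + \<tau> / C' * (psum p N x + psum p N (\<lambda>i. y i - x i))" .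
        have "\<bar>f y a\<bar> \<le> C * (1 + pnorm p N y powr (p - \<epsilon>))"
          by (rule C[OF y aK[OF a]])
        also have "\<dots> \<le> C' * (1 + pnorm p N y powr (p - \<epsilon>))"
          by (intro mult_right_mono) (auto simp: C'_def)
        also have "\<dots> \<le> C' * (1 + (M powr (p - \<epsilon>) + \<tau> / C' * (psum p N x + psum p N (\<lambda>i. y i - x i))))"
          using * C' by (intro mult_left_mono add_left_mono) auto
        also have "\<dots> = C' * (1 + M powr (p - \<epsilon>)) + \<tau> * psum p N x + \<tau> * psum p N (\<lambda>i. y i - x i)"
          using C' by (simp add: field_simps)
        finally show "0 \<le> f y a + (C' * (1 + M powr (p - \<epsilon>)) + \<tau> * psum p N x + \<tau> * psum p N (\<lambda>i. y i - x i))"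
          by linarith
      qed (use C' \<tau> Pp in auto)
    qed
  qed
qed

section \<open>Removal of the penalty\<close>

lemma kernel_prod_in_prob_algebra:
  assumes "\<And>t. t < n \<Longrightarrow> \<kappa> t \<in> Rn t \<rightarrow>\<^sub>M prob_algebra borel" and "t \<le> n"
  shows "kernel_prod \<kappa> t \<in> space (prob_algebra (Rn t))"
  using assms(2)
proof (induction t)
  case 0
  have "(\<lambda>_. undefined) \<in> space (Rn 0)"
    by (simp add: space_Rn_0)
  from measurable_space[OF measurable_return_prob_space this] show ?case
    by simp
next
  case (Suc t)
  then have [measurable]: "\<kappa> t \<in> Rn t \<rightarrow>\<^sub>M prob_algebra borel"
    using assms by simp
  have step: "(\<lambda>x. distr (\<kappa> t x) (Rn (Suc t)) (\<lambda>u. x(t := u))) \<in> Rn t \<rightarrow>\<^sub>M prob_algebra (Rn (Suc t))"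
    by measurable
  have "(\<lambda>_. kernel_prod \<kappa> t) \<in> count_space {()} \<rightarrow>\<^sub>M prob_algebra (Rn t)"
    using Suc by simp
  from measurable_space[OF measurable_bind_prob_space[OF this step]] show ?case
    by simp
qed

lemma nn_integral_kernel_prod_Suc:
  assumes \<kappa>: "\<And>t. t < n \<Longrightarrow> \<kappa> t \<in> Rn t \<rightarrow>\<^sub>M prob_algebra borel" and t: "t < n"
    and h: "h \<in> borel_measurable (Rn (Suc t))"
  shows "(\<integral>\<^sup>+z. h z \<partial>kernel_prod \<kappa> (Suc t)) = (\<integral>\<^sup>+x. \<integral>\<^sup>+u. h (x(t := u)) \<partial>\<kappa> t x \<partial>kernel_prod \<kappa> t)"
proof -
  have [measurable]: "\<kappa> t \<in> Rn t \<rightarrow>\<^sub>M prob_algebra borel"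
    using \<kappa> t by simp
  have sets: "sets (kernel_prod \<kappa> t) = sets (Rn t)"
    using kernel_prod_in_prob_algebra[of n \<kappa> t] \<kappa> t by (simp add: space_prob_algebra)
  have "(\<lambda>x. distr (\<kappa> t x) (Rn (Suc t)) (\<lambda>u. x(t := u))) \<in> Rn t \<rightarrow>\<^sub>M subprob_algebra (Rn (Suc t))"
    by (rule measurable_prob_algebraD) measurable
  then have step: "(\<lambda>x. distr (\<kappa> t x) (Rn (Suc t)) (\<lambda>u. x(t := u))) \<in> kernel_prod \<kappa> t \<rightarrow>\<^sub>M subprob_algebra (Rn (Suc t))"
    using sets by (simp cong: measurable_cong_sets)
  show ?thesis
    unfolding kernel_prod.simps nn_integral_bind[OF h step]
  proof (rule nn_integral_cong)
    fix x assume "x \<in> space (kernel_prod \<kappa> t)"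
    then have x [measurable]: "x \<in> space (Rn t)"
      using sets_eq_imp_space_eq[OF sets] by simp
    have [measurable_cong]: "sets (\<kappa> t x) = sets borel"
      using measurable_space[OF \<kappa>[OF t] x] by (simp add: space_prob_algebra)
    have "(\<lambda>u. x(t := u)) \<in> \<kappa> t x \<rightarrow>\<^sub>M Rn (Suc t)"
      by measurable
    then show "(\<integral>\<^sup>+z. h z \<partial>distr (\<kappa> t x) (Rn (Suc t)) (\<lambda>u. x(t := u))) = (\<integral>\<^sup>+u. h (x(t := u)) \<partial>\<kappa> t x)"
      using h by (intro nn_integral_distr) auto
  qed
qed

lemma nn_integral_fst_Pi_delta_real:
  assumes \<gamma>: "\<gamma> \<in> Pi_delta_real p \<delta> \<eta>" and h: "h \<in> borel_measurable borel"
  shows "(\<integral>\<^sup>+uv. h (fst uv) \<partial>\<gamma>) = (\<integral>\<^sup>+u. h u \<partial>\<eta>)"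
proof -
  have [measurable_cong]: "sets \<gamma> = sets borel" and eq: "distr \<gamma> borel fst = \<eta>"
    using \<gamma> by (simp_all add: Pi_delta_real_def space_prob_algebra)
  show ?thesis
    unfolding eq[symmetric] using h by (intro nn_integral_distr[symmetric]) measurable
qed

locale robust_problem =
  fixes N :: nat and p \<delta> :: real and K :: "real set" and \<kappa> :: "nat \<Rightarrow> path \<Rightarrow> real measure"
    and f :: "path \<Rightarrow> path \<Rightarrow> real"
  assumes \<kappa>_meas: "\<And>t. t < N \<Longrightarrow> \<kappa> t \<in> Rn t \<rightarrow>\<^sub>M prob_algebra borel"
    and \<kappa>_cont: "successively_continuous p N \<kappa>"
    and p_pos: "0 < p" and \<delta>_pos: "0 < \<delta>" and K_compact: "compact K" and K_ne: "K \<noteq> {}"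
    and f_lsc: "lower_semicont N f"

locale penalized_problem = robust_problem +
  fixes A \<theta> :: real
  assumes A: "0 \<le> A" and \<theta>: "0 \<le> \<theta>" and fin: "\<theta> = 0 \<or> kernel_prod \<kappa> N \<in> Pp p N"
    and nonneg: "\<And>x y a. y \<in> space (Rn N) \<Longrightarrow> a \<in> {..<N} \<rightarrow>\<^sub>E K \<Longrightarrow>
      0 \<le> f y a + (A + \<theta> * psum p N x + \<theta> * psum p N (\<lambda>i. y i - x i))"
begin

sublocale control_problem N p \<delta> K \<kappa> "\<lambda>z. ennreal (penalized p N f A \<theta> z)"
  using \<kappa>_meas successively_continuous_weak[OF \<kappa>_cont p_pos] p_pos \<delta>_pos K_compact K_ne
    lsc_penalized[OF f_lsc p_pos]
  by unfold_locales auto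

primrec corr_to_go :: "nat \<Rightarrow> path \<Rightarrow> ennreal" where
  "corr_to_go 0 x = ennreal (A + \<theta> * psum p N x)"
| "corr_to_go (Suc n) x = (\<integral>\<^sup>+u. corr_to_go n (x(N - Suc n := u)) \<partial>\<kappa> (N - Suc n) x)"

text \<open>The conditional expectation of the part of the penalty that involves the first coordinates only.\<close>

definition corr :: "nat \<Rightarrow> path \<Rightarrow> ennreal" where
  "corr t = corr_to_go (N - t)"

lemma corr_N: "corr N x = ennreal (A + \<theta> * psum p N x)"
  by (simp add: corr_def)

lemma corr_step: "t < N \<Longrightarrow> corr t x = (\<integral>\<^sup>+u. corr (Suc t) (x(t := u)) \<partial>\<kappa> t x)"
  by (simp add: corr_def Suc_diff_Suc[symmetric])

lemma measurable_psum_diff: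
  "(\<lambda>xy. psum p t (\<lambda>i. snd xy i - fst xy i)) \<in> borel_measurable (Rn2 t)"
proof -
  have [measurable]: "(\<lambda>x. x i) \<in> Rn t \<rightarrow>\<^sub>M (borel :: real measure)" if "i \<in> {..<t}" for i
    using that by (rule measurable_component_singleton)
  show ?thesis
    unfolding psum_def by (intro borel_measurable_sum) measurable
qed

lemma measurable_psum: "psum p t \<in> borel_measurable (Rn t)"
proof -
  have [measurable]: "(\<lambda>x. x i) \<in> Rn t \<rightarrow>\<^sub>M (borel :: real measure)" if "i \<in> {..<t}" for i
    using that by (rule measurable_component_singleton)
  show ?thesis
    unfolding psum_def by (intro borel_measurable_sum) measurable
qed

lemma measurable_corr: "t \<le> N \<Longrightarrow> corr t \<in> borel_measurable (Rn t)"
proof (induction t rule: inc_induct)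
  case base
  show ?case
    using measurable_psum[of N] by (simp add: corr_N[abs_def])
next
  case (step t)
  note [measurable] = step.IH
  have [measurable]: "\<kappa> t \<in> Rn t \<rightarrow>\<^sub>M subprob_algebra borel"
    using \<kappa>_meas step by (intro measurable_prob_algebraD)
  have "(\<lambda>x. \<integral>\<^sup>+u. corr (Suc t) (x(t := u)) \<partial>\<kappa> t x) \<in> borel_measurable (Rn t)"
    by (rule nn_integral_measurable_subprob_algebra2[where N=borel]) measurable
  moreover have "corr t = (\<lambda>x. \<integral>\<^sup>+u. corr (Suc t) (x(t := u)) \<partial>\<kappa> t x)"
    using step by (intro ext corr_step)
  ultimately show ?case
    by simp
qed

lemma measurable_corr_upd:
  assumes "t < N" and [measurable]: "x \<in> space (Rn t)"
  shows "(\<lambda>u. corr (Suc t) (x(t := u))) \<in> borel_measurable borel"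
proof -
  have [measurable]: "corr (Suc t) \<in> borel_measurable (Rn (Suc t))"
    using assms by (intro measurable_corr) simp
  show ?thesis by measurable
qed

text \<open>The mean of \<open>corr t\<close> under the first \<open>t\<close> kernels does not
  depend on \<open>t\<close>, and at the horizon it is \<open>A\<close> plus \<open>\<theta>\<close>
  times the p-th moment. At individual later states \<open>corr\<close> may be infinite.\<close>

lemma corr_0_finite: "corr 0 (\<lambda>_. undefined) < \<top>"
proof -
  have eq: "t \<le> N \<Longrightarrow> (\<integral>\<^sup>+x. corr t x \<partial>kernel_prod \<kappa> t) = corr 0 (\<lambda>_. undefined)" for t
  proof (induction t)
    case 0
    show ?case
      using measurable_corr[of 0] by (simp add: nn_integral_return space_PiM_empty)
  next
    case (Suc t)
    then have t: "t < N" by simp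
    then have "(\<integral>\<^sup>+x. corr (Suc t) x \<partial>kernel_prod \<kappa> (Suc t)) = (\<integral>\<^sup>+x. corr t x \<partial>kernel_prod \<kappa> t)"
      by (subst nn_integral_kernel_prod_Suc[OF \<kappa>_meas t measurable_corr])
        (auto intro!: nn_integral_cong simp: corr_step)
    with Suc show ?case by (simp del: kernel_prod.simps)
  qed
  have sets: "sets (kernel_prod \<kappa> N) = sets (Rn N)" and "prob_space (kernel_prod \<kappa> N)"
    using kernel_prod_in_prob_algebra[of N \<kappa> N] \<kappa>_meas by (auto simp: space_prob_algebra)
  interpret P: prob_space "kernel_prod \<kappa> N" by fact
  have meas: "(\<lambda>x. ennreal (psum p N x)) \<in> borel_measurable (kernel_prod \<kappa> N)"
    using measurable_psum[of N] sets by (simp cong: measurable_cong_sets)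
  have "corr 0 (\<lambda>_. undefined) = (\<integral>\<^sup>+x. ennreal A + ennreal \<theta> * ennreal (psum p N x) \<partial>kernel_prod \<kappa> N)"
    unfolding eq[OF order_refl, symmetric] using A \<theta>
    by (intro nn_integral_cong) (simp add: corr_N psum_nonneg flip: ennreal_mult ennreal_plus)
  also have "\<dots> = ennreal A + ennreal \<theta> * (\<integral>\<^sup>+x. ennreal (psum p N x) \<partial>kernel_prod \<kappa> N)"
    using meas by (simp add: nn_integral_add nn_integral_cmult P.emeasure_space_1)
  also have "\<dots> < \<top>"
    using fin by (auto simp: Pp_def pnorm_powr[OF p_pos] ennreal_mult_less_top)
  finally show ?thesis .
qed

text \<open>The penalty already incurred by \<open>y - x\<close>, plus a budget for the remaining
  \<open>N - t\<close> steps, each of which has p-th power cost below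
  \<open>\<delta> powr p\<close>.\<close>

definition err :: "nat \<Rightarrow> path \<Rightarrow> path \<Rightarrow> real" where
  "err t x y = \<theta> * (psum p t (\<lambda>i. y i - x i) + real (N - t) * \<delta> powr p)"

lemma err_nonneg: "0 \<le> err t x y"
  using \<theta> by (simp add: err_def psum_nonneg)

lemma err_Suc:
  assumes "t < N"
  shows "err (Suc t) (x(t := u)) (y(t := v)) + \<theta> * \<delta> powr p = err t x y + \<theta> * \<bar>u - v\<bar> powr p"
proof -
  have "real (N - t) = real (N - Suc t) + 1"
    using assms by (simp add: of_nat_diff)
  moreover have "psum p (Suc t) (\<lambda>i. (y(t := v)) i - (x(t := u)) i) = psum p t (\<lambda>i. y i - x i) + \<bar>u - v\<bar> powr p"
    by (simp add: psum_def abs_minus_commute)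
  ultimately show ?thesis
    by (simp add: err_def algebra_simps)
qed

text \<open>A supermartingale inequality: the deviation grows in mean by less than
  \<open>\<delta> powr p\<close>, and the budget of the remaining steps shrinks by exactly that
  amount.\<close>

lemma nn_integral_err:
  assumes t: "t < N" and \<gamma>: "\<gamma> \<in> Pi_delta_real p \<delta> \<eta>"
  shows "(\<integral>\<^sup>+uv. ennreal (err (Suc t) (x(t := fst uv)) (y(t := snd uv))) \<partial>\<gamma>) \<le> ennreal (err t x y)"
proof -
  have s [measurable_cong]: "sets \<gamma> = sets borel" and "prob_space \<gamma>"
      and cost: "(\<integral>\<^sup>+uv. ennreal (\<bar>fst uv - snd uv\<bar> powr p) \<partial>\<gamma>) < ennreal (\<delta> powr p)"
    using \<gamma> by (simp_all add: Pi_delta_real_def space_prob_algebra pcost_less_iff[OF p_pos \<delta>_pos] case_prod_beta')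
  interpret prob_space \<gamma> by fact
  let ?E = "\<lambda>uv. err (Suc t) (x(t := fst uv)) (y(t := snd uv))"
  have E: "?E uv = err t x y + \<theta> * \<bar>fst uv - snd uv\<bar> powr p - \<theta> * \<delta> powr p" for uv
    using err_Suc[OF t, of x "fst uv" y "snd uv"] by simp
  have [measurable]: "?E \<in> borel_measurable \<gamma>"
    unfolding E by measurable
  \<comment> \<open>The budget of one step is added to both sides and cancelled at the end, which
    avoids the truncated subtraction of \<open>ennreal\<close>.\<close>
  have "(\<integral>\<^sup>+uv. ennreal (?E uv) \<partial>\<gamma>) + ennreal (\<theta> * \<delta> powr p) = (\<integral>\<^sup>+uv. ennreal (?E uv) + ennreal (\<theta> * \<delta> powr p) \<partial>\<gamma>)"
    by (subst nn_integral_add) (auto simp: emeasure_space_1)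
  also have "\<dots> = (\<integral>\<^sup>+uv. ennreal (err t x y) + ennreal \<theta> * ennreal (\<bar>fst uv - snd uv\<bar> powr p) \<partial>\<gamma>)"
    using err_Suc[OF t] \<theta> err_nonneg
    by (intro nn_integral_cong) (simp flip: ennreal_plus ennreal_mult)
  also have "\<dots> = ennreal (err t x y) + ennreal \<theta> * (\<integral>\<^sup>+uv. ennreal (\<bar>fst uv - snd uv\<bar> powr p) \<partial>\<gamma>)"
    by (simp add: nn_integral_add nn_integral_cmult emeasure_space_1)
  also have "\<dots> \<le> ennreal (err t x y) + ennreal \<theta> * ennreal (\<delta> powr p)"
    using cost by (intro add_left_mono mult_left_mono) auto
  also have "\<dots> = ennreal (err t x y) + ennreal (\<theta> * \<delta> powr p)"
    using \<theta> by (simp add: ennreal_mult)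
  finally show ?thesis
    by (simp add: ennreal_add_left_cancel_le add.commute)
qed

lemma U_eq_INF_SUP:
  assumes t: "t < N" and x: "x \<in> space (Rn t)"
  shows "enn2ereal (U t (x, y, a)) =
    (INF b\<in>K. SUP \<gamma>\<in>Pi_delta_real p \<delta> (\<kappa> t x). enn2ereal (\<integral>\<^sup>+uv. U (Suc t) (upd t (x, y, a) b uv) \<partial>\<gamma>))"
proof -
  interpret S: kernel_step "kr t" p \<delta> K by (rule kernel_step_kr) fact
  have kr: "kr t x = \<kappa> t x"
    using x by (simp add: kr_def restrict_Rn)
  have "Pi_delta_real p \<delta> (\<kappa> t x) \<noteq> {}"
    using lift_shift_in_Pi_delta_real[OF shifts_nonempty[OF \<delta>_pos] p_pos \<delta>_pos S.real_distribution_k[of x]]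
    by (auto simp: kr)
  from enn2ereal_INF_SUP[OF this] show ?thesis
    unfolding U_step[OF t] S.val_def S.gain_def by (simp add: kr)
qed

lemma ereal_add_uminus_le:
  fixes I J :: ereal
  shows "J \<le> I + ereal s \<Longrightarrow> J + ereal (- s) \<le> I"
  by (cases I; cases J) auto

text \<open>Backward induction encloses \<open>dpp_value\<close> between
  \<open>U - corr - err\<close> and \<open>U - corr\<close>. All admissible couplings give
  \<open>corr\<close> the same mean, so it can be carried through the recursion, whereas
  \<open>err\<close> may only shrink in mean.\<close>

lemma dpp_value_U:
  assumes "t \<le> N" and "x \<in> space (Rn t)" and "y \<in> space (Rn t)" and "a \<in> {..<t} \<rightarrow>\<^sub>E K"
    and "corr t x = ennreal c" and "0 \<le> c"
  shows "dpp_value p \<delta> K \<kappa> f N t x y a + ereal c \<le> enn2ereal (U t (x, y, a))"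
    and "enn2ereal (U t (x, y, a)) + ereal (- (c + err t x y)) \<le> dpp_value p \<delta> K \<kappa> f N t x y a"
proof -
  let ?P = "\<lambda>t x y a c. dpp_value p \<delta> K \<kappa> f N t x y a + ereal c \<le> enn2ereal (U t (x, y, a)) \<and>
      enn2ereal (U t (x, y, a)) + ereal (- (c + err t x y)) \<le> dpp_value p \<delta> K \<kappa> f N t x y a"
  have "?P t x y a c"
    using assms
  proof (induction t arbitrary: x y a c rule: inc_induct)
    case base
    have c: "c = A + \<theta> * psum p N x"
    proof -
      have "ennreal c = ennreal (A + \<theta> * psum p N x)"
        using base.prems by (simp only: corr_N)
      then show ?thesis
        using base.prems A \<theta> by (subst (asm) ennreal_inj) (auto simp: psum_nonneg)
    qed
    have r: "restrict y {..<N} = y" "restrict a {..<N} = a"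
      using base.prems by (auto simp: restrict_Rn PiE_restrict)
    have U: "enn2ereal (U N (x, y, a)) = ereal (f y a + (A + \<theta> * psum p N x + \<theta> * psum p N (\<lambda>i. y i - x i)))"
      unfolding fun_cong[OF U_N] using nonneg[of y a x] base.prems by (simp add: penalized_def r)
    show ?case
      unfolding U c using \<theta> psum_nonneg[of p N "\<lambda>i. y i - x i"]
      by (simp add: dpp_value.simps err_def)
  next
    case (step t)
    then have t: "t < N" by simp
    let ?G = "Pi_delta_real p \<delta> (\<kappa> t x)"
    let ?V = "\<lambda>b uv. dpp_value p \<delta> K \<kappa> f N (Suc t) (x(t := fst uv)) (y(t := snd uv)) (a(t := b))"
    let ?I = "\<lambda>b \<gamma>. ereal_integral \<gamma> (?V b)"
    let ?J = "\<lambda>b \<gamma>. enn2ereal (\<integral>\<^sup>+uv. U (Suc t) (upd t (x, y, a) b uv) \<partial>\<gamma>)"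
    have dpp: "dpp_value p \<delta> K \<kappa> f N t x y a = (INF b\<in>K. SUP \<gamma>\<in>?G. ?I b \<gamma>)"
      using t by (subst dpp_value.simps) (simp add: case_prod_beta')
    have U: "enn2ereal (U t (x, y, a)) = (INF b\<in>K. SUP \<gamma>\<in>?G. ?J b \<gamma>)"
      by (rule U_eq_INF_SUP[OF t]) fact
    have main: "?I b \<gamma> + ereal c \<le> ?J b \<gamma> \<and> ?J b \<gamma> + ereal (- (c + err t x y)) \<le> ?I b \<gamma>"
      if b: "b \<in> K" and \<gamma>: "\<gamma> \<in> ?G" for b \<gamma>
    proof -
      have s [measurable_cong]: "sets \<gamma> = sets borel"
        using \<gamma> by (simp add: Pi_delta_real_def space_prob_algebra)
      let ?\<psi> = "\<lambda>uv. corr (Suc t) (x(t := fst uv))"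
      let ?e = "\<lambda>uv. ennreal (err (Suc t) (x(t := fst uv)) (y(t := snd uv)))"
      have [measurable]: "(\<lambda>u. corr (Suc t) (x(t := u))) \<in> borel_measurable borel"
        using t step.prems by (intro measurable_corr_upd)
      have psi_meas: "?\<psi> \<in> borel_measurable \<gamma>"
        by measurable
      have psi: "(\<integral>\<^sup>+uv. ?\<psi> uv \<partial>\<gamma>) = ennreal c"
        using nn_integral_fst_Pi_delta_real[OF \<gamma>, of "\<lambda>u. corr (Suc t) (x(t := u))"] step.prems
        by (simp add: corr_step[OF t])
      have e_meas: "?e \<in> borel_measurable \<gamma>"
      proof -
        have "?e = (\<lambda>uv. ennreal (err t x y + \<theta> * \<bar>fst uv - snd uv\<bar> powr p - \<theta> * \<delta> powr p))"
        proof
          fix uv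
          show "?e uv = ennreal (err t x y + \<theta> * \<bar>fst uv - snd uv\<bar> powr p - \<theta> * \<delta> powr p)"
            using err_Suc[OF t, of x "fst uv" y "snd uv"] by (intro arg_cong[where f=ennreal]) simp
        qed
        then show ?thesis by simp
      qed
      have e: "(\<integral>\<^sup>+uv. ?e uv \<partial>\<gamma>) \<le> ennreal (err t x y)"
        by (rule nn_integral_err[OF t \<gamma>])
      have U_meas: "(\<lambda>uv. U (Suc t) (upd t (x, y, a) b uv)) \<in> borel_measurable \<gamma>"
        using lsc_measurable[OF lsc_U[of "Suc t"]] t by simp
      \<comment> \<open>Where \<open>corr (Suc t)\<close> is infinite the induction hypothesis says
        nothing; as its mean is the finite \<open>c\<close>, this is a null set.\<close>
      have IH: "?P (Suc t) (x(t := fst uv)) (y(t := snd uv)) (a(t := b)) (enn2real (?\<psi> uv))" if "?\<psi> uv \<noteq> \<top>" for uv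
      proof (rule step.IH)
        show "a(t := b) \<in> {..<Suc t} \<rightarrow>\<^sub>E K"
          using step.prems b by (auto simp: PiE_iff extensional_def less_Suc_eq)
        show "corr (Suc t) (x(t := fst uv)) = ennreal (enn2real (?\<psi> uv))"
          using that by (simp add: less_top)
        show "x(t := fst uv) \<in> space (Rn (Suc t))" "y(t := snd uv) \<in> space (Rn (Suc t))"
          by (intro upd_in_Rn step.prems)+
      qed simp
      have upd: "upd t (x, y, a) b uv = (x(t := fst uv), y(t := snd uv), a(t := b))" for uv
        by (simp add: upd_def)
      have "?I b \<gamma> + enn2ereal (\<integral>\<^sup>+uv. ?\<psi> uv \<partial>\<gamma>) \<le> ?J b \<gamma>"
      proof (rule ereal_integral_add_le[OF U_meas psi_meas])
        show "AE uv in \<gamma>. ?\<psi> uv \<noteq> \<top> \<longrightarrow> ?V b uv + enn2ereal (?\<psi> uv) \<le> enn2ereal (U (Suc t) (upd t (x, y, a) b uv))"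
        proof (intro AE_I2 impI)
          fix uv :: "real \<times> real" assume nt: "?\<psi> uv \<noteq> \<top>"
          then have "enn2ereal (?\<psi> uv) = ereal (enn2real (?\<psi> uv))"
            by (cases "?\<psi> uv") auto
          with IH[OF nt] show "?V b uv + enn2ereal (?\<psi> uv) \<le> enn2ereal (U (Suc t) (upd t (x, y, a) b uv))"
            by (simp add: upd)
        qed
      qed (simp add: psi)
      then have 1: "?I b \<gamma> + ereal c \<le> ?J b \<gamma>"
        using step.prems by (simp add: psi)
      have sum: "(\<integral>\<^sup>+uv. ?\<psi> uv + ?e uv \<partial>\<gamma>) \<le> ennreal (c + err t x y)"
        using e psi step.prems err_nonneg
        by (subst nn_integral_add[OF psi_meas e_meas]) (simp add: add_left_mono)
      have "?J b \<gamma> \<le> ?I b \<gamma> + enn2ereal (\<integral>\<^sup>+uv. ?\<psi> uv + ?e uv \<partial>\<gamma>)"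
      proof (rule ereal_integral_add_ge[OF U_meas])
        show "(\<integral>\<^sup>+uv. ?\<psi> uv + ?e uv \<partial>\<gamma>) < \<top>"
          using sum ennreal_less_top by (rule order.strict_trans1)
        show "AE uv in \<gamma>. ?\<psi> uv + ?e uv \<noteq> \<top> \<longrightarrow> enn2ereal (U (Suc t) (upd t (x, y, a) b uv)) \<le> ?V b uv + enn2ereal (?\<psi> uv + ?e uv)"
        proof (intro AE_I2 impI)
          fix uv :: "real \<times> real" assume "?\<psi> uv + ?e uv \<noteq> \<top>"
          then have nt: "?\<psi> uv \<noteq> \<top>" by simp
          then have eq: "enn2ereal (?\<psi> uv + ?e uv) = ereal (enn2real (?\<psi> uv) + err (Suc t) (x(t := fst uv)) (y(t := snd uv)))"
            by (cases "?\<psi> uv") (auto simp: err_nonneg simp flip: ennreal_plus)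
          from IH[OF nt] have "enn2ereal (U (Suc t) (upd t (x, y, a) b uv)) +
              ereal (- (enn2real (?\<psi> uv) + err (Suc t) (x(t := fst uv)) (y(t := snd uv)))) \<le> ?V b uv"
            by (simp add: upd)
          then show "enn2ereal (U (Suc t) (upd t (x, y, a) b uv)) \<le> ?V b uv + enn2ereal (?\<psi> uv + ?e uv)"
            unfolding eq
            by (cases "?V b uv"; cases "enn2ereal (U (Suc t) (upd t (x, y, a) b uv))") auto
        qed
      qed (use psi_meas e_meas in measurable)
      also have "\<dots> \<le> ?I b \<gamma> + ereal (c + err t x y)"
        using sum step.prems err_nonneg[of t x y]
        by (intro add_left_mono) (simp add: less_eq_ennreal.rep_eq del: ennreal_plus)
      finally show ?thesis
        using 1 ereal_add_uminus_le by blast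
    qed
    show ?case
      unfolding dpp U using main INF_SUP_add_le[of K ?G ?I c ?J] INF_SUP_add_le[of K ?G ?J "- (c + err t x y)" ?I]
      by blast
  qed
  then show "dpp_value p \<delta> K \<kappa> f N t x y a + ereal c \<le> enn2ereal (U t (x, y, a))"
    and "enn2ereal (U t (x, y, a)) + ereal (- (c + err t x y)) \<le> dpp_value p \<delta> K \<kappa> f N t x y a"
    by auto
qed

end

context penalized_problem
begin

context
  fixes g assumes dk: "delta_kernels p \<delta> N \<kappa> g"
begin

interpretation pair_kernels g N
  by (rule pair_kernels_delta_kernels[OF dk])

text \<open>Admissible kernels have the prescribed first marginals, so the mean of a function of the
  first path is the same for all of them.\<close>

lemma nn_integral_corr:
  "t \<le> N \<Longrightarrow> (\<integral>\<^sup>+xy. corr t (fst xy) \<partial>pair_kernel_prod g t) = corr 0 (\<lambda>_. undefined)"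
proof (induction t)
  case 0
  have "(\<lambda>xy. corr 0 (fst xy)) \<in> borel_measurable (Rn2 0)"
    using measurable_compose[OF measurable_fst measurable_corr[of 0]] by simp
  then show ?case
    by (simp add: nn_integral_return space_pair_measure space_PiM_empty)
next
  case (Suc t)
  then have t: "t < N" by simp
  have "(\<lambda>xy. corr (Suc t) (fst xy)) \<in> borel_measurable (Rn2 (Suc t))"
    using measurable_compose[OF measurable_fst measurable_corr[of "Suc t"]] t by simp
  then have "(\<integral>\<^sup>+xy. corr (Suc t) (fst xy) \<partial>pair_kernel_prod g (Suc t)) =
      (\<integral>\<^sup>+xy. \<integral>\<^sup>+uv. corr (Suc t) (fst (pair_upd t xy uv)) \<partial>g t xy \<partial>pair_kernel_prod g t)"
    by (rule nn_integral_Suc[OF t])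
  also have "\<dots> = (\<integral>\<^sup>+xy. corr t (fst xy) \<partial>pair_kernel_prod g t)"
  proof (rule nn_integral_cong)
    fix xy assume "xy \<in> space (pair_kernel_prod g t)"
    then have xy: "xy \<in> space (Rn2 t)"
      using t by (simp add: space_pair_kernel_prod)
    then have "fst xy \<in> space (Rn t)"
      by (auto simp: space_pair_measure)
    from nn_integral_fst_Pi_delta_real[OF delta_kernels_cases[OF dk t xy] measurable_corr_upd[OF t this]]
    show "(\<integral>\<^sup>+uv. corr (Suc t) (fst (pair_upd t xy uv)) \<partial>g t xy) = corr t (fst xy)"
      by (simp add: pair_upd_def corr_step[OF t])
  qed
  also have "\<dots> = corr 0 (\<lambda>_. undefined)"
    using Suc by simp
  finally show ?case .
qed

lemma measurable_err: "(\<lambda>xy. err t (fst xy) (snd xy)) \<in> borel_measurable (Rn2 t)"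
  using measurable_psum_diff unfolding err_def by measurable

lemma nn_integral_err_prod:
  "t \<le> N \<Longrightarrow> (\<integral>\<^sup>+xy. ennreal (err t (fst xy) (snd xy)) \<partial>pair_kernel_prod g t) \<le> ennreal (\<theta> * (real N * \<delta> powr p))"
proof (induction t)
  case 0
  have "(\<lambda>xy. ennreal (err 0 (fst xy) (snd xy))) \<in> borel_measurable (Rn2 0)"
    using measurable_err[of 0] by simp
  then show ?case
    by (simp add: nn_integral_return space_pair_measure space_PiM_empty) (simp add: err_def psum_def)
next
  case (Suc t)
  then have t: "t < N" by simp
  have "(\<integral>\<^sup>+xy. ennreal (err (Suc t) (fst xy) (snd xy)) \<partial>pair_kernel_prod g (Suc t)) =
      (\<integral>\<^sup>+xy. \<integral>\<^sup>+uv. ennreal (err (Suc t) (fst (pair_upd t xy uv)) (snd (pair_upd t xy uv))) \<partial>g t xy \<partial>pair_kernel_prod g t)"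
    using measurable_err[of "Suc t"] by (intro nn_integral_Suc[OF t]) simp
  also have "\<dots> \<le> (\<integral>\<^sup>+xy. ennreal (err t (fst xy) (snd xy)) \<partial>pair_kernel_prod g t)"
  proof (rule nn_integral_mono)
    fix xy assume "xy \<in> space (pair_kernel_prod g t)"
    then have xy: "xy \<in> space (Rn2 t)"
      using t by (simp add: space_pair_kernel_prod)
    from nn_integral_err[OF t delta_kernels_cases[OF dk t xy]]
    show "(\<integral>\<^sup>+uv. ennreal (err (Suc t) (fst (pair_upd t xy uv)) (snd (pair_upd t xy uv))) \<partial>g t xy) \<le> ennreal (err t (fst xy) (snd xy))"
      by (simp add: pair_upd_def)
  qed
  also have "\<dots> \<le> ennreal (\<theta> * (real N * \<delta> powr p))"
    using Suc by simp
  finally show ?case .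
qed

text \<open>The counterpart of \<open>dpp_value_U\<close> for one control and one coupling: the
  penalty in \<open>x\<close> has mean \<open>c\<close> together with \<open>A\<close>, and the
  deviation penalty has mean at most \<open>\<theta> * (real N * \<delta> powr p)\<close>.\<close>

lemma ereal_integral_penalized:
  assumes \<alpha>: "\<alpha> \<in> controls N K" and c: "corr 0 (\<lambda>_. undefined) = ennreal c" "0 \<le> c"
  defines "I \<equiv> ereal_integral (pair_kernel_prod g N) (\<lambda>(x, y). ereal (f y (\<alpha> (x, y))))"
    and "J \<equiv> enn2ereal (\<integral>\<^sup>+xy. ennreal (penalized p N f A \<theta> (fst xy, snd xy, \<alpha> xy)) \<partial>pair_kernel_prod g N)"
  shows "I + ereal c \<le> J" and "J + ereal (- (c + \<theta> * (real N * \<delta> powr p))) \<le> I"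
proof -
  let ?M = "pair_kernel_prod g N"
  have s [measurable_cong]: "sets ?M = sets (Rn2 N)" and sp: "space ?M = space (Rn2 N)"
    by (simp_all add: sets_pair_kernel_prod space_pair_kernel_prod)
  let ?F = "\<lambda>xy. ennreal (penalized p N f A \<theta> (fst xy, snd xy, \<alpha> xy))"
  have \<alpha>': "\<alpha> \<in> Rn2 N \<rightarrow>\<^sub>M Rn N"
    using \<alpha> unfolding controls_def by blast
  have F_meas: "?F \<in> borel_measurable ?M"
    using measurable_U_Rn[OF order_refl \<alpha>'] s by (simp add: U_N cong: measurable_cong_sets)
  have psi_meas: "(\<lambda>xy. corr N (fst xy)) \<in> borel_measurable ?M"
    using measurable_compose[OF measurable_fst measurable_corr[of N]] s by (simp cong: measurable_cong_sets)
  have e_meas: "(\<lambda>xy. ennreal (err N (fst xy) (snd xy))) \<in> borel_measurable ?M"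
    using measurable_err[of N] s by (simp cong: measurable_cong_sets)
  have psi: "(\<integral>\<^sup>+xy. corr N (fst xy) \<partial>?M) = ennreal c"
    using nn_integral_corr[OF order_refl] c by simp
  have pt: "enn2ereal (?F xy) = ereal (f (snd xy) (\<alpha> xy) + (A + \<theta> * psum p N (fst xy) + err N (fst xy) (snd xy)))"
    if xy: "xy \<in> space ?M" for xy
  proof -
    have xy': "xy \<in> space (Rn2 N)"
      using xy sp by simp
    then have y: "snd xy \<in> space (Rn N)"
      by (cases xy) (simp add: space_pair_measure)
    have "\<alpha> xy \<in> space (Rn N)"
      using measurable_space[OF \<alpha>' xy'] .
    then have r: "restrict (\<alpha> xy) {..<N} = \<alpha> xy" "restrict (snd xy) {..<N} = snd xy"
      using y by (simp_all only: restrict_Rn)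
    have "\<forall>x\<in>space (Rn N). \<forall>y\<in>space (Rn N). \<forall>t<N. \<alpha> (x, y) t \<in> K"
      using \<alpha> unfolding controls_def by blast
    then have "\<forall>t<N. \<alpha> xy t \<in> K"
      using xy' by (cases xy) (simp add: space_pair_measure)
    with \<open>\<alpha> xy \<in> space (Rn N)\<close> have "\<alpha> xy \<in> {..<N} \<rightarrow>\<^sub>E K"
      by (auto simp: space_PiM PiE_iff)
    with y have "0 \<le> f (snd xy) (\<alpha> xy) + (A + \<theta> * psum p N (fst xy) + \<theta> * psum p N (\<lambda>i. snd xy i - fst xy i))"
      by (intro nonneg)
    then show ?thesis
      by (simp add: penalized_def r err_def)
  qed
  have corr_pt: "enn2ereal (corr N x) = ereal (A + \<theta> * psum p N x)" for x
    unfolding corr_N using A \<theta> psum_nonneg by (intro enn2ereal_ennreal) simp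
  have "I + enn2ereal (\<integral>\<^sup>+xy. corr N (fst xy) \<partial>?M) \<le> J"
    unfolding I_def J_def
  proof (rule ereal_integral_add_le[OF F_meas psi_meas])
    show "AE xy in ?M. corr N (fst xy) \<noteq> \<top> \<longrightarrow>
        (case xy of (x, y) \<Rightarrow> ereal (f y (\<alpha> (x, y)))) + enn2ereal (corr N (fst xy)) \<le> enn2ereal (?F xy)"
    proof (intro AE_I2 impI)
      fix xy assume "xy \<in> space ?M"
      from pt[OF this] show "(case xy of (x, y) \<Rightarrow> ereal (f y (\<alpha> (x, y)))) + enn2ereal (corr N (fst xy)) \<le> enn2ereal (?F xy)"
        using err_nonneg[of N "fst xy" "snd xy"] by (cases xy) (simp add: corr_pt)
    qed
  qed (simp add: psi)
  then show "I + ereal c \<le> J"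
    using c by (simp add: psi)
  have E: "0 \<le> \<theta> * (real N * \<delta> powr p)"
    using \<theta> by simp
  have sum: "(\<integral>\<^sup>+xy. corr N (fst xy) + ennreal (err N (fst xy) (snd xy)) \<partial>?M) \<le> ennreal (c + \<theta> * (real N * \<delta> powr p))"
    using nn_integral_err_prod[OF order_refl] psi c(2) E
    by (subst nn_integral_add[OF psi_meas e_meas]) (simp add: add_left_mono)
  have "J \<le> I + enn2ereal (\<integral>\<^sup>+xy. corr N (fst xy) + ennreal (err N (fst xy) (snd xy)) \<partial>?M)"
    unfolding I_def J_def
  proof (rule ereal_integral_add_ge[OF F_meas])
    show "(\<lambda>xy. corr N (fst xy) + ennreal (err N (fst xy) (snd xy))) \<in> borel_measurable ?M"
      using psi_meas e_meas by measurable
    show "(\<integral>\<^sup>+xy. corr N (fst xy) + ennreal (err N (fst xy) (snd xy)) \<partial>?M) < \<top>"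
      using sum ennreal_less_top by (rule order.strict_trans1)
    show "AE xy in ?M. corr N (fst xy) + ennreal (err N (fst xy) (snd xy)) \<noteq> \<top> \<longrightarrow>
        enn2ereal (?F xy) \<le> (case xy of (x, y) \<Rightarrow> ereal (f y (\<alpha> (x, y)))) + enn2ereal (corr N (fst xy) + ennreal (err N (fst xy) (snd xy)))"
    proof (intro AE_I2 impI)
      fix xy assume "xy \<in> space ?M"
      from pt[OF this] show "enn2ereal (?F xy) \<le> (case xy of (x, y) \<Rightarrow> ereal (f y (\<alpha> (x, y)))) + enn2ereal (corr N (fst xy) + ennreal (err N (fst xy) (snd xy)))"
        using err_nonneg[of N "fst xy" "snd xy"] by (cases xy) (simp add: plus_ennreal.rep_eq corr_pt)
    qed
  qed
  also have "\<dots> \<le> I + ereal (c + \<theta> * (real N * \<delta> powr p))"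
    using sum c E by (intro add_left_mono) (simp add: less_eq_ennreal.rep_eq del: ennreal_plus)
  finally show "J + ereal (- (c + \<theta> * (real N * \<delta> powr p))) \<le> I"
    by (rule ereal_add_uminus_le)
qed

end

lemma controls_nonempty: "controls N K \<noteq> {}"
proof -
  obtain b where b: "b \<in> K" using K_ne by blast
  have "(\<lambda>xy. \<lambda>i\<in>{..<N}. b) \<in> controls N K"
    using b by (auto simp: controls_def space_PiM intro!: measurable_const)
  then show ?thesis by blast
qed

text \<open>Both quantities lie between \<open>U - c - e\<close> and \<open>U - c\<close> with the
  same initial value \<open>U\<close> and the same constant \<open>c\<close>, hence differ by at
  most \<open>e\<close>. The case distinctions cover an infinite \<open>U\<close>.\<close>

lemma robust_value_approx:
  defines "e \<equiv> ereal (\<theta> * (real N * \<delta> powr p))"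
    and "V \<equiv> dpp_value p \<delta> K \<kappa> f N 0 (\<lambda>_. undefined) (\<lambda>_. undefined) (\<lambda>_. undefined)"
  shows "robust_value p \<delta> K \<kappa> f N \<le> V + e" and "V \<le> robust_value p \<delta> K \<kappa> f N + e"
proof -
  let ?G = "Pi_bc_delta p \<delta> N \<kappa>" and ?E = "\<theta> * (real N * \<delta> powr p)"
  let ?I = "\<lambda>\<alpha> \<gamma>. ereal_integral \<gamma> (\<lambda>(x, y). ereal (f y (\<alpha> (x, y))))"
  let ?J = "\<lambda>\<alpha> \<gamma>. enn2ereal (\<integral>\<^sup>+xy. ennreal (penalized p N f A \<theta> (fst xy, snd xy, \<alpha> xy)) \<partial>\<gamma>)"
  obtain c where c: "corr 0 (\<lambda>_. undefined) = ennreal c" "0 \<le> c"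
    using corr_0_finite by (cases "corr 0 (\<lambda>_. undefined)") auto
  have U: "enn2ereal (U 0 start) = (INF \<alpha>\<in>controls N K. SUP \<gamma>\<in>?G. ?J \<alpha> \<gamma>)"
  proof -
    have "?G \<noteq> {}"
      using controls_nonempty Pi_bc_delta_nonempty by blast
    from enn2ereal_INF_SUP[OF this] show ?thesis
      by (simp add: dynamic_programming[symmetric])
  qed
  have main: "?I \<alpha> \<gamma> + ereal c \<le> ?J \<alpha> \<gamma> \<and> ?J \<alpha> \<gamma> + ereal (- (c + ?E)) \<le> ?I \<alpha> \<gamma>"
    if "\<alpha> \<in> controls N K" "\<gamma> \<in> ?G" for \<alpha> \<gamma>
    using that ereal_integral_penalized[OF _ _ c] by (auto simp: Pi_bc_delta_def)
  have 1: "robust_value p \<delta> K \<kappa> f N + ereal c \<le> enn2ereal (U 0 start)"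
    unfolding robust_value_def U by (rule INF_SUP_add_le) (use main in blast)
  have 2: "enn2ereal (U 0 start) + ereal (- (c + ?E)) \<le> robust_value p \<delta> K \<kappa> f N"
    unfolding robust_value_def U by (rule INF_SUP_add_le) (use main in blast)
  have 3: "V + ereal c \<le> enn2ereal (U 0 start)"
    unfolding V_def by (rule dpp_value_U) (use c in \<open>auto simp: space_PiM_empty\<close>)
  have 4: "enn2ereal (U 0 start) + ereal (- (c + ?E)) \<le> V"
    using dpp_value_U(2)[of 0 "\<lambda>_. undefined" "\<lambda>_. undefined" "\<lambda>_. undefined" c] c
    by (simp add: V_def err_def psum_def space_PiM_empty)
  show "robust_value p \<delta> K \<kappa> f N \<le> V + e"
    using 1 4 unfolding e_def
    by (cases "robust_value p \<delta> K \<kappa> f N"; cases V; cases "enn2ereal (U 0 start)") auto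
  show "V \<le> robust_value p \<delta> K \<kappa> f N + e"
    using 2 3 unfolding e_def
    by (cases "robust_value p \<delta> K \<kappa> f N"; cases V; cases "enn2ereal (U 0 start)") auto
qed

end

context robust_problem
begin

theorem robust_value_eq_dpp_value:
  assumes "bounded_below N f \<or> growth p N f \<and> kernel_prod \<kappa> N \<in> Pp p N"
  shows "robust_value p \<delta> K \<kappa> f N = dpp_value p \<delta> K \<kappa> f N 0 (\<lambda>_. undefined) (\<lambda>_. undefined) (\<lambda>_. undefined)"
    (is "?R = ?V")
proof -
  have approx: "?R \<le> ?V + ereal e \<and> ?V \<le> ?R + ereal e" if e: "0 < e" for e
  proof -
    let ?D = "real N * \<delta> powr p"
    \<comment> \<open>This makes \<open>\<tau> * ?D \<le> e\<close>; the summand 1 keeps the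
      denominator positive when \<open>N = 0\<close>.\<close>
    define \<tau> where "\<tau> = e / (?D + 1)"
    have D: "0 \<le> ?D" by simp
    then have \<tau>: "0 < \<tau>"
      unfolding \<tau>_def using e by (intro divide_pos_pos) linarith+
    have "\<tau> * ?D \<le> \<tau> * (?D + 1)"
      using \<tau> by (intro mult_left_mono) auto
    also have "\<dots> = e"
    proof -
      have "?D + 1 \<noteq> 0" using D by linarith
      then show ?thesis by (simp add: \<tau>_def)
    qed
    finally have \<tau>D: "\<tau> * ?D \<le> e" .
    obtain A \<theta> where A\<theta>: "0 \<le> A" "0 \<le> \<theta>" "\<theta> \<le> \<tau>" "\<theta> = 0 \<or> kernel_prod \<kappa> N \<in> Pp p N"
        "\<And>x y a. y \<in> space (Rn N) \<Longrightarrow> a \<in> {..<N} \<rightarrow>\<^sub>E K \<Longrightarrow>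
          0 \<le> f y a + (A + \<theta> * psum p N x + \<theta> * psum p N (\<lambda>i. y i - x i))"
      by (rule penalty_exists[OF f_lsc K_compact p_pos \<tau> assms]) (rule that)
    interpret penalized_problem N p \<delta> K \<kappa> f A \<theta>
      using A\<theta> by unfold_locales auto
    have "\<theta> * ?D \<le> \<tau> * ?D"
      using A\<theta>(3) D by (intro mult_right_mono)
    then have "ereal (\<theta> * ?D) \<le> ereal e"
      using \<tau>D by simp
    then have m: "?V + ereal (\<theta> * ?D) \<le> ?V + ereal e" "?R + ereal (\<theta> * ?D) \<le> ?R + ereal e"
      by (simp_all add: add_left_mono)
    show ?thesis
      using order_trans[OF robust_value_approx(1) m(1)] order_trans[OF robust_value_approx(2) m(2)]
      by (rule conjI)
  qed
  show ?thesis
  proof (rule antisym)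
    show "?R \<le> ?V"
      by (rule ereal_le_epsilon2) (rule approx[THEN conjunct1])
    show "?V \<le> ?R"
      by (rule ereal_le_epsilon2) (rule approx[THEN conjunct2])
  qed
qed

end

section \<open>The problem started at a later time\<close>

lemma glue_in_Rn: "glue t s x z \<in> space (Rn (t + s))"
  by (auto simp: glue_def space_PiM)

lemma glue_0: "glue t 0 x z = restrict x {..<t}"
  by (auto simp: glue_def restrict_def)

lemma glue_upd: "glue t (Suc s) x (z(s := u)) = (glue t s x z)(t + s := u)"
  by (auto simp: glue_def restrict_def fun_eq_iff)

lemma glue_inj:
  assumes "glue t s x z = glue t s x z'" and "z \<in> extensional {..<s}" and "z' \<in> extensional {..<s}"
  shows "z = z'"
proof (rule extensionalityI[OF assms(2,3)])
  fix i assume "i \<in> {..<s}"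
  then show "z i = z' i"
    using fun_cong[OF assms(1), of "t + i"] by (simp add: glue_def)
qed

lemma measurable_glue: "glue t s x \<in> Rn s \<rightarrow>\<^sub>M Rn (t + s)"
  unfolding glue_def
proof (rule measurable_restrict)
  fix i assume "i \<in> {..<t + s}"
  then show "(\<lambda>z. if i < t then x i else z (i - t)) \<in> Rn s \<rightarrow>\<^sub>M (borel :: real measure)"
    by (cases "i < t") (auto intro!: measurable_component_singleton)
qed

lemma continuous_map_glue: "continuous_map (Rn_top s) (Rn_top (t + s)) (glue t s x)"
proof -
  have "continuous_map (Rn_top s) euclideanreal (\<lambda>z. glue t s x z i)" if "i < t + s" for i
  proof (cases "i < t")
    case False
    with that have "continuous_map (Rn_top s) euclideanreal (\<lambda>z. z (i - t))"
      by (intro continuous_map_product_projection) auto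
    with False that show ?thesis by (simp add: glue_def)
  qed (use that in \<open>simp add: glue_def\<close>)
  then show ?thesis
    by (auto simp: continuous_map_componentwise glue_def)
qed

text \<open>\<open>glue t s x\<close> is continuous and injective on extensional paths; injectivity
  carries punctured neighbourhoods into punctured neighbourhoods, as \<open>atin\<close>
  demands.\<close>

lemma filterlim_glue_atin:
  assumes z: "z \<in> topspace (Rn_top s)"
  shows "filterlim (glue t s x) (atin (Rn_top (t + s)) (glue t s x z)) (atin (Rn_top s) z)"
  unfolding filterlim_iff
proof (intro allI impI)
  fix P assume P: "eventually P (atin (Rn_top (t + s)) (glue t s x z))"
  have "glue t s x z \<in> topspace (Rn_top (t + s))"
    by (auto simp: glue_def)
  with P obtain Q where Q: "openin (Rn_top (t + s)) Q" "glue t s x z \<in> Q"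
      "\<forall>w\<in>Q - {glue t s x z}. P w"
    unfolding eventually_atin by blast
  let ?Q = "{w \<in> topspace (Rn_top s). glue t s x w \<in> Q}"
  have "openin (Rn_top s) ?Q"
    by (rule openin_continuous_map_preimage[OF continuous_map_glue Q(1)])
  moreover have "P (glue t s x w)" if "w \<in> ?Q - {z}" for w
  proof -
    have "w \<in> extensional {..<s}" "z \<in> extensional {..<s}"
      using that z by (auto simp: PiE_iff)
    then have "glue t s x w \<noteq> glue t s x z"
      using that glue_inj by blast
    then show ?thesis using Q(3) that by blast
  qed
  ultimately show "eventually (\<lambda>w. P (glue t s x w)) (atin (Rn_top s) z)"
    unfolding eventually_atin using z Q(2) by blast
qed

text \<open>Positive \<open>q\<close> is treated by comparison with twice the maximum, other
  \<open>q\<close> by antitonicity. Both occur because \<open>p - \<epsilon>\<close> may have either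
  sign.\<close>

lemma powr_add_le:
  fixes A B q :: real
  assumes "0 \<le> A" "0 \<le> B"
  shows "(A + B) powr q \<le> 2 powr \<bar>q\<bar> * (A powr q + B powr q)"
proof (cases "0 < q")
  case True
  have "(A + B) powr q \<le> (2 * max A B) powr q"
    using assms True by (intro powr_mono2) (auto simp: max_def)
  also have "\<dots> = 2 powr q * max A B powr q"
    using assms by (simp add: powr_mult)
  also have "\<dots> \<le> 2 powr q * (A powr q + B powr q)"
    by (intro mult_left_mono) (auto simp: max_def)
  finally show ?thesis using True by simp
next
  case False
  have "(A + B) powr q \<le> A powr q + B powr q"
  \<comment> \<open>Since \<open>0 powr q = 0\<close>, antitonicity of negative powers fails at 0,
    so this case is separate.\<close>
  proof (cases "B = 0")
    case False
    then have "(A + B) powr q \<le> B powr q"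
      using assms \<open>\<not> 0 < q\<close> by (intro powr_mono2') auto
    then show ?thesis by (simp add: add_increasing)
  qed simp
  also have "\<dots> \<le> 2 powr \<bar>q\<bar> * (A powr q + B powr q)"
  proof -
    have "1 \<le> 2 powr \<bar>q\<bar>" by (intro ge_one_powr_ge_zero) auto
    then have "1 * (A powr q + B powr q) \<le> 2 powr \<bar>q\<bar> * (A powr q + B powr q)"
      by (intro mult_right_mono) auto
    then show ?thesis by simp
  qed
  finally show ?thesis .
qed

lemma sum_lessThan_add: "(\<Sum>i<t + s. h i) = (\<Sum>i<t. h i) + (\<Sum>i<s. h (t + i :: nat) :: real)"
  by (induction s) auto

lemma psum_glue: "psum p (t + s) (glue t s x z) = psum p t x + psum p s z"
  unfolding psum_def sum_lessThan_add by (simp add: glue_def)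

definition tail_cost :: "nat \<Rightarrow> nat \<Rightarrow> (path \<Rightarrow> path \<Rightarrow> real) \<Rightarrow> path \<Rightarrow> path \<Rightarrow> path \<Rightarrow> path \<Rightarrow> real" where
  "tail_cost t n f y a v b = f (glue t n y v) (glue t n a b)"

lemma bounded_below_tail:
  assumes "bounded_below (t + n) f"
  shows "bounded_below n (tail_cost t n f y a)"
  using assms glue_in_Rn unfolding bounded_below_def tail_cost_def by blast

text \<open>In terms of \<open>psum\<close> the growth exponent is
  \<open>(p - \<epsilon>) / p\<close>, and \<open>psum\<close> is additive under
  \<open>glue\<close>; the contribution of the fixed prefix \<open>y\<close> is absorbed into the
  constant.\<close>

lemma growth_tail:
  assumes "growth p (t + n) f"
  shows "growth p n (tail_cost t n f y a)"
proof -
  obtain \<epsilon> C where \<epsilon>: "0 < \<epsilon>"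
      and C: "\<And>x a. x \<in> space (Rn (t + n)) \<Longrightarrow> a \<in> space (Rn (t + n)) \<Longrightarrow> \<bar>f x a\<bar> \<le> C * (1 + pnorm p (t + n) x powr (p - \<epsilon>))"
    using assms by (auto simp: growth_def)
  define q where "q = 1 / p * (p - \<epsilon>)"
  have pn: "pnorm p k z powr (p - \<epsilon>) = psum p k z powr q" for k z
    by (simp add: pnorm_def psum_def powr_powr q_def)
  let ?D = "2 powr \<bar>q\<bar>"
  have "\<bar>tail_cost t n f y a v b\<bar> \<le> \<bar>C\<bar> * (1 + ?D + ?D * psum p t y powr q) * (1 + pnorm p n v powr (p - \<epsilon>))" for v b
  proof -
    have "\<bar>tail_cost t n f y a v b\<bar> \<le> C * (1 + psum p (t + n) (glue t n y v) powr q)"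
      unfolding tail_cost_def pn[symmetric] by (intro C glue_in_Rn)
    also have "\<dots> \<le> \<bar>C\<bar> * (1 + psum p (t + n) (glue t n y v) powr q)"
      by (intro mult_right_mono) auto
    also have "\<dots> \<le> \<bar>C\<bar> * (1 + ?D * (psum p t y powr q + psum p n v powr q))"
      unfolding psum_glue by (intro mult_left_mono add_left_mono powr_add_le psum_nonneg) auto
    also have "\<dots> \<le> \<bar>C\<bar> * ((1 + ?D + ?D * psum p t y powr q) * (1 + psum p n v powr q))"
      by (intro mult_left_mono) (auto simp: algebra_simps)
    finally show ?thesis
      by (simp add: pn mult.assoc)
  qed
  with \<epsilon> show ?thesis
    unfolding growth_def by blast
qed

lemma lower_semicont_tail:
  assumes "lower_semicont (t + n) f"
  shows "lower_semicont n (tail_cost t n f y a)"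
  unfolding lower_semicont_def
proof
  fix c
  let ?h = "\<lambda>z. (glue t n y (fst z), glue t n a (snd z))"
  have "openin (prod_topology (Rn_top (t + n)) (Rn_top (t + n)))
      {(x, a). x \<in> space (Rn (t + n)) \<and> a \<in> space (Rn (t + n)) \<and> c < f x a}"
    using assms by (auto simp: lower_semicont_def)
  moreover have "continuous_map (prod_topology (Rn_top n) (Rn_top n)) (prod_topology (Rn_top (t + n)) (Rn_top (t + n))) ?h"
    by (intro continuous_map_pairedI continuous_map_compose[OF continuous_map_fst continuous_map_glue, unfolded o_def]
        continuous_map_compose[OF continuous_map_snd continuous_map_glue, unfolded o_def])
  ultimately have "openin (prod_topology (Rn_top n) (Rn_top n)) {z \<in> topspace (prod_topology (Rn_top n) (Rn_top n)).
      ?h z \<in> {(x, a). x \<in> space (Rn (t + n)) \<and> a \<in> space (Rn (t + n)) \<and> c < f x a}}"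
    by (intro openin_continuous_map_preimage)
  also have "{z \<in> topspace (prod_topology (Rn_top n) (Rn_top n)).
      ?h z \<in> {(x, a). x \<in> space (Rn (t + n)) \<and> a \<in> space (Rn (t + n)) \<and> c < f x a}} =
      {(v, b). v \<in> space (Rn n) \<and> b \<in> space (Rn n) \<and> c < tail_cost t n f y a v b}"
    using glue_in_Rn by (auto simp: space_PiM tail_cost_def)
  finally show "openin (prod_topology (Rn_top n) (Rn_top n))
      {(v, b). v \<in> space (Rn n) \<and> b \<in> space (Rn n) \<and> c < tail_cost t n f y a v b}" .
qed

text \<open>The recursion sees histories only through the kernels and the terminal cost, so fixing a
  prefix and shifting time commutes with it.\<close>

lemma dpp_value_tail:
  assumes "s \<le> n"
  shows "dpp_value p \<delta> K (tail_kernels t x \<kappa>) (tail_cost t n f y a) n s u v b =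
    dpp_value p \<delta> K \<kappa> f (t + n) (t + s) (glue t s x u) (glue t s y v) (glue t s a b)"
  using assms
proof (induction s arbitrary: u v b rule: inc_induct)
  case base
  show ?case
    by (simp add: dpp_value.simps tail_cost_def)
next
  case (step s)
  have s: "\<not> n \<le> s" "\<not> t + n \<le> t + s"
    using step.hyps by auto
  have eq: "dpp_value p \<delta> K (tail_kernels t x \<kappa>) (tail_cost t n f y a) n (Suc s) (u(s := w)) (v(s := w')) (b(s := c)) =
      dpp_value p \<delta> K \<kappa> f (t + n) (Suc (t + s)) ((glue t s x u)(t + s := w)) ((glue t s y v)(t + s := w')) ((glue t s a b)(t + s := c))"
    for w w' c
    by (simp only: step.IH glue_upd add_Suc_right)
  show ?case
    by (subst (1 2) dpp_value.simps) (simp only: s eq tail_kernels_def if_False)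
qed

lemma controls_eq_iff:
  "\<alpha> \<in> controls N K \<longleftrightarrow> \<alpha> \<in> Rn2 N \<rightarrow>\<^sub>M Rn N \<and>
     (\<forall>x y t. x \<in> space (Rn N) \<longrightarrow> y \<in> space (Rn N) \<longrightarrow> t < N \<longrightarrow> \<alpha> (x, y) t \<in> K) \<and>
     (\<forall>x y x' y' t. x \<in> space (Rn N) \<longrightarrow> y \<in> space (Rn N) \<longrightarrow> x' \<in> space (Rn N) \<longrightarrow> y' \<in> space (Rn N) \<longrightarrow> t < N \<longrightarrow>
        (\<forall>i<t. x i = x' i \<and> y i = y' i) \<longrightarrow> \<alpha> (x, y) t = \<alpha> (x', y') t)"
  unfolding controls_def by blast

text \<open>The prefixes \<open>x\<close> and \<open>y\<close> are frozen and the first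
  \<open>t\<close> controls dropped. By \<open>controls_from\<close> these are \<open>a\<close>, so
  gluing \<open>a\<close> in front restores the control on all paths with these prefixes.\<close>

lemma controls_from_tail:
  fixes x y :: path
  assumes \<alpha>: "\<alpha> \<in> controls_from (t + n) K t a"
  defines "\<beta> \<equiv> \<lambda>uv. \<lambda>i\<in>{..<n}. \<alpha> (glue t n x (fst uv), glue t n y (snd uv)) (t + i)"
  shows "\<beta> \<in> controls n K"
    and "\<And>u v. glue t n a (\<beta> (u, v)) = \<alpha> (glue t n x u, glue t n y v)"
proof -
  have meas: "\<alpha> \<in> Rn2 (t + n) \<rightarrow>\<^sub>M Rn (t + n)"
      and K: "\<And>x y s. x \<in> space (Rn (t + n)) \<Longrightarrow> y \<in> space (Rn (t + n)) \<Longrightarrow> s < t + n \<Longrightarrow> \<alpha> (x, y) s \<in> K"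
      and pred: "\<And>x y x' y' s. x \<in> space (Rn (t + n)) \<Longrightarrow> y \<in> space (Rn (t + n)) \<Longrightarrow>
        x' \<in> space (Rn (t + n)) \<Longrightarrow> y' \<in> space (Rn (t + n)) \<Longrightarrow> s < t + n \<Longrightarrow>
        (\<forall>i<s. x i = x' i \<and> y i = y' i) \<Longrightarrow> \<alpha> (x, y) s = \<alpha> (x', y') s"
      and init: "\<And>x y i. x \<in> space (Rn (t + n)) \<Longrightarrow> y \<in> space (Rn (t + n)) \<Longrightarrow> i < t \<Longrightarrow> \<alpha> (x, y) i = a i"
    using \<alpha> unfolding controls_from_def controls_eq_iff mem_Collect_eq by blast+
  have "\<beta> \<in> Rn2 n \<rightarrow>\<^sub>M Rn n"
    unfolding \<beta>_def
  proof (rule measurable_restrict)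
    fix i assume i: "i \<in> {..<n}"
    note [measurable] = measurable_glue[of t n] meas
    have "(\<lambda>uv. \<alpha> (glue t n x (fst uv), glue t n y (snd uv))) \<in> Rn2 n \<rightarrow>\<^sub>M Rn (t + n)"
      by measurable
    then show "(\<lambda>uv. \<alpha> (glue t n x (fst uv), glue t n y (snd uv)) (t + i)) \<in> Rn2 n \<rightarrow>\<^sub>M (borel :: real measure)"
      by (rule measurable_compose[OF _ measurable_component_singleton]) (use i in simp)
  qed
  moreover have "\<beta> (u, v) s = \<beta> (u', v') s" if "s < n" "\<forall>i<s. u i = u' i \<and> v i = v' i" for u v u' v' s
  proof -
    have "\<alpha> (glue t n x u, glue t n y v) (t + s) = \<alpha> (glue t n x u', glue t n y v') (t + s)"
      using that by (intro pred glue_in_Rn) (auto simp: glue_def)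
    with that show ?thesis by (simp add: \<beta>_def)
  qed
  moreover have "\<beta> (u, v) s \<in> K" if "s < n" for u v s
    using that K[OF glue_in_Rn glue_in_Rn, of "t + s"] by (simp add: \<beta>_def)
  ultimately show "\<beta> \<in> controls n K"
    unfolding controls_eq_iff by blast
  fix u v
  have sp: "\<alpha> (glue t n x u, glue t n y v) \<in> space (Rn (t + n))"
    using measurable_space[OF meas, of "(glue t n x u, glue t n y v)"] glue_in_Rn
    by (simp add: space_pair_measure)
  show "glue t n a (\<beta> (u, v)) = \<alpha> (glue t n x u, glue t n y v)"
  proof
    fix i
    consider "i < t" | "t \<le> i" "i < t + n" | "t + n \<le> i" by linarith
    then show "glue t n a (\<beta> (u, v)) i = \<alpha> (glue t n x u, glue t n y v) i"
    proof cases
      case 1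
      then show ?thesis using init[OF glue_in_Rn glue_in_Rn] by (simp add: glue_def)
    next
      case 2
      then have "glue t n a (\<beta> (u, v)) i = \<beta> (u, v) (i - t)"
        by (simp add: glue_def)
      also have "\<dots> = \<alpha> (glue t n x u, glue t n y v) i"
        using 2 less_diff_conv2[of t i n] by (simp add: \<beta>_def add.commute)
      finally show ?thesis .
    next
      case 3
      then show ?thesis using sp by (simp add: glue_def space_PiM PiE_iff extensional_def)
    qed
  qed
qed

definition tail_path :: "nat \<Rightarrow> nat \<Rightarrow> path \<Rightarrow> path" where
  "tail_path t n x = (\<lambda>i\<in>{..<n}. x (t + i))"

lemma tail_path_in_Rn: "tail_path t n x \<in> space (Rn n)"
  by (auto simp: tail_path_def space_PiM)

lemma tail_path_glue: "z \<in> space (Rn n) \<Longrightarrow> tail_path t n (glue t n x z) = z"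
  by (auto simp: tail_path_def glue_def space_PiM PiE_iff extensional_def fun_eq_iff)

lemma measurable_tail_path: "tail_path t n \<in> Rn (t + n) \<rightarrow>\<^sub>M Rn n"
  unfolding tail_path_def by (intro measurable_restrict measurable_component_singleton) auto

text \<open>In the converse direction the extended control ignores the first \<open>t\<close>
  coordinates; an entry \<open>s \<ge> t\<close> then sees tail coordinates below
  \<open>s - t\<close>, that is, coordinates below \<open>s\<close>.\<close>

lemma controls_extend:
  assumes \<beta>: "\<beta> \<in> controls n K" and a: "a \<in> {..<t} \<rightarrow>\<^sub>E K"
  defines "\<alpha> \<equiv> \<lambda>xy. glue t n a (\<beta> (tail_path t n (fst xy), tail_path t n (snd xy)))"
  shows "\<alpha> \<in> controls_from (t + n) K t a"
proof -
  have meas: "\<beta> \<in> Rn2 n \<rightarrow>\<^sub>M Rn n"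
      and K: "\<And>x y s. x \<in> space (Rn n) \<Longrightarrow> y \<in> space (Rn n) \<Longrightarrow> s < n \<Longrightarrow> \<beta> (x, y) s \<in> K"
      and pred: "\<And>x y x' y' s. x \<in> space (Rn n) \<Longrightarrow> y \<in> space (Rn n) \<Longrightarrow>
        x' \<in> space (Rn n) \<Longrightarrow> y' \<in> space (Rn n) \<Longrightarrow> s < n \<Longrightarrow>
        (\<forall>i<s. x i = x' i \<and> y i = y' i) \<Longrightarrow> \<beta> (x, y) s = \<beta> (x', y') s"
    using \<beta> unfolding controls_eq_iff by blast+
  have "\<alpha> \<in> Rn2 (t + n) \<rightarrow>\<^sub>M Rn (t + n)"
  proof -
    note [measurable] = measurable_tail_path[of t n] meas
    have "(\<lambda>xy. \<beta> (tail_path t n (fst xy), tail_path t n (snd xy))) \<in> Rn2 (t + n) \<rightarrow>\<^sub>M Rn n"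
      by measurable
    from measurable_compose[OF this measurable_glue] show ?thesis
      by (simp add: \<alpha>_def)
  qed
  moreover have "\<alpha> (x, y) s \<in> K" if "s < t + n" for x y s
  proof (cases "s < t")
    case True
    with a that show ?thesis by (auto simp: \<alpha>_def glue_def)
  next
    case False
    with that K[OF tail_path_in_Rn tail_path_in_Rn, of "s - t"] show ?thesis by (simp add: \<alpha>_def glue_def)
  qed
  moreover have "\<alpha> (x, y) s = \<alpha> (x', y') s" if s: "s < t + n" "\<forall>i<s. x i = x' i \<and> y i = y' i" for x y x' y' s
  proof (cases "s < t")
    case True
    with s show ?thesis by (simp add: \<alpha>_def glue_def)
  next
    case False
    have "\<beta> (tail_path t n x, tail_path t n y) (s - t) = \<beta> (tail_path t n x', tail_path t n y') (s - t)"
      using s False by (intro pred tail_path_in_Rn) (auto simp: tail_path_def)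
    with s False show ?thesis by (simp add: \<alpha>_def glue_def)
  qed
  moreover have "\<alpha> (x, y) i = a i" if "i < t" for x y i
    using that by (simp add: \<alpha>_def glue_def)
  ultimately show ?thesis
    unfolding controls_from_def controls_eq_iff by blast
qed

lemma ereal_integral_cong:
  "(\<And>z. z \<in> space M \<Longrightarrow> V z = W z) \<Longrightarrow> ereal_integral M V = ereal_integral M W"
  by (intro antisym ereal_integral_mono_AE AE_I2) auto

lemma space_Pi_bc_delta:
  assumes "\<gamma> \<in> Pi_bc_delta p \<delta> n \<kappa>"
  shows "space \<gamma> = space (Rn2 n)"
proof -
  obtain g where \<gamma>: "\<gamma> = pair_kernel_prod g n" "delta_kernels p \<delta> n \<kappa> g"
    using assms by (auto simp: Pi_bc_delta_def)
  interpret pair_kernels g n by (rule pair_kernels_delta_kernels[OF \<gamma>(2)])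
  show ?thesis
    unfolding \<gamma>(1) by (rule space_pair_kernel_prod) simp
qed

text \<open>Freezing the prefix and extending controls map the two control sets into each other
  without changing the cost, so the infima agree.\<close>

lemma cost_to_go_eq_robust_value:
  assumes a: "a \<in> {..<t} \<rightarrow>\<^sub>E K"
  shows "cost_to_go p \<delta> K \<kappa> f (t + n) t x y a =
    robust_value p \<delta> K (tail_kernels t x \<kappa>) (tail_cost t n f y a) n"
proof -
  let ?G = "Pi_bc_delta p \<delta> n (tail_kernels t x \<kappa>)"
  let ?I = "\<lambda>\<alpha>. SUP \<gamma>\<in>?G. ereal_integral \<gamma> (\<lambda>(u, v). ereal (f (glue t n y v) (\<alpha> (glue t n x u, glue t n y v))))"
  let ?J = "\<lambda>\<beta>. SUP \<gamma>\<in>?G. ereal_integral \<gamma> (\<lambda>(u, v). ereal (tail_cost t n f y a v (\<beta> (u, v))))"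
  have "(INF \<alpha>\<in>controls_from (t + n) K t a. ?I \<alpha>) = (INF \<beta>\<in>controls n K. ?J \<beta>)"
  proof (rule antisym)
    show "(INF \<alpha>\<in>controls_from (t + n) K t a. ?I \<alpha>) \<le> (INF \<beta>\<in>controls n K. ?J \<beta>)"
    proof (rule INF_greatest)
      fix \<beta> assume \<beta>: "\<beta> \<in> controls n K"
      let ?\<alpha> = "\<lambda>xy. glue t n a (\<beta> (tail_path t n (fst xy), tail_path t n (snd xy)))"
      have "?I ?\<alpha> = ?J \<beta>"
      proof (rule SUP_cong[OF refl], rule ereal_integral_cong)
        fix \<gamma> z assume "\<gamma> \<in> ?G" "z \<in> space \<gamma>"
        then have "z \<in> space (Rn2 n)"
          by (simp add: space_Pi_bc_delta)
        then show "(case z of (u, v) \<Rightarrow> ereal (f (glue t n y v) (?\<alpha> (glue t n x u, glue t n y v)))) =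
            (case z of (u, v) \<Rightarrow> ereal (tail_cost t n f y a v (\<beta> (u, v))))"
          by (cases z) (simp add: space_pair_measure tail_path_glue tail_cost_def)
      qed
      with controls_extend[OF \<beta> a] show "(INF \<alpha>\<in>controls_from (t + n) K t a. ?I \<alpha>) \<le> ?J \<beta>"
        by (intro INF_lower2[of ?\<alpha>]) auto
    qed
    show "(INF \<beta>\<in>controls n K. ?J \<beta>) \<le> (INF \<alpha>\<in>controls_from (t + n) K t a. ?I \<alpha>)"
    proof (rule INF_greatest)
      fix \<alpha> assume \<alpha>: "\<alpha> \<in> controls_from (t + n) K t a"
      let ?\<beta> = "\<lambda>uv. \<lambda>i\<in>{..<n}. \<alpha> (glue t n x (fst uv), glue t n y (snd uv)) (t + i)"
      have "?J ?\<beta> = ?I \<alpha>"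
        unfolding tail_cost_def controls_from_tail(2)[OF \<alpha>] ..
      with controls_from_tail(1)[OF \<alpha>, of x y] show "(INF \<beta>\<in>controls n K. ?J \<beta>) \<le> ?I \<alpha>"
        by (intro INF_lower2[of ?\<beta>]) auto
    qed
  qed
  then show ?thesis
    by (simp add: cost_to_go_def robust_value_def)
qed

lemma (in robust_problem) robust_problem_tail:
  assumes "t \<le> N"
  shows "robust_problem (N - t) p \<delta> K (tail_kernels t x \<kappa>) (tail_cost t (N - t) f y a)"
proof
  show "tail_kernels t x \<kappa> s \<in> Rn s \<rightarrow>\<^sub>M prob_algebra borel" if "s < N - t" for s
    using measurable_compose[OF measurable_glue \<kappa>_meas, of t s x] that
    by (simp add: tail_kernels_def[abs_def])
  show "successively_continuous p (N - t) (tail_kernels t x \<kappa>)"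
    unfolding successively_continuous_def
  proof (intro allI impI ballI)
    fix s z assume s: "s < N - t" and z: "z \<in> space (Rn s)"
    have \<kappa>: "\<kappa> (t + s) (glue t s x z) \<in> Pp_real p"
        "((\<lambda>w. wasserstein p (\<kappa> (t + s) w) (\<kappa> (t + s) (glue t s x z))) \<longlongrightarrow> 0) (atin (Rn_top (t + s)) (glue t s x z))"
      using \<kappa>_cont s glue_in_Rn[of t s x z] by (simp_all add: successively_continuous_def)
    have "filterlim (glue t s x) (atin (Rn_top (t + s)) (glue t s x z)) (atin (Rn_top s) z)"
      using z by (intro filterlim_glue_atin) (simp add: space_PiM)
    from filterlim_compose[OF \<kappa>(2) this] \<kappa>(1)
    show "tail_kernels t x \<kappa> s z \<in> Pp_real p \<and>
        ((\<lambda>z'. wasserstein p (tail_kernels t x \<kappa> s z') (tail_kernels t x \<kappa> s z)) \<longlongrightarrow> 0) (atin (Rn_top s) z)"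
      unfolding tail_kernels_def by (rule conjI[rotated])
  qed
  show "lower_semicont (N - t) (tail_cost t (N - t) f y a)"
    using lower_semicont_tail[of t "N - t" f] f_lsc assms by simp
qed (use p_pos \<delta>_pos K_compact K_ne in auto)

text \<open>About the moment condition in the second part: \<open>\<mu> \<in> Pp p N\<close> bounds
  moments of the conditional laws only for almost every prefix, while the cost-to-go identity is
  claimed at each single prefix. The penalty argument uses a finite moment there unless
  \<open>f\<close> is bounded below.\<close>

theorem theorem4p7:
  fixes N :: nat and p \<delta> :: real and K :: "real set"
    and \<mu> :: "(nat \<Rightarrow> real) measure"
    and \<kappa> :: "nat \<Rightarrow> (nat \<Rightarrow> real) \<Rightarrow> real measure"
    and f :: "(nat \<Rightarrow> real) \<Rightarrow> (nat \<Rightarrow> real) \<Rightarrow> real"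
  assumes "1 \<le> p" and "0 < \<delta>"
    and "compact K" and "K \<noteq> {}"
    and "\<mu> \<in> Pp p N"
    and "disintegration N \<mu> \<kappa>"
    and "successively_continuous p N \<kappa>"
    and "lower_semicont N f"
    and "(\<exists>c. \<forall>x\<in>space (Rn N). \<forall>a\<in>space (Rn N). c \<le> f x a) \<or>
         (\<exists>\<epsilon>>0. \<exists>C. \<forall>x\<in>space (Rn N). \<forall>a\<in>space (Rn N).
            \<bar>f x a\<bar> \<le> C * (1 + pnorm p N x powr (p - \<epsilon>)))"
  shows "robust_value p \<delta> K \<kappa> f N =
           dpp_value p \<delta> K \<kappa> f N 0 (\<lambda>_. undefined) (\<lambda>_. undefined) (\<lambda>_. undefined)
       \<and> (\<forall>t\<le>N. \<forall>x\<in>space (Rn t). \<forall>y\<in>space (Rn t). \<forall>a\<in>{..<t} \<rightarrow>\<^sub>E K.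
            (\<exists>c. \<forall>x'\<in>space (Rn N). \<forall>a'\<in>space (Rn N). c \<le> f x' a') \<or>
            kernel_prod (tail_kernels t x \<kappa>) (N - t) \<in> Pp p (N - t)
            \<longrightarrow> dpp_value p \<delta> K \<kappa> f N t x y a = cost_to_go p \<delta> K \<kappa> f N t x y a)"
proof -
  have \<mu>: "\<mu> = kernel_prod \<kappa> N"
    using assms(6) by (simp add: disintegration_def)
  have fb: "bounded_below N f \<or> growth p N f"
    using assms(9) unfolding bounded_below_def growth_def .
  interpret robust_problem N p \<delta> K \<kappa> f
    using assms by unfold_locales (auto simp: disintegration_def)
  have "robust_value p \<delta> K \<kappa> f N =
      dpp_value p \<delta> K \<kappa> f N 0 (\<lambda>_. undefined) (\<lambda>_. undefined) (\<lambda>_. undefined)"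
    using fb assms(5) unfolding \<mu> by (intro robust_value_eq_dpp_value) blast
  moreover have "dpp_value p \<delta> K \<kappa> f N t x y a = cost_to_go p \<delta> K \<kappa> f N t x y a"
    if t: "t \<le> N" and x: "x \<in> space (Rn t)" and y: "y \<in> space (Rn t)" and a: "a \<in> {..<t} \<rightarrow>\<^sub>E K"
      and b: "bounded_below N f \<or> kernel_prod (tail_kernels t x \<kappa>) (N - t) \<in> Pp p (N - t)"
    for t x y a
  proof -
    let ?n = "N - t"
    have N: "N = t + ?n" using t by simp
    \<comment> \<open>With the prefix frozen, the remaining \<open>N - t\<close> coordinates form a
      problem of the same kind, and the cost-to-go identity is its equality of values at time
      0.\<close>
    interpret tail: robust_problem ?n p \<delta> K "tail_kernels t x \<kappa>" "tail_cost t ?n f y a"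
      by (rule robust_problem_tail[OF t])
    have "bounded_below ?n (tail_cost t ?n f y a) \<or>
        growth p ?n (tail_cost t ?n f y a) \<and> kernel_prod (tail_kernels t x \<kappa>) ?n \<in> Pp p ?n"
      using fb b bounded_below_tail[of t ?n f] growth_tail[of p t ?n f] unfolding N[symmetric] by blast
    from tail.robust_value_eq_dpp_value[OF this]
    have "cost_to_go p \<delta> K \<kappa> f (t + ?n) t x y a =
        dpp_value p \<delta> K (tail_kernels t x \<kappa>) (tail_cost t ?n f y a) ?n 0 (\<lambda>_. undefined) (\<lambda>_. undefined) (\<lambda>_. undefined)"
      by (simp only: cost_to_go_eq_robust_value[OF a])
    also have "\<dots> = dpp_value p \<delta> K \<kappa> f (t + ?n) t x y a"
      using x y a by (simp add: dpp_value_tail glue_0 restrict_Rn PiE_restrict)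
    finally show ?thesis
      using t by simp
  qed
  ultimately show ?thesis
    unfolding bounded_below_def by blast
qed

end
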